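(* Let $H_1,H_2$ be ordered graphs without isolated vertices and with $m_1,m_2$ edges, respectively. Then \[ r_<(H_1, H_2) \leq e^{10^8 (m_1m_2)^{1/4} (\log \log (m_1 + m_2))^{3/2}}. \]
   Context: An ordered graph on $n$ vertices is a graph on vertex set $\{1,\dots,n\}$ with its natural order. An ordered graph $G$ contains an ordered graph $H$ on $[n]$ if there is a map $\phi:V(H)\to V(G)$ with $\phi(i)<\phi(j)$ for $i<j$ and $\phi(i)\phi(j)\in E(G)$ whenever $ij\in E(H)$. For ordered graphs $H_1,H_2$, $r_<(H_1,H_2)$ is the minimum integer $N$ such that every red-blue coloring of the edges of the complete ordered graph on $[N]$ contains a red ordered copy of $H_1$ or a blue ordered copy of $H_2$. Logarithms are natural. *)

theory Defs
  imports Complex_Main "HOL-Library.Ramsey"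
begin

datatype ograph = OGraph (order: nat) (edges: "nat set set")

abbreviation verts :: "ograph \<Rightarrow> nat set" where
  "verts G \<equiv> {1..order G}"

definition ordered_graph :: "ograph \<Rightarrow> bool" where
  "ordered_graph G \<longleftrightarrow> edges G \<subseteq> nsets (verts G) 2"

definition no_isolated_vertices :: "ograph \<Rightarrow> bool" where
  "no_isolated_vertices G \<longleftrightarrow> (\<forall>v\<in>verts G. \<exists>e\<in>edges G. v \<in> e)"

definition contains_ordered :: "ograph \<Rightarrow> ograph \<Rightarrow> bool" where
  "contains_ordered G H \<longleftrightarrow>
     (\<exists>\<phi>. \<phi> ` verts H \<subseteq> verts G \<and> strict_mono_on (verts H) \<phi> \<and>
       (\<forall>i\<in>verts H. \<forall>j\<in>verts H. {i, j} \<in> edges H \<longrightarrow> {\<phi> i, \<phi> j} \<in> edges G))"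

datatype colour = Red | Blue

definition colour_class :: "nat \<Rightarrow> (nat set \<Rightarrow> colour) \<Rightarrow> colour \<Rightarrow> ograph" where
  "colour_class N \<chi> c = OGraph N {e \<in> nsets {1..N} 2. \<chi> e = c}"

definition ordered_ramsey :: "ograph \<Rightarrow> ograph \<Rightarrow> nat" where
  "ordered_ramsey H1 H2 = (LEAST N. \<forall>\<chi>.
     contains_ordered (colour_class N \<chi> Red) H1 \<or> contains_ordered (colour_class N \<chi> Blue) H2)"

end

theory Submission
  imports Defs
begin

text \<open>
  Embedding an ordered graph greedily in one colour either succeeds or stops at a pair of large sets,
  one entirely before the other, between which that colour has tiny density. The failure is as useful
  as the success. Almost everything between the two sets has the other colour, so a clique in that
  colour can be nearly doubled, and a graph whose vertices are cut into an initial and a final segment,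
  each spanning at most half of its edges, can be embedded by placing one segment in each set.

  The greedy embedding costs a factor exponential in the degrees. To avoid this for the few vertices
  of high degree, they are placed in a clique first: if every set of \<open>M\<close> vertices contains a clique,
  then supersaturation gives a clique such that each of its vertices is joined to a large set near
  every other one, and the vertices of low degree are embedded greedily into these sets.

  If there is no red \<open>H\<^sub>1\<close> and no blue \<open>H\<^sub>2\<close>, with \<open>a \<ge> b\<close> edges, then alternating these steps produces
  red cliques: first from the absence of a blue copy of a graph alone, then, starting from size about
  \<open>(ab)\<^sup>1\<^sup>/\<^sup>4\<close>, by growing the clique by a factor \<open>3/2\<close> in each of \<open>O(log log (a + b))\<close> rounds. Placing the
  vertices of \<open>H\<^sub>1\<close> of high degree in such a clique gives a sparse red pair, whence \<open>H\<^sub>2\<close> can be replaced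
  by a graph with half as many edges. If \<open>b\<close> is much smaller than \<open>a\<close>, a plain greedy embedding of
  \<open>H\<^sub>2\<close> halves \<open>H\<^sub>1\<close> instead. The exponent decreases geometrically, so the costs of all halvings add up
  to a constant multiple of the first one.
\<close>

section \<open>Greedy embeddings and sparse pairs\<close>

text \<open>The cost of a step is the logarithm of the size of the vertex set it needs. Let
  \<open>G = (ab)^(1/4)\<close>, \<open>L\<close> the logarithm of the number of edges,
  \<open>l = ln L\<close>, and let the smaller graph have \<open>b = B^4\<close> edges. The
  obstacle: halving needs a pair of density about \<open>1/n\<close>, because each of up to
  \<open>n\<close> vertices placed in the first set may spoil a share of the second, and a greedy
  embedding at that density costs the degree times \<open>L\<close>. To pay only
  \<open>O(G)\<close>, vertices of degree above \<open>G / L\<close> must go into a clique, and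
  there may be \<open>O(G L^3)\<close> of them. Growing that clique tolerates the much larger
  density \<open>L^(-5)\<close>, whose logarithm is only \<open>5 l\<close>. In a growth round a
  degree threshold \<open>D\<close> costs \<open>D l\<close> for the low degrees and leaves about
  \<open>B^4 / D\<close> vertices for an auxiliary clique in the other colour. Taking
  \<open>D\<close> of order \<open>B^2 / sqrt l\<close> balances the two, so a round costs
  \<open>O(G sqrt l)\<close>, and from size \<open>G\<close> to size \<open>G L^3\<close> there are
  \<open>O(l)\<close> rounds: together \<open>G l^(3/2)\<close>.\<close>

definition simple_graph :: "nat set \<Rightarrow> (nat \<times> nat) set \<Rightarrow> bool" where
  "simple_graph W E \<longleftrightarrow> finite W \<and> E \<subseteq> {(u, v). u \<in> W \<and> v \<in> W \<and> u < v}"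

text \<open>The vertices form an arbitrary finite set of numbers, so that passing to a segment or
  dropping isolated vertices needs no relabelling. A colour is a symmetric predicate and the other
  colour is its negation, so exchanging the colours is negating \<open>c\<close>.\<close>

definition copy :: "(nat \<Rightarrow> nat \<Rightarrow> bool) \<Rightarrow> nat set \<Rightarrow> (nat \<times> nat) set \<Rightarrow> nat set \<Rightarrow> bool" where
  "copy c W E V \<longleftrightarrow> (\<exists>\<phi>. strict_mono_on W \<phi> \<and> \<phi> ` W \<subseteq> V \<and> (\<forall>(u, v)\<in>E. c (\<phi> u) (\<phi> v)))"

definition clique_on :: "(nat \<Rightarrow> nat \<Rightarrow> bool) \<Rightarrow> nat set \<Rightarrow> bool" where
  "clique_on c X \<longleftrightarrow> (\<forall>x\<in>X. \<forall>y\<in>X. x \<noteq> y \<longrightarrow> c x y)"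

definition has_clique :: "(nat \<Rightarrow> nat \<Rightarrow> bool) \<Rightarrow> nat \<Rightarrow> nat set \<Rightarrow> bool" where
  "has_clique c k V \<longleftrightarrow> (\<exists>X\<subseteq>V. finite X \<and> card X = k \<and> clique_on c X)"

definition nbrs :: "(nat \<times> nat) set \<Rightarrow> nat \<Rightarrow> nat set" where
  "nbrs E u = {v. (u, v) \<in> E \<or> (v, u) \<in> E}"

definition separated :: "nat set \<Rightarrow> nat set \<Rightarrow> bool" where
  "separated A B \<longleftrightarrow> (\<forall>a\<in>A. \<forall>b\<in>B. a < b)"

text \<open>When the greedy embedding stops, a candidate set of size \<open>t\<close> is covered by at most \<open>n\<close> sets of
  bad vertices; \<open>A\<close> is the largest of them, which is why it is only required to have \<open>t / n\<close> elements.\<close>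

definition sparse_pair :: "(nat \<Rightarrow> nat \<Rightarrow> bool) \<Rightarrow> real \<Rightarrow> nat \<Rightarrow> real \<Rightarrow> nat set \<Rightarrow> bool" where
  "sparse_pair c \<epsilon> n t V \<longleftrightarrow> (\<exists>A B. A \<subseteq> V \<and> B \<subseteq> V \<and> (separated A B \<or> separated B A)
     \<and> t \<le> real n * real (card A) \<and> t \<le> real (card B)
     \<and> (\<forall>a\<in>A. real (card {b\<in>B. c a b}) \<le> \<epsilon> * real (card B)))"

lemma copy_mono: "copy c W E V \<Longrightarrow> V \<subseteq> V' \<Longrightarrow> copy c W E V'"
  unfolding copy_def by blast

lemma has_clique_mono: "has_clique c k V \<Longrightarrow> V \<subseteq> V' \<Longrightarrow> has_clique c k V'"
  unfolding has_clique_def by blast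

lemma has_clique_le:
  assumes "has_clique c k V" "j \<le> k" shows "has_clique c j V"
proof -
  obtain X where X: "X \<subseteq> V" "finite X" "card X = k" "clique_on c X"
    using assms(1) unfolding has_clique_def by blast
  obtain Y where Y: "Y \<subseteq> X" "card Y = j" "finite Y"
    using obtain_subset_with_card_n[of j X] X(3) assms(2) by blast
  have "clique_on c Y" using X(4) Y(1) unfolding clique_on_def by blast
  moreover have "Y \<subseteq> V" using X(1) Y(1) by blast
  ultimately show ?thesis unfolding has_clique_def using Y by blast
qed

lemma clique_imp_copy:
  assumes g: "simple_graph W E" and h: "has_clique c (card W) V"
  shows "copy c W E V"
proof -
  obtain X where X: "X \<subseteq> V" "finite X" "card X = card W" "clique_on c X"
    using h unfolding has_clique_def by blast
  have fW: "finite W" using g unfolding simple_graph_def by blast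
  let ?xs = "sorted_list_of_set X"
  define r where "r u = card {w\<in>W. w < u}" for u
  have len: "length ?xs = card W" using X by simp
  have rlt: "r u < card W" if "u \<in> W" for u
  proof -
    have "{w\<in>W. w < u} \<subset> W" using that by auto
    then show ?thesis unfolding r_def using fW psubset_card_mono by blast
  qed
  have rmono: "r u < r v" if "u \<in> W" "v \<in> W" "u < v" for u v
  proof -
    have "{w\<in>W. w < u} \<subset> {w\<in>W. w < v}" using that by auto
    then show ?thesis unfolding r_def using fW psubset_card_mono[of "{w\<in>W. w < v}"] by auto
  qed
  define \<phi> where "\<phi> u = ?xs ! r u" for u
  have sw: "sorted_wrt (<) ?xs" by simp
  have mono: "\<phi> u < \<phi> v" if "u \<in> W" "v \<in> W" "u < v" for u v
    unfolding \<phi>_def using sorted_wrt_nth_less[OF sw rmono[OF that]] rlt[OF that(2)] len by auto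
  have inX: "\<phi> u \<in> X" if "u \<in> W" for u
    unfolding \<phi>_def using rlt[OF that] len X(2) by (metis nth_mem set_sorted_list_of_set)
  have "strict_mono_on W \<phi>" using mono by (auto simp: strict_mono_on_def)
  moreover have "\<forall>(u,v)\<in>E. c (\<phi> u) (\<phi> v)"
  proof clarify
    fix u v assume "(u,v) \<in> E"
    then have "u \<in> W" "v \<in> W" "u < v" using g unfolding simple_graph_def by auto
    then show "c (\<phi> u) (\<phi> v)" using mono inX X(4) unfolding clique_on_def by (metis less_irrefl)
  qed
  ultimately show ?thesis unfolding copy_def using inX X(1) by blast
qed

text \<open>Provides candidate sets that already stand in the right order: picking one point from
  each is automatically order preserving, so an embedding only has to care about the edges.\<close>

lemma consecutive_chunks:
  fixes Y :: "nat set"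
  assumes "finite Y" "n * t \<le> card Y"
  shows "\<exists>Z. (\<forall>j<n. Z j \<subseteq> Y \<and> card (Z j) = t) \<and> (\<forall>i j. i < j \<and> j < n \<longrightarrow> separated (Z i) (Z j))"
proof -
  let ?ys = "sorted_list_of_set Y"
  define Z where "Z j = (\<lambda>i. ?ys ! i) ` {j*t..<j*t+t}" for j
  have len: "length ?ys = card Y" by simp
  have sw: "sorted_wrt (<) ?ys" by simp
  have lt: "i < card Y" if "j < n" "i \<in> {j*t..<j*t+t}" for i j
  proof -
    have "i < (j+1)*t" using that by simp
    also have "\<dots> \<le> n*t" using that(1) by (intro mult_right_mono) auto
    finally show ?thesis using assms(2) by simp
  qed
  have "Z j \<subseteq> Y" if "j < n" for j
    unfolding Z_def using lt[OF that] len assms(1)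
    by (metis image_subsetI nth_mem set_sorted_list_of_set)
  moreover have "card (Z j) = t" if "j < n" for j
  proof -
    have "inj_on (\<lambda>i. ?ys ! i) {j*t..<j*t+t}"
      using lt[OF that] len by (intro inj_onI) (metis distinct_sorted_list_of_set nth_eq_iff_index_eq)
    then show ?thesis unfolding Z_def by (simp add: card_image)
  qed
  moreover have "separated (Z i) (Z j)" if "i < j" "j < n" for i j
    unfolding separated_def Z_def
  proof clarify
    fix p q assume p: "p \<in> {i*t..<i*t+t}" and q: "q \<in> {j*t..<j*t+t}"
    have "p < (i+1)*t" using p by simp
    also have "\<dots> \<le> j*t" using that(1) by (intro mult_right_mono) auto
    finally have "p < q" using q by simp
    moreover have "q < length ?ys" using lt[OF that(2) q] len by simp
    ultimately show "?ys ! p < ?ys ! q" using sorted_wrt_nth_less[OF sw] by blast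
  qed
  ultimately show ?thesis by blast
qed

text \<open>For \<open>u\<close> in a distinct list, this is the number of neighbours embedded
  before \<open>u\<close>, hence the number of times its candidate set is still going to shrink.
  Consuming the list from the front matches the induction on the embedding.\<close>

fun back_deg :: "(nat \<Rightarrow> nat \<Rightarrow> bool) \<Rightarrow> nat list \<Rightarrow> nat \<Rightarrow> nat" where
  "back_deg adj [] u = 0"
| "back_deg adj (v # ws) u = (if u = v then 0 else (if adj v u then 1 else 0) + back_deg adj ws u)"

text \<open>Each candidate set carries a reserve of one factor \<open>\<epsilon>\<close> for every
  neighbour of its vertex still to be embedded earlier; embedding \<open>v\<close> spends one factor
  for each later neighbour of \<open>v\<close>, so no set ever falls below \<open>t\<close>. If
  every point of \<open>C v\<close> has too few neighbours in some later candidate set, one of these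
  at most \<open>n\<close> reasons accounts for a fraction \<open>1/n\<close> of
  \<open>C v\<close>.\<close>

lemma greedy_embedding:
  fixes \<epsilon> t :: real
  assumes sym: "\<And>x y. c x y = c y x" and adjs: "\<And>x y. adj x y = adj y x"
    and e: "0 < \<epsilon>" "\<epsilon> \<le> 1" and t: "0 < t"
  shows "distinct ws \<Longrightarrow> length ws \<le> n \<Longrightarrow>
    \<forall>u\<in>set ws. finite (C u) \<and> t \<le> real (card (C u)) * \<epsilon> ^ back_deg adj ws u \<Longrightarrow>
    (\<exists>\<phi>. (\<forall>u\<in>set ws. \<phi> u \<in> C u) \<and> (\<forall>u\<in>set ws. \<forall>v\<in>set ws. u \<noteq> v \<and> adj u v \<longrightarrow> c (\<phi> u) (\<phi> v))) \<or>
    (\<exists>u\<in>set ws. \<exists>v\<in>set ws. u \<noteq> v \<and> (\<exists>A B. A \<subseteq> C u \<and> B \<subseteq> C v \<and> t \<le> real n * real (card A)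
       \<and> t \<le> real (card B) \<and> (\<forall>a\<in>A. real (card {b\<in>B. c a b}) \<le> \<epsilon> * real (card B))))"
proof (induction ws arbitrary: C)
  case Nil
  then show ?case by simp
next
  case (Cons v ws)
  have big: "t \<le> real (card (C u))" if "u \<in> set (v # ws)" for u
  proof -
    have "real (card (C u)) * \<epsilon> ^ back_deg adj (v#ws) u \<le> real (card (C u)) * 1"
      using e by (intro mult_left_mono power_le_one) auto
    then show ?thesis using bspec[OF Cons.prems(3) that] by linarith
  qed
  have fin: "finite (C u)" if "u \<in> set (v # ws)" for u using bspec[OF Cons.prems(3) that] by blast
  define F where "F = {u \<in> set ws. adj v u}"
  define bad where "bad u = {x \<in> C v. real (card {b\<in>C u. c x b}) < \<epsilon> * real (card (C u))}" for u
  show ?case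
  proof (cases "\<exists>x\<in>C v. \<forall>u\<in>F. x \<notin> bad u")
    case True
    then obtain x where x: "x \<in> C v" "\<And>u. u \<in> F \<Longrightarrow> \<epsilon> * real (card (C u)) \<le> real (card {b\<in>C u. c x b})"
      unfolding bad_def by force
    define C' where "C' u = (if adj v u then {b\<in>C u. c x b} else C u)" for u
    have sub: "C' u \<subseteq> C u" for u unfolding C'_def by auto
    have "finite (C' u) \<and> t \<le> real (card (C' u)) * \<epsilon> ^ back_deg adj ws u" if u: "u \<in> set ws" for u
    proof
      have uv: "u \<noteq> v" using u Cons.prems(1) by auto
      show "finite (C' u)" using fin[of u] u sub finite_subset by (metis list.set_intros(2))
      have old: "t \<le> real (card (C u)) * \<epsilon> ^ back_deg adj (v#ws) u" using bspec[OF Cons.prems(3), of u] u by simp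
      show "t \<le> real (card (C' u)) * \<epsilon> ^ back_deg adj ws u"
      proof (cases "adj v u")
        case True
        then have "u \<in> F" using u F_def by simp
        then have "(\<epsilon> * real (card (C u))) * \<epsilon> ^ back_deg adj ws u \<le> real (card (C' u)) * \<epsilon> ^ back_deg adj ws u"
          using x(2) True e unfolding C'_def by (intro mult_right_mono) auto
        moreover have "(\<epsilon> * real (card (C u))) * \<epsilon> ^ back_deg adj ws u = real (card (C u)) * \<epsilon> ^ back_deg adj (v#ws) u"
          using True uv by simp
        ultimately show ?thesis using old by linarith
      next
        case False
        then show ?thesis using old uv unfolding C'_def by simp
      qed
    qed
    then have "(\<exists>\<phi>. (\<forall>u\<in>set ws. \<phi> u \<in> C' u) \<and> (\<forall>u\<in>set ws. \<forall>v\<in>set ws. u \<noteq> v \<and> adj u v \<longrightarrow> c (\<phi> u) (\<phi> v))) \<or>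
    (\<exists>u\<in>set ws. \<exists>v\<in>set ws. u \<noteq> v \<and> (\<exists>A B. A \<subseteq> C' u \<and> B \<subseteq> C' v \<and> t \<le> real n * real (card A)
       \<and> t \<le> real (card B) \<and> (\<forall>a\<in>A. real (card {b\<in>B. c a b}) \<le> \<epsilon> * real (card B))))"
      using Cons.IH[of C'] Cons.prems(1,2) by auto
    then show ?thesis
    proof (elim disjE)
      assume "\<exists>\<phi>. (\<forall>u\<in>set ws. \<phi> u \<in> C' u) \<and> (\<forall>u\<in>set ws. \<forall>v\<in>set ws. u \<noteq> v \<and> adj u v \<longrightarrow> c (\<phi> u) (\<phi> v))"
      then obtain \<phi> where p: "\<And>u. u\<in>set ws \<Longrightarrow> \<phi> u \<in> C' u"
        "\<And>u w. u\<in>set ws \<Longrightarrow> w\<in>set ws \<Longrightarrow> u \<noteq> w \<Longrightarrow> adj u w \<Longrightarrow> c (\<phi> u) (\<phi> w)" by blast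
      define \<psi> where "\<psi> = \<phi>(v := x)"
      have vn: "v \<notin> set ws" using Cons.prems(1) by simp
      have cx: "c x (\<phi> u)" if "u \<in> set ws" "adj v u" for u using p(1)[OF that(1)] that(2) unfolding C'_def by simp
      have "\<forall>u\<in>set (v#ws). \<psi> u \<in> C u" using p(1) sub x(1) unfolding \<psi>_def by auto
      moreover have "\<forall>u\<in>set (v#ws). \<forall>w\<in>set (v#ws). u \<noteq> w \<and> adj u w \<longrightarrow> c (\<psi> u) (\<psi> w)"
      proof (intro ballI impI)
        fix u w assume uw: "u \<in> set (v#ws)" "w \<in> set (v#ws)" "u \<noteq> w \<and> adj u w"
        consider "u = v" "w \<in> set ws" "w \<noteq> v" | "w = v" "u \<in> set ws" "u \<noteq> v"
          | "u \<noteq> v" "w \<noteq> v" "u \<in> set ws" "w \<in> set ws" using uw by auto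
        then show "c (\<psi> u) (\<psi> w)"
        proof cases
          case 1
          then show ?thesis using cx[of w] uw(3) unfolding \<psi>_def by simp
        next
          case 2
          have "adj v u" using uw(3) 2(1) adjs[of u v] by simp
          then have "c x (\<phi> u)" using cx[of u] 2 by simp
          then show ?thesis using sym[of x "\<phi> u"] 2 unfolding \<psi>_def by simp
        next
          case 3
          then show ?thesis using p(2)[of u w] uw(3) unfolding \<psi>_def by simp
        qed
      qed
      ultimately show ?thesis by blast
    next
      assume "\<exists>u\<in>set ws. \<exists>v\<in>set ws. u \<noteq> v \<and> (\<exists>A B. A \<subseteq> C' u \<and> B \<subseteq> C' v \<and> t \<le> real n * real (card A)
       \<and> t \<le> real (card B) \<and> (\<forall>a\<in>A. real (card {b\<in>B. c a b}) \<le> \<epsilon> * real (card B)))"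
      then obtain u w A B where o: "u \<in> set ws" "w \<in> set ws" "u \<noteq> w" "A \<subseteq> C' u" "B \<subseteq> C' w"
        "t \<le> real n * real (card A)" "t \<le> real (card B)" "\<forall>a\<in>A. real (card {b\<in>B. c a b}) \<le> \<epsilon> * real (card B)"
        by blast
      have "A \<subseteq> C u" "B \<subseteq> C w" using o(4,5) sub by blast+
      moreover have "u \<in> set (v#ws)" "w \<in> set (v#ws)" using o(1,2) by auto
      ultimately show ?thesis using o(3,6,7,8) by blast
    qed
  next
    case False
    have finF: "finite F" unfolding F_def by simp
    have cov: "C v \<subseteq> (\<Union>u\<in>F. bad u)" using False by blast
    have ne: "C v \<noteq> {}" using big[of v] t by auto
    then have Fne: "F \<noteq> {}" using cov by auto
    have cardF: "card F \<le> n"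
    proof -
      have "card F \<le> card (set ws)" unfolding F_def by (intro card_mono) auto
      also have "\<dots> \<le> n" using Cons.prems(2) card_length[of ws] by simp
      finally show ?thesis .
    qed
    have "\<exists>u\<in>F. real (card (C v)) \<le> real n * real (card (bad u))"
    proof (rule ccontr)
      assume "\<not> ?thesis"
      then have l: "real n * real (card (bad u)) < real (card (C v))" if "u \<in> F" for u using that by force
      have fb: "finite (bad u)" for u unfolding bad_def using fin[of v] by auto
      have "card (C v) \<le> card (\<Union>u\<in>F. bad u)" using card_mono[OF _ cov] fb finF by blast
      also have "\<dots> \<le> (\<Sum>u\<in>F. card (bad u))" by (rule card_UN_le[OF finF])
      finally have "real (card (C v)) \<le> real (\<Sum>u\<in>F. card (bad u))" by (simp only: of_nat_le_iff)
      then have "real n * real (card (C v)) \<le> (\<Sum>u\<in>F. real n * real (card (bad u)))"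
        by (simp add: sum_distrib_left[symmetric] mult_left_mono)
      also have "\<dots> < (\<Sum>u\<in>F. real (card (C v)))" using l finF Fne by (intro sum_strict_mono) auto
      also have "\<dots> = real (card F) * real (card (C v))" by simp
      also have "\<dots> \<le> real n * real (card (C v))" using cardF by (intro mult_right_mono) auto
      finally show False by simp
    qed
    then obtain u where u: "u \<in> F" "real (card (C v)) \<le> real n * real (card (bad u))" by blast
    have uw: "u \<in> set (v#ws)" "u \<noteq> v" using u(1) Cons.prems(1) unfolding F_def by auto
    have "bad u \<subseteq> C v" "C u \<subseteq> C u" unfolding bad_def by auto
    moreover have "t \<le> real n * real (card (bad u))" using big[of v] u(2) by simp
    moreover have "\<forall>a\<in>bad u. real (card {b\<in>C u. c a b}) \<le> \<epsilon> * real (card (C u))" unfolding bad_def by auto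
    ultimately have "v \<noteq> u \<and> (\<exists>A B. A \<subseteq> C v \<and> B \<subseteq> C u \<and> t \<le> real n * real (card A)
       \<and> t \<le> real (card B) \<and> (\<forall>a\<in>A. real (card {b\<in>B. c a b}) \<le> \<epsilon> * real (card B)))"
      using big[OF uw(1)] uw(2) by blast
    moreover have "v \<in> set (v#ws)" by simp
    ultimately show ?thesis using uw(1) by blast
  qed
qed

lemma sum_degrees_le:
  assumes g: "simple_graph W E" and B: "finite B"
  shows "(\<Sum>v\<in>B. card (nbrs E v)) \<le> 2 * card E"
proof -
  have fE: "finite E" using g unfolding simple_graph_def
    by (elim conjE, intro finite_subset[of E "W \<times> W"]) auto
  define O1 where "O1 v = {w. (v,w) \<in> E}" for v
  define I1 where "I1 v = {w. (w,v) \<in> E}" for v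
  have "O1 v \<subseteq> snd ` E" "I1 v \<subseteq> fst ` E" for v unfolding O1_def I1_def by force+
  then have fin: "finite (O1 v)" "finite (I1 v)" for v using fE by (meson finite_imageI finite_subset)+
  have "nbrs E v = O1 v \<union> I1 v" for v unfolding nbrs_def O1_def I1_def by auto
  then have "card (nbrs E v) \<le> card (O1 v) + card (I1 v)" for v by (metis card_Un_le)
  then have "(\<Sum>v\<in>B. card (nbrs E v)) \<le> (\<Sum>v\<in>B. card (O1 v)) + (\<Sum>v\<in>B. card (I1 v))"
    by (simp add: sum_mono sum.distrib[symmetric])
  moreover have "(\<Sum>v\<in>B. card (O1 v)) \<le> card E"
  proof -
    have "(\<Sum>v\<in>B. card (O1 v)) = card (SIGMA v:B. O1 v)" using B fin by simp
    also have "\<dots> \<le> card E" using fE by (intro card_mono) (auto simp: O1_def)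
    finally show ?thesis .
  qed
  moreover have "(\<Sum>v\<in>B. card (I1 v)) \<le> card E"
  proof -
    have "(\<Sum>v\<in>B. card (I1 v)) = card (SIGMA v:B. I1 v)" using B fin by simp
    also have "\<dots> = card (prod.swap ` (SIGMA v:B. I1 v))" by (simp add: card_image)
    also have "\<dots> \<le> card E" using fE by (intro card_mono) (auto simp: I1_def)
    finally show ?thesis .
  qed
  ultimately show ?thesis by linarith
qed

section \<open>Fat cliques\<close>

text \<open>Let \<open>N(Q)\<close> be the number of cliques with exactly one vertex in each block of \<open>Q\<close>. By averaging
  some \<open>q\<close> blocks have many of them. Among the subsets \<open>Q\<close> of these, take one maximising the normalised
  count \<open>N(Q) M\<^bsup>2|Q|\<^esup> / s\<^bsup>|Q|\<^esup>\<close>: maximality bounds the number of cliques with a small link in some block,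
  and a clique all of whose links are large remains.\<close>

lemma fat_clique:
  fixes V :: "nat set"
  assumes sym: "\<And>x y. c x y = c y x" and V: "finite V" "M * s \<le> card V"
    and pos: "0 < s" "1 < M" "0 < q"
    and cl: "\<forall>X. X \<subseteq> V \<and> card X = M \<longrightarrow> has_clique c q X"
  shows "\<exists>B Q x Y. (\<forall>l<M. B l \<subseteq> V) \<and> (\<forall>i j. i < j \<and> j < M \<longrightarrow> separated (B i) (B j))
    \<and> Q \<subseteq> {..<M} \<and> q \<le> 2 * card Q
    \<and> (\<forall>l\<in>Q. x l \<in> B l \<and> Y l \<subseteq> B l \<and> s \<le> 2 * q * M\<^sup>2 * card (Y l))
    \<and> (\<forall>l\<in>Q. \<forall>l'\<in>Q. l \<noteq> l' \<longrightarrow> c (x l) (x l') \<and> (\<forall>y\<in>Y l'. c (x l) y))"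
proof -
  obtain B where B: "\<And>l. l < M \<Longrightarrow> B l \<subseteq> V \<and> card (B l) = s"
    "\<And>i j. i < j \<Longrightarrow> j < M \<Longrightarrow> separated (B i) (B j)"
    using consecutive_chunks[OF V] by blast
  have finB: "finite (B l)" if "l < M" for l using B(1)[OF that] V(1) finite_subset by blast
  define T where "T Q = {x \<in> PiE Q B. \<forall>l\<in>Q. \<forall>l'\<in>Q. l \<noteq> l' \<longrightarrow> c (x l) (x l')}" for Q
  define N where "N Q = card (T Q)" for Q
  have cardPi: "card (PiE Q B) = s ^ card Q" "finite (PiE Q B)" if "Q \<subseteq> {..<M}" for Q
  proof -
    have f: "finite Q" using that finite_subset by blast
    have "card (PiE Q B) = (\<Prod>l\<in>Q. card (B l))" using card_PiE[OF f, of B] by simp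
    also have "\<dots> = (\<Prod>l\<in>Q. s)" using that B(1) by (intro prod.cong) auto
    finally show "card (PiE Q B) = s ^ card Q" by simp
    show "finite (PiE Q B)" using f finB that by (intro finite_PiE) auto
  qed
  have finT: "finite (T Q)" if "Q \<subseteq> {..<M}" for Q
    unfolding T_def using cardPi(2)[OF that] by simp
  have NleS: "N Q \<le> s ^ card Q" if "Q \<subseteq> {..<M}" for Q
    unfolding N_def cardPi(1)[OF that, symmetric] using cardPi(2)[OF that] by (intro card_mono) (auto simp: T_def)
  let ?I = "{..<M}"
  define \<Q> where "\<Q> = {Q. Q \<subseteq> ?I \<and> card Q = q}"
  have finQ: "finite \<Q>" unfolding \<Q>_def by simp
  have cardQ: "card \<Q> \<le> M ^ q"
  proof -
    have "M choose q \<le> M ^ q" using binomial_le_pow[of q M] by (cases "q \<le> M") (simp_all add: binomial_eq_0)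
    moreover have "card \<Q> = M choose q" unfolding \<Q>_def using n_subsets[of ?I q] by simp
    ultimately show ?thesis by simp
  qed
  \<comment> \<open>One point from each of the \<open>M\<close> blocks makes a set of
    \<open>M\<close> vertices; it contains a clique of size \<open>q\<close>, whose coordinates form
    a set in \<open>\<Q>\<close>.\<close>
  have cover: "PiE ?I B \<subseteq> (\<Union>Q\<in>\<Q>. {x \<in> PiE ?I B. restrict x Q \<in> T Q})"
  proof
    fix x assume x: "x \<in> PiE ?I B"
    have inj: "inj_on x ?I"
    proof (rule linorder_inj_onI')
      fix i j assume "i \<in> ?I" "j \<in> ?I" "i < j"
      then have "x i < x j" using B(2)[of i j] x unfolding separated_def by (auto simp: PiE_def Pi_def)
      then show "x i \<noteq> x j" by simp
    qed
    have "x ` ?I \<subseteq> V" using x B(1) by (fastforce simp: PiE_def Pi_def)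
    moreover have "card (x ` ?I) = M" using inj by (simp add: card_image)
    ultimately have "has_clique c q (x ` ?I)" using cl by blast
    then obtain X where X: "X \<subseteq> x ` ?I" "finite X" "card X = q" "clique_on c X" unfolding has_clique_def by blast
    define Q where "Q = {l\<in>?I. x l \<in> X}"
    have im: "x ` Q = X" using X(1) unfolding Q_def by auto
    have QI: "Q \<subseteq> ?I" unfolding Q_def by auto
    have injQ: "inj_on x Q" using inj QI inj_on_subset by blast
    then have "card Q = q" using X(3) im card_image by metis
    then have "Q \<in> \<Q>" using QI unfolding \<Q>_def by blast
    moreover have "restrict x Q \<in> T Q"
    proof -
      have "restrict x Q \<in> PiE Q B" using x QI by (auto simp: PiE_def Pi_def)
      moreover have "c (x l) (x l')" if "l \<in> Q" "l' \<in> Q" "l \<noteq> l'" for l l'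
        using that X(4) injQ unfolding clique_on_def Q_def by (auto dest: inj_onD)
      ultimately show ?thesis unfolding T_def by auto
    qed
    ultimately show "x \<in> (\<Union>Q\<in>\<Q>. {x \<in> PiE ?I B. restrict x Q \<in> T Q})" using x by blast
  qed
  have fib: "card {x \<in> PiE ?I B. restrict x Q \<in> T Q} \<le> N Q * s ^ (M - q)" if "Q \<in> \<Q>" for Q
  proof -
    have QI: "Q \<subseteq> ?I" "card Q = q" using that unfolding \<Q>_def by auto
    let ?F = "{x \<in> PiE ?I B. restrict x Q \<in> T Q}"
    let ?h = "\<lambda>x. (restrict x Q, restrict x (?I - Q))"
    have "inj_on ?h ?F"
    proof (rule inj_onI)
      fix x y assume xy: "x \<in> ?F" "y \<in> ?F" "?h x = ?h y"
      show "x = y"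
      proof (rule PiE_ext[of x ?I B y])
        show "x \<in> PiE ?I B" "y \<in> PiE ?I B" using xy by auto
        fix i assume "i \<in> ?I"
        then show "x i = y i" using xy(3) by (cases "i \<in> Q") (auto dest: fun_cong[of _ _ i] simp: restrict_def)
      qed
    qed
    moreover have "?h ` ?F \<subseteq> T Q \<times> PiE (?I - Q) B" by (auto simp: PiE_def Pi_def)
    ultimately have "card ?F \<le> card (T Q \<times> PiE (?I - Q) B)"
      using finT[OF QI(1)] cardPi(2)[of "?I - Q"] by (intro card_inj_on_le[of ?h]) auto
    also have "\<dots> = N Q * s ^ (M - q)"
    proof -
      have "card (?I - Q) = M - q" using QI by (simp add: card_Diff_subset finite_subset)
      then show ?thesis unfolding card_cartesian_product N_def using cardPi(1)[of "?I - Q"] by simp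
    qed
    finally show ?thesis .
  qed
  have total: "s ^ M \<le> (\<Sum>Q\<in>\<Q>. N Q * s ^ (M - q))"
  proof -
    have "s ^ M = card (PiE ?I B)" using cardPi(1)[of ?I] by simp
    also have "\<dots> \<le> card (\<Union>Q\<in>\<Q>. {x \<in> PiE ?I B. restrict x Q \<in> T Q})"
      using cover finQ cardPi(2)[of ?I] by (intro card_mono) auto
    also have "\<dots> \<le> (\<Sum>Q\<in>\<Q>. card {x \<in> PiE ?I B. restrict x Q \<in> T Q})" by (rule card_UN_le[OF finQ])
    also have "\<dots> \<le> (\<Sum>Q\<in>\<Q>. N Q * s ^ (M - q))" by (intro sum_mono fib)
    finally show ?thesis .
  qed
  \<comment> \<open>Averaging over at most \<open>M ^ q\<close> sets of coordinates loses no more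
    than the factor \<open>M ^ q\<close>.\<close>
  have "\<exists>Q\<in>\<Q>. s ^ q \<le> N Q * M ^ q"
  proof (rule ccontr)
    assume "\<not> ?thesis"
    then have l: "N Q * M ^ q < s ^ q" if "Q \<in> \<Q>" for Q using that by force
    have ne: "\<Q> \<noteq> {}" using total pos(1) by auto
    then have qM: "q \<le> M" unfolding \<Q>_def using card_mono[of ?I] by fastforce
    have "s ^ M * M ^ q \<le> (\<Sum>Q\<in>\<Q>. N Q * s ^ (M - q)) * M ^ q" using total by (rule mult_right_mono) simp
    also have "\<dots> = (\<Sum>Q\<in>\<Q>. (N Q * M ^ q) * s ^ (M - q))" unfolding sum_distrib_right by (intro sum.cong) (simp_all only: mult_ac)
    also have "\<dots> < (\<Sum>Q\<in>\<Q>. s ^ q * s ^ (M - q))"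
      using l ne finQ pos(1) by (intro sum_strict_mono mult_strict_right_mono) auto
    also have "\<dots> = card \<Q> * s ^ M" using qM by (simp add: power_add[symmetric])
    also have "\<dots> \<le> M ^ q * s ^ M" using cardQ by (rule mult_right_mono) simp
    finally show False by (simp add: mult.commute)
  qed
  then obtain Q0 where Q0: "Q0 \<subseteq> ?I" "card Q0 = q" "s ^ q \<le> N Q0 * M ^ q" unfolding \<Q>_def by blast
  have finQ0: "finite Q0" using Q0(1) finite_subset by blast
  \<comment> \<open>The square in \<open>M\<^sup>2\<close> is deliberate: one factor
    \<open>M\<close> per block pays for the averaging loss, the other remains, so that
    \<open>\<Psi> Q0\<close> is at least \<open>M ^ q\<close>. As \<open>\<Psi> Q\<close> is at most
    \<open>M ^ (2 * card Q)\<close>, the maximiser has at least \<open>q / 2\<close> blocks.\<close>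
  define \<Psi> where "\<Psi> Q = real (N Q) * (real M ^ 2 / real s) ^ card Q" for Q
  have fP: "finite (\<Psi> ` Pow Q0)" "\<Psi> ` Pow Q0 \<noteq> {}" using finQ0 by auto
  have "Max (\<Psi> ` Pow Q0) \<in> \<Psi> ` Pow Q0" using Max_in[OF fP] .
  then obtain Q where Q: "Q \<subseteq> Q0" "\<Psi> Q = Max (\<Psi> ` Pow Q0)" by (metis (no_types, lifting) PowD imageE)
  have mx: "\<Psi> R \<le> \<Psi> Q" if "R \<subseteq> Q0" for R using Q(2) Max_ge[OF fP(1)] that by auto
  have QI: "Q \<subseteq> ?I" using Q(1) Q0(1) by blast
  have finQ': "finite Q" using QI finite_subset by blast
  have rs: "real s > 0" "real M > 0" using pos by auto
  have Psi_big: "real M ^ q \<le> \<Psi> Q"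
  proof -
    have "real s ^ q \<le> real (N Q0) * real M ^ q" using Q0(3) by (metis of_nat_le_iff of_nat_mult of_nat_power)
    then have "real s ^ q * (real M ^ q / real s ^ q) \<le> (real (N Q0) * real M ^ q) * (real M ^ q / real s ^ q)"
      using rs by (intro mult_right_mono) auto
    moreover have "real s ^ q * (real M ^ q / real s ^ q) = real M ^ q" using rs by simp
    moreover have "(real (N Q0) * real M ^ q) * (real M ^ q / real s ^ q) = \<Psi> Q0"
      unfolding \<Psi>_def Q0(2) by (simp add: power_divide power2_eq_square power_mult_distrib)
    ultimately show ?thesis using mx[of Q0] by simp
  qed
  have NQpos: "0 < N Q"
  proof (rule ccontr)
    assume "\<not> 0 < N Q"
    then have "\<Psi> Q = 0" unfolding \<Psi>_def by simp
    moreover have "0 < real M ^ q" using rs by simp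
    ultimately show False using Psi_big by linarith
  qed
  have cardQbig: "q \<le> 2 * card Q"
  proof (rule ccontr)
    assume a: "\<not> ?thesis"
    have "\<Psi> Q \<le> real (s ^ card Q) * (real M ^ 2 / real s) ^ card Q"
      unfolding \<Psi>_def using NleS[OF QI] rs by (intro mult_right_mono) (auto simp del: of_nat_power)
    also have "\<dots> = real M ^ (2 * card Q)" using rs by (simp add: power_divide power_mult)
    also have "\<dots> < real M ^ q" using a pos(2) by (intro power_strict_increasing) auto
    finally show False using Psi_big by simp
  qed
  \<comment> \<open>Comparing the maximiser with \<open>Q - {l}\<close>: on average a clique on the
    other blocks extends to at least a fraction \<open>1 / M\<^sup>2\<close> of block
    \<open>l\<close>.\<close>
  have marg: "N (Q - {l}) * s \<le> M\<^sup>2 * N Q" if l: "l \<in> Q" for l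
  proof -
    have cq: "card Q = Suc (card (Q - {l}))" using l finQ' by (metis card.remove)
    have pp: "0 < (real M ^ 2 / real s) ^ card (Q - {l})" using rs by simp
    have "\<Psi> (Q - {l}) \<le> \<Psi> Q" using mx[of "Q - {l}"] Q(1) by blast
    then have "real (N (Q - {l})) * (real M ^ 2 / real s) ^ card (Q - {l})
       \<le> (real (N Q) * (real M ^ 2 / real s)) * (real M ^ 2 / real s) ^ card (Q - {l})"
      unfolding \<Psi>_def cq by (simp only: power_Suc mult.assoc)
    then have "real (N (Q - {l})) \<le> real (N Q) * (real M ^ 2 / real s)" using pp by (simp only: mult_le_cancel_right_pos)
    then have "real (N (Q - {l})) * real s \<le> real (N Q) * real M ^ 2" using rs by (simp add: field_simps)
    then have "real (N (Q - {l}) * s) \<le> real (M\<^sup>2 * N Q)" by (simp add: mult.commute)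
    then show ?thesis by (simp only: of_nat_le_iff)
  qed
  define link where "link l x = {y \<in> B l. \<forall>l'\<in>Q - {l}. c (x l') y}" for l x
  \<comment> \<open>The threshold lies a factor \<open>2 * q\<close> below that average, so one
    block spoils at most \<open>N Q / (2 * q)\<close> cliques and all of at most \<open>q\<close>
    blocks together at most half of them.\<close>
  define bad where "bad l = {x \<in> T Q. 2 * q * M\<^sup>2 * card (link l x) < s}" for l
  have badcard: "card (bad l) * (2 * q) \<le> N Q" if l: "l \<in> Q" for l
  proof -
    have lM: "l < M" using l QI by blast
    have QlI: "Q - {l} \<subseteq> ?I" using QI by blast
    define Zs where "Zs = {z \<in> T (Q - {l}). 2 * q * M\<^sup>2 * card (link l z) < s}"
    have finZ: "finite Zs" unfolding Zs_def using finT[OF QlI] by simp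
    have finl: "finite (link l z)" for z unfolding link_def using finB[OF lM] by simp
    have "bad l \<subseteq> (\<Union>z\<in>Zs. (\<lambda>y. z(l := y)) ` link l z)"
    proof
      fix x assume x: "x \<in> bad l"
      define z where "z = restrict x (Q - {l})"
      have lk: "link l z = link l x" unfolding link_def z_def by auto
      have xT: "x \<in> T Q" using x unfolding bad_def by blast
      then have xP: "x \<in> PiE Q B" and xc: "\<And>i j. i \<in> Q \<Longrightarrow> j \<in> Q \<Longrightarrow> i \<noteq> j \<Longrightarrow> c (x i) (x j)" unfolding T_def by auto
      have "z \<in> T (Q - {l})" unfolding T_def z_def using xP xc by (auto simp: PiE_def Pi_def)
      then have "z \<in> Zs" unfolding Zs_def using x lk unfolding bad_def by simp
      moreover have "x l \<in> link l z" unfolding lk unfolding link_def using xP xc l by (auto simp: PiE_def Pi_def)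
      moreover have "x = z(l := x l)"
        using xP l unfolding z_def by (auto simp: fun_eq_iff PiE_def extensional_def)
      ultimately show "x \<in> (\<Union>z\<in>Zs. (\<lambda>y. z(l := y)) ` link l z)" by blast
    qed
    then have "card (bad l) \<le> card (\<Union>z\<in>Zs. (\<lambda>y. z(l := y)) ` link l z)"
      using finZ finl by (intro card_mono) auto
    also have "\<dots> \<le> (\<Sum>z\<in>Zs. card ((\<lambda>y. z(l := y)) ` link l z))" by (rule card_UN_le[OF finZ])
    also have "\<dots> \<le> (\<Sum>z\<in>Zs. card (link l z))" using finl by (intro sum_mono card_image_le)
    finally have "card (bad l) * (2 * q * M\<^sup>2) \<le> (\<Sum>z\<in>Zs. card (link l z)) * (2 * q * M\<^sup>2)"
      by (rule mult_right_mono) simp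
    also have "\<dots> = (\<Sum>z\<in>Zs. 2 * q * M\<^sup>2 * card (link l z))" unfolding sum_distrib_right by (intro sum.cong) (simp_all only: mult_ac)
    also have "\<dots> \<le> (\<Sum>z\<in>Zs. s)" unfolding Zs_def by (intro sum_mono) auto
    also have "\<dots> = card Zs * s" by simp
    also have "\<dots> \<le> N (Q - {l}) * s"
      unfolding N_def Zs_def using finT[OF QlI] by (intro mult_right_mono card_mono) auto
    also have "\<dots> \<le> M\<^sup>2 * N Q" by (rule marg[OF l])
    finally have "M\<^sup>2 * (card (bad l) * (2 * q)) \<le> M\<^sup>2 * N Q" by (simp add: mult_ac)
    then show ?thesis using pos(2) by simp
  qed
  have "\<exists>x\<in>T Q. \<forall>l\<in>Q. x \<notin> bad l"
  proof (rule ccontr)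
    assume "\<not> ?thesis"
    then have "T Q \<subseteq> (\<Union>l\<in>Q. bad l)" by blast
    then have "N Q \<le> card (\<Union>l\<in>Q. bad l)" unfolding N_def
      using finQ' finT[OF QI] by (intro card_mono) (auto simp: bad_def)
    also have "\<dots> \<le> (\<Sum>l\<in>Q. card (bad l))" by (rule card_UN_le[OF finQ'])
    finally have "N Q * (2 * q) \<le> (\<Sum>l\<in>Q. card (bad l)) * (2 * q)" by (rule mult_right_mono) simp
    also have "\<dots> = (\<Sum>l\<in>Q. card (bad l) * (2 * q))" by (simp add: sum_distrib_right)
    also have "\<dots> \<le> (\<Sum>l\<in>Q. N Q)" by (intro sum_mono badcard)
    also have "\<dots> = card Q * N Q" by simp
    also have "\<dots> \<le> q * N Q" using card_mono[OF finQ0 Q(1)] Q0(2) by simp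
    finally have "2 * (N Q * q) \<le> N Q * q" by (simp only: mult_ac)
    moreover have "0 < N Q * q" using NQpos pos(3) by simp
    ultimately show False by linarith
  qed
  then obtain x where x: "x \<in> T Q" "\<And>l. l \<in> Q \<Longrightarrow> x \<notin> bad l" by blast
  have r1: "x l \<in> B l \<and> link l x \<subseteq> B l \<and> s \<le> 2 * q * M\<^sup>2 * card (link l x)" if "l \<in> Q" for l
    using x that unfolding bad_def link_def T_def by (auto simp: PiE_def Pi_def not_less)
  have r2: "c (x l) (x l') \<and> (\<forall>y\<in>link l' x. c (x l) y)" if "l \<in> Q" "l' \<in> Q" "l \<noteq> l'" for l l'
    using x(1) that unfolding link_def T_def by auto
  show ?thesis
    by (rule exI[of _ B], rule exI[of _ Q], rule exI[of _ x], rule exI[of _ "\<lambda>l. link l x"])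
      (use B QI cardQbig r1 r2 in \<open>intro conjI ballI allI impI; simp\<close>)
qed

section \<open>Vertex orders with few earlier neighbours, and embeddings along them\<close>

lemma back_deg_le_card:
  "distinct ws \<Longrightarrow> back_deg adj ws u \<le> card {v \<in> set ws. adj v u}"
proof (induction ws)
  case (Cons v ws)
  have sub: "{w \<in> set ws. adj w u} \<subseteq> {w \<in> set (v#ws). adj w u}" by auto
  have "card {w \<in> set (v#ws). adj w u} = card {w \<in> set ws. adj w u} + 1" if "adj v u"
  proof -
    have "{w \<in> set (v#ws). adj w u} = insert v {w \<in> set ws. adj w u}" using that by auto
    then show ?thesis using Cons.prems by simp
  qed
  moreover have "card {w \<in> set ws. adj w u} \<le> card {w \<in> set (v#ws). adj w u}" by (rule card_mono[OF _ sub]) simp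
  moreover have "back_deg adj ws u \<le> card {w \<in> set ws. adj w u}" using Cons by simp
  ultimately show ?case by (cases "adj v u") auto
qed simp

text \<open>In an order of decreasing degree the earlier neighbours of \<open>u\<close> have degree
  at least that of \<open>u\<close>; the witness \<open>B\<close> makes them available for
  counting.\<close>

lemma back_deg_sorted:
  "distinct ws \<Longrightarrow> sorted_wrt (\<lambda>x y. dg y \<le> dg x) ws \<Longrightarrow> u \<in> set ws \<Longrightarrow>
    \<exists>B\<subseteq>set ws. card B = back_deg adj ws u \<and> (\<forall>v\<in>B. adj v u \<and> dg u \<le> (dg v :: nat))"
proof (induction ws)
  case (Cons v ws)
  show ?case
  proof (cases "u = v")
    case True
    then show ?thesis by (intro exI[of _ "{}"]) simp
  next
    case False
    then have u: "u \<in> set ws" using Cons.prems by simp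
    then obtain B where B: "B \<subseteq> set ws" "card B = back_deg adj ws u" "\<forall>v\<in>B. adj v u \<and> dg u \<le> dg v"
      using Cons by auto
    have fB: "finite B" using B(1) finite_subset by blast
    show ?thesis
    proof (cases "adj v u")
      case True
      have "v \<notin> B" using B(1) Cons.prems(1) by auto
      then have "card (insert v B) = back_deg adj (v#ws) u" using True False B(2) fB by simp
      moreover have "dg u \<le> dg v" using Cons.prems(2) u by simp
      ultimately show ?thesis using B(1,3) True by (intro exI[of _ "insert v B"]) auto
    next
      case f: False
      then show ?thesis using B False by (intro exI[of _ B]) auto
    qed
  qed
qed simp

text \<open>Order the vertices by decreasing degree. A vertex with \<open>b\<close> earlier
  neighbours has degree at least \<open>b\<close>, and so has each of these neighbours; hence
  \<open>b * b\<close> is at most the sum of degrees, that is, at most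
  \<open>2 * card E\<close>.\<close>

lemma degeneracy_order:
  assumes g: "simple_graph W E" and d: "2 * card E \<le> d * d"
  shows "\<exists>ws. distinct ws \<and> set ws = W \<and> (\<forall>u\<in>W. back_deg (\<lambda>x y. y \<in> nbrs E x) ws u \<le> d)"
proof -
  have fW: "finite W" using g unfolding simple_graph_def by blast
  define dg where "dg v = card (nbrs E v)" for v
  define ws where "ws = sort_key (\<lambda>v. - int (dg v)) (sorted_list_of_set W)"
  have ws: "distinct ws" "set ws = W" unfolding ws_def using fW by simp_all
  have "sorted (map (\<lambda>v. - int (dg v)) ws)" unfolding ws_def by simp
  then have sw: "sorted_wrt (\<lambda>x y. dg y \<le> dg x) ws" by (simp add: sorted_wrt_map)
  have "back_deg (\<lambda>x y. y \<in> nbrs E x) ws u \<le> d" if u: "u \<in> W" for u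
  proof (rule ccontr)
    let ?b = "back_deg (\<lambda>x y. y \<in> nbrs E x) ws u"
    assume "\<not> ?b \<le> d"
    then have gt: "d + 1 \<le> ?b" by simp
    obtain B where B: "B \<subseteq> set ws" "card B = ?b" "\<forall>v\<in>B. u \<in> nbrs E v \<and> dg u \<le> dg v"
      using back_deg_sorted[OF ws(1) sw, of u "\<lambda>x y. y \<in> nbrs E x"] u ws(2) by auto
    have fB: "finite B" using B(1) finite_subset by blast
    have "nbrs E u \<subseteq> W" using g unfolding simple_graph_def nbrs_def by auto
    then have fn: "finite (nbrs E u)" using fW finite_subset by blast
    have "B \<subseteq> nbrs E u" using B(3) unfolding nbrs_def by auto
    then have "?b \<le> dg u" using card_mono[OF fn] B(2) unfolding dg_def by metis
    then have "?b * ?b \<le> (\<Sum>v\<in>B. dg u)" using B(2) by simp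
    also have "\<dots> \<le> (\<Sum>v\<in>B. dg v)" using B(3) by (intro sum_mono) auto
    also have "\<dots> \<le> 2 * card E" unfolding dg_def by (rule sum_degrees_le[OF g fB])
    finally have "?b * ?b \<le> d * d" using d by simp
    moreover have "(d + 1) * (d + 1) \<le> ?b * ?b" using gt by (intro mult_mono) auto
    ultimately show False by simp
  qed
  then show ?thesis using ws by blast
qed

lemma rank_less:
  fixes u v :: nat
  assumes "finite W" "u \<in> W" "u < v" shows "card {w\<in>W. w < u} < card {w\<in>W. w < v}"
proof -
  have "{w\<in>W. w < u} \<subset> {w\<in>W. w < v}" using assms by auto
  then show ?thesis using assms(1) psubset_card_mono[of "{w\<in>W. w < v}"] by auto
qed

lemma rank_bound:
  fixes u :: nat
  assumes "finite W" "u \<in> W" shows "card {w\<in>W. w < u} < card W"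
proof -
  have "{w\<in>W. w < u} \<subset> W" using assms by auto
  then show ?thesis using assms(1) psubset_card_mono by blast
qed

text \<open>The \<open>r\<close>-th vertex is looked for in the \<open>r\<close>-th of
  \<open>n\<close> consecutive chunks, along an order of back degree at most \<open>d\<close>. The
  exponent of \<open>\<epsilon>\<close> is about the square root of the number of edges, which is
  affordable for the graph with far fewer edges.\<close>

lemma copy_or_sparse_pair:
  fixes \<epsilon> t :: real
  assumes sym: "\<And>x y. c x y = c y x" and g: "simple_graph W E" and n: "card W \<le> n"
    and d: "2 * card E \<le> d * d" and e: "0 < \<epsilon>" "\<epsilon> \<le> 1" "0 < t"
    and V: "finite V" "n * s \<le> card V" "t \<le> real s * \<epsilon> ^ d"
  shows "copy c W E V \<or> sparse_pair c \<epsilon> n t V"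
proof -
  have fW: "finite W" using g unfolding simple_graph_def by blast
  obtain ws where ws: "distinct ws" "set ws = W" "\<And>u. u \<in> W \<Longrightarrow> back_deg (\<lambda>x y. y \<in> nbrs E x) ws u \<le> d"
    using degeneracy_order[OF g d] by blast
  obtain Z where Z: "\<And>j. j < n \<Longrightarrow> Z j \<subseteq> V \<and> card (Z j) = s" "\<And>i j. i < j \<Longrightarrow> j < n \<Longrightarrow> separated (Z i) (Z j)"
    using consecutive_chunks[OF V(1,2)] by blast
  define r where "r u = card {w\<in>W. w < u}" for u
  have rn: "r u < n" if "u \<in> W" for u using rank_bound[OF fW that] n unfolding r_def by simp
  have rless: "r u < r v" if "u \<in> W" "u < v" for u v using rank_less[OF fW that] unfolding r_def .
  define C where "C u = Z (r u)" for u
  have adjs: "(y \<in> nbrs E x) = (x \<in> nbrs E y)" for x y unfolding nbrs_def by auto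
  have lenws: "length ws \<le> n" using ws(1,2) n distinct_card by metis
  have sz: "finite (C u) \<and> t \<le> real (card (C u)) * \<epsilon> ^ back_deg (\<lambda>x y. y \<in> nbrs E x) ws u" if u: "u \<in> set ws" for u
  proof
    have uW: "u \<in> W" using u ws(2) by simp
    show "finite (C u)" using Z(1)[OF rn[OF uW]] V(1) finite_subset unfolding C_def by blast
    have "\<epsilon> ^ d \<le> \<epsilon> ^ back_deg (\<lambda>x y. y \<in> nbrs E x) ws u" using ws(3)[OF uW] e by (intro power_decreasing) auto
    then have "real s * \<epsilon> ^ d \<le> real s * \<epsilon> ^ back_deg (\<lambda>x y. y \<in> nbrs E x) ws u" by (intro mult_left_mono) auto
    then show "t \<le> real (card (C u)) * \<epsilon> ^ back_deg (\<lambda>x y. y \<in> nbrs E x) ws u"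
      using V(3) Z(1)[OF rn[OF uW]] unfolding C_def by simp
  qed
  have sep: "separated (C u) (C v)" if "u \<in> W" "v \<in> W" "u < v" for u v
    unfolding C_def using Z(2)[OF rless[OF that(1,3)] rn[OF that(2)]] .
  have sz': "\<forall>u\<in>set ws. finite (C u) \<and> t \<le> real (card (C u)) * \<epsilon> ^ back_deg (\<lambda>x y. y \<in> nbrs E x) ws u"
    using sz by blast
  from greedy_embedding[of c "\<lambda>x y. y \<in> nbrs E x", OF sym adjs e ws(1) lenws sz']
  show ?thesis
  proof (elim disjE)
    assume "\<exists>\<phi>. (\<forall>u\<in>set ws. \<phi> u \<in> C u) \<and> (\<forall>u\<in>set ws. \<forall>v\<in>set ws. u \<noteq> v \<and> v \<in> nbrs E u \<longrightarrow> c (\<phi> u) (\<phi> v))"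
    then obtain \<phi> where p: "\<And>u. u\<in>W \<Longrightarrow> \<phi> u \<in> C u" "\<And>u v. u\<in>W \<Longrightarrow> v\<in>W \<Longrightarrow> u \<noteq> v \<Longrightarrow> v \<in> nbrs E u \<Longrightarrow> c (\<phi> u) (\<phi> v)"
      using ws(2) by blast
    have "strict_mono_on W \<phi>"
      unfolding strict_mono_on_def using sep p(1) unfolding separated_def by blast
    moreover have "\<phi> ` W \<subseteq> V" using p(1) Z(1) rn unfolding C_def by blast
    moreover have "\<forall>(u,v)\<in>E. c (\<phi> u) (\<phi> v)"
      using p(2) g unfolding simple_graph_def nbrs_def by fastforce
    ultimately have "copy c W E V" unfolding copy_def by blast
    then show ?thesis by blast
  next
    assume "\<exists>u\<in>set ws. \<exists>v\<in>set ws. u \<noteq> v \<and> (\<exists>A B. A \<subseteq> C u \<and> B \<subseteq> C v \<and> t \<le> real n * real (card A)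
       \<and> t \<le> real (card B) \<and> (\<forall>a\<in>A. real (card {b\<in>B. c a b}) \<le> \<epsilon> * real (card B)))"
    then obtain u v A B where o: "u \<in> W" "v \<in> W" "u \<noteq> v" "A \<subseteq> C u" "B \<subseteq> C v" "t \<le> real n * real (card A)"
      "t \<le> real (card B)" "\<forall>a\<in>A. real (card {b\<in>B. c a b}) \<le> \<epsilon> * real (card B)" using ws(2) by blast
    have "separated A B \<or> separated B A"
    proof (cases "u < v")
      case True
      then show ?thesis using sep[OF o(1,2) True] o(4,5) unfolding separated_def by blast
    next
      case False
      then have "v < u" using o(3) by simp
      then show ?thesis using sep[OF o(2,1)] o(4,5) unfolding separated_def by blast
    qed
    moreover have "A \<subseteq> V" "B \<subseteq> V" using o(4,5) Z(1) rn[OF o(1)] rn[OF o(2)] unfolding C_def by blast+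
    ultimately show ?thesis unfolding sparse_pair_def using o(6-8) by blast
  qed
qed

text \<open>Clique vertices in every other position host \<open>S\<close>; the sets \<open>Y\<close> in between are cut into chunks
  for the remaining vertices, so that any interleaving of the two kinds of vertices can be realised.\<close>

lemma fat_copy_or_sparse_pair:
  fixes \<epsilon> t :: real
  assumes sym: "\<And>x y. c x y = c y x" and g: "simple_graph W E" and n: "card W \<le> n" "0 < n"
    and S: "S \<subseteq> W" "\<And>u. u \<in> W - S \<Longrightarrow> card (nbrs E u) \<le> d" and q: "q = 4 * card S + 2"
    and e: "0 < \<epsilon>" "\<epsilon> \<le> 1" "0 < t"
    and M: "1 < M" "\<forall>X. X \<subseteq> V \<and> card X = M \<longrightarrow> has_clique c q X"
    and V: "finite V" "M * (2 * q * M\<^sup>2 * (n * s)) \<le> card V" "t \<le> real s * \<epsilon> ^ d"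
  shows "copy c W E V \<or> sparse_pair c \<epsilon> n t V"
proof -
  have fW: "finite W" using g unfolding simple_graph_def by blast
  have fS: "finite S" using S(1) fW finite_subset by blast
  have s0: "0 < s" using V(3) e by (cases s) auto
  \<comment> \<open>The links in a fat clique lose the factor \<open>2 * q * M\<^sup>2\<close>; what
    remains has room for \<open>n\<close> chunks of size \<open>s\<close>.\<close>
  define s' where "s' = 2 * q * M\<^sup>2 * (n * s)"
  have s'0: "0 < s'" "0 < q" unfolding s'_def q using s0 n M by auto
  have cV: "M * s' \<le> card V" using V(2) s'_def by simp
  obtain B Q x Y where B0: "\<forall>l<M. B l \<subseteq> V" "\<forall>i j. i < j \<and> j < M \<longrightarrow> separated (B i) (B j)"
    and Q: "Q \<subseteq> {..<M}" "q \<le> 2 * card Q"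
    and xY0: "\<forall>l\<in>Q. x l \<in> B l \<and> Y l \<subseteq> B l \<and> s' \<le> 2 * q * M\<^sup>2 * card (Y l)"
    and cc0: "\<forall>l\<in>Q. \<forall>l'\<in>Q. l \<noteq> l' \<longrightarrow> c (x l) (x l') \<and> (\<forall>y\<in>Y l'. c (x l) y)"
    using fat_clique[OF sym V(1) cV s'0(1) M(1) s'0(2) M(2)] by (elim exE conjE) (rule that)
  have B: "\<And>l. l < M \<Longrightarrow> B l \<subseteq> V" "\<And>i j. i < j \<Longrightarrow> j < M \<Longrightarrow> separated (B i) (B j)" using B0 by blast+
  have xY: "\<And>l. l\<in>Q \<Longrightarrow> x l \<in> B l \<and> Y l \<subseteq> B l \<and> s' \<le> 2 * q * M\<^sup>2 * card (Y l)" using xY0 by blast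
  have cc: "\<And>l l'. l\<in>Q \<Longrightarrow> l'\<in>Q \<Longrightarrow> l \<noteq> l' \<Longrightarrow> c (x l) (x l') \<and> (\<forall>y\<in>Y l'. c (x l) y)" using cc0 by blast
  have fQ: "finite Q" using Q(1) finite_subset by blast
  have Ybig: "n * s \<le> card (Y l)" if "l \<in> Q" for l
    using xY[OF that] s'0 M(1) unfolding s'_def by simp
  have Yfin: "finite (Y l)" if "l \<in> Q" for l 
  proof -
    have "l < M" using that Q(1) by blast
    then have "Y l \<subseteq> V" using xY[OF that] B(1)[of l] by blast
    then show ?thesis using V(1) by (rule finite_subset)
  qed
  have "\<forall>l. \<exists>Z. l \<in> Q \<longrightarrow> (\<forall>j<n. Z j \<subseteq> Y l \<and> card (Z j) = s) \<and> (\<forall>i j. i < j \<and> j < n \<longrightarrow> separated (Z i) (Z j))"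
    using consecutive_chunks[OF Yfin Ybig] by blast
  then obtain Z where Z0: "\<forall>l. l \<in> Q \<longrightarrow> (\<forall>j<n. Z l j \<subseteq> Y l \<and> card (Z l j) = s) \<and> (\<forall>i j. i < j \<and> j < n \<longrightarrow> separated (Z l i) (Z l j))"
    by (rule choice[THEN exE])
  have Z: "\<And>l j. l \<in> Q \<Longrightarrow> j < n \<Longrightarrow> Z l j \<subseteq> Y l \<and> card (Z l j) = s"
    "\<And>l i j. l \<in> Q \<Longrightarrow> i < j \<Longrightarrow> j < n \<Longrightarrow> separated (Z l i) (Z l j)"
    using Z0 by blast+
  define p where "p i = sorted_list_of_set Q ! i" for i
  \<comment> \<open>The clique may lose half of its \<open>q\<close> blocks. The remaining
    \<open>2 * card S + 1\<close> suffice: one for each vertex of \<open>S\<close>, and one for each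
    gap before, between and after them.\<close>
  have cQ: "2 * card S + 1 \<le> card Q" using Q(2) q by simp
  have pQ: "p i \<in> Q" if "i \<le> 2 * card S" for i
  proof -
    have "i < length (sorted_list_of_set Q)" using that cQ fQ by simp
    then have "sorted_list_of_set Q ! i \<in> set (sorted_list_of_set Q)" by (rule nth_mem)
    then show ?thesis unfolding p_def using fQ by simp
  qed
  have pless: "p i < p j" if "i < j" "j \<le> 2 * card S" for i j
    unfolding p_def using that cQ fQ sorted_wrt_nth_less[of "(<)" "sorted_list_of_set Q" i j] by simp
  define r where "r u = card {w\<in>W. w < u}" for u
  have rn: "r u < n" if "u \<in> W" for u using rank_bound[OF fW that] n unfolding r_def by simp
  have rless: "r u < r v" if "u \<in> W" "u < v" for u v using rank_less[OF fW that] unfolding r_def .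
  \<comment> \<open>Odd positions belong to \<open>S\<close>, even ones to the gaps. Two vertices
    can only share a position when both lie outside \<open>S\<close>, and then their ranks separate
    them inside one link.\<close>
  define h where "h u = 2 * card {w\<in>S. w < u} + (if u \<in> S then 1 else 0)" for u
  have hb: "h u \<le> 2 * card S" for u
  proof (cases "u \<in> S")
    case True
    then show ?thesis using rank_bound[OF fS True] unfolding h_def by simp
  next
    case False
    have "card {w\<in>S. w < u} \<le> card S" using fS by (intro card_mono) auto
    then show ?thesis using False unfolding h_def by simp
  qed
  have hle: "h u \<le> h v \<and> (h u = h v \<longrightarrow> u \<notin> S \<and> v \<notin> S)" if "u < v" for u v
  proof (cases "u \<in> S")
    case True
    have "card {w\<in>S. w < u} < card {w\<in>S. w < v}" by (rule rank_less[OF fS True that])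
    then show ?thesis using True unfolding h_def by simp
  next
    case False
    have "card {w\<in>S. w < u} \<le> card {w\<in>S. w < v}" using fS that by (intro card_mono) auto
    then show ?thesis using False unfolding h_def by auto
  qed
  define pos where "pos u = p (h u)" for u
  have posQ: "pos u \<in> Q" for u unfolding pos_def using pQ[OF hb] .
  have posM: "pos u < M" for u using posQ Q(1) by blast
  define C where "C u = Z (pos u) (r u)" for u
  have CY: "C u \<subseteq> Y (pos u)" "C u \<subseteq> B (pos u)" "card (C u) = s" if "u \<in> W" for u
    using Z(1)[OF posQ rn[OF that], of u] xY[OF posQ, of u] unfolding C_def by auto
  have sepB: "separated (B (pos u)) (B (pos v))" if "u < v" "h u \<noteq> h v" for u v
  proof -
    have "h u < h v" using hle[OF that(1)] that(2) by simp
    then have "pos u < pos v" unfolding pos_def using pless[OF _ hb] by blast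
    then show ?thesis using B(2) posM by blast
  qed
  have sep: "separated (C u) (C v)" if "u \<in> W" "v \<in> W" "u < v" for u v
  proof (cases "h u = h v")
    case True
    then show ?thesis unfolding C_def pos_def using Z(2)[OF pQ[OF hb] rless[OF that(1,3)] rn[OF that(2)]] by simp
  next
    case False
    then show ?thesis using sepB[OF that(3) False] CY(2) that unfolding separated_def by blast
  qed
  define ws where "ws = sorted_list_of_set (W - S)"
  have ws: "distinct ws" "set ws = W - S" unfolding ws_def using fW by simp_all
  have adjs: "(y \<in> nbrs E x) = (x \<in> nbrs E y)" for x y unfolding nbrs_def by auto
  have lenws: "length ws \<le> n"
  proof -
    have "length ws = card (W - S)" using ws distinct_card by metis
    also have "\<dots> \<le> card W" using fW by (intro card_mono) auto
    finally show ?thesis using n by simp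
  qed
  have sz: "finite (C u) \<and> t \<le> real (card (C u)) * \<epsilon> ^ back_deg (\<lambda>x y. y \<in> nbrs E x) ws u" if u: "u \<in> set ws" for u
  proof
    have uW: "u \<in> W" "u \<in> W - S" using u ws(2) by auto
    show "finite (C u)" using CY(1)[OF uW(1)] Yfin[OF posQ] finite_subset by blast
    have "nbrs E u \<subseteq> W" using g unfolding simple_graph_def nbrs_def by auto
    then have fn: "finite (nbrs E u)" using fW finite_subset by blast
    have "back_deg (\<lambda>x y. y \<in> nbrs E x) ws u \<le> card {v \<in> set ws. u \<in> nbrs E v}" by (rule back_deg_le_card[OF ws(1)])
    also have "\<dots> \<le> card (nbrs E u)" using fn adjs by (intro card_mono) auto
    also have "\<dots> \<le> d" using S(2)[OF uW(2)] .
    finally have "\<epsilon> ^ d \<le> \<epsilon> ^ back_deg (\<lambda>x y. y \<in> nbrs E x) ws u" using e by (intro power_decreasing) auto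
    then have "real s * \<epsilon> ^ d \<le> real s * \<epsilon> ^ back_deg (\<lambda>x y. y \<in> nbrs E x) ws u" by (intro mult_left_mono) auto
    then show "t \<le> real (card (C u)) * \<epsilon> ^ back_deg (\<lambda>x y. y \<in> nbrs E x) ws u"
      using V(3) CY(3)[OF uW(1)] by simp
  qed
  have sz': "\<forall>u\<in>set ws. finite (C u) \<and> t \<le> real (card (C u)) * \<epsilon> ^ back_deg (\<lambda>x y. y \<in> nbrs E x) ws u"
    using sz by blast
  from greedy_embedding[of c "\<lambda>x y. y \<in> nbrs E x", OF sym adjs e ws(1) lenws sz']
  show ?thesis
  proof (elim disjE)
    assume "\<exists>\<phi>. (\<forall>u\<in>set ws. \<phi> u \<in> C u) \<and> (\<forall>u\<in>set ws. \<forall>v\<in>set ws. u \<noteq> v \<and> v \<in> nbrs E u \<longrightarrow> c (\<phi> u) (\<phi> v))"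
    then obtain \<phi> where ph: "\<And>u. u\<in>W - S \<Longrightarrow> \<phi> u \<in> C u"
      "\<And>u v. u\<in>W - S \<Longrightarrow> v\<in>W - S \<Longrightarrow> u \<noteq> v \<Longrightarrow> v \<in> nbrs E u \<Longrightarrow> c (\<phi> u) (\<phi> v)"
      using ws(2) by blast
    define \<psi> where "\<psi> u = (if u \<in> S then x (pos u) else \<phi> u)" for u
    have inB: "\<psi> u \<in> B (pos u)" if "u \<in> W" for u
      using ph(1)[of u] CY(2)[OF that] xY[OF posQ, of u] that unfolding \<psi>_def by auto
    have mono: "\<psi> u < \<psi> v" if "u \<in> W" "v \<in> W" "u < v" for u v
    proof (cases "h u = h v")
      case True
      then have "u \<notin> S" "v \<notin> S" using hle[OF that(3)] by auto
      then show ?thesis using sep[OF that] ph(1) that unfolding \<psi>_def separated_def by simp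
    next
      case False
      then show ?thesis using sepB[OF that(3) False] inB that unfolding separated_def by blast
    qed
    have edge: "c (\<psi> u) (\<psi> v)" if uv: "(u,v) \<in> E" for u v
    proof -
      have W: "u \<in> W" "v \<in> W" "u < v" using uv g unfolding simple_graph_def by auto
      have hne: "pos u \<noteq> pos v" if "u \<in> S \<or> v \<in> S"
      proof -
        have "h u \<noteq> h v" using hle[OF W(3)] that by auto
        then have "h u < h v" using hle[OF W(3)] by simp
        then have "p (h u) < p (h v)" by (rule pless[OF _ hb])
        then show ?thesis unfolding pos_def by simp
      qed
      consider "u \<in> S" "v \<in> S" | "u \<in> S" "v \<notin> S" | "u \<notin> S" "v \<in> S" | "u \<notin> S" "v \<notin> S" by blast
      then show ?thesis
      proof cases
        case 1
        then show ?thesis using cc[OF posQ posQ, of u v] hne unfolding \<psi>_def by simp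
      next
        case 2
        then have "\<phi> v \<in> Y (pos v)" using ph(1)[of v] CY(1)[OF W(2)] W(2) by blast
        then show ?thesis using cc[OF posQ posQ, of u v] hne 2 unfolding \<psi>_def by simp
      next
        case 3
        then have "\<phi> u \<in> Y (pos u)" using ph(1)[of u] CY(1)[OF W(1)] W(1) by blast
        then have "c (x (pos v)) (\<phi> u)" using cc[OF posQ posQ, of v u] hne 3 by auto
        then show ?thesis using 3 sym[of "x (pos v)"] unfolding \<psi>_def by simp
      next
        case 4
        have "v \<in> nbrs E u" using uv unfolding nbrs_def by simp
        then show ?thesis using ph(2)[of u v] 4 W unfolding \<psi>_def by simp
      qed
    qed
    have "strict_mono_on W \<psi>" unfolding strict_mono_on_def using mono by blast
    moreover have "\<psi> ` W \<subseteq> V" using inB B(1)[OF posM] by blast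
    ultimately have "copy c W E V" unfolding copy_def using edge by blast
    then show ?thesis by blast
  next
    assume "\<exists>u\<in>set ws. \<exists>v\<in>set ws. u \<noteq> v \<and> (\<exists>A B. A \<subseteq> C u \<and> B \<subseteq> C v \<and> t \<le> real n * real (card A)
       \<and> t \<le> real (card B) \<and> (\<forall>a\<in>A. real (card {b\<in>B. c a b}) \<le> \<epsilon> * real (card B)))"
    then obtain u v A B' where o: "u \<in> W" "v \<in> W" "u \<noteq> v" "A \<subseteq> C u" "B' \<subseteq> C v" "t \<le> real n * real (card A)"
      "t \<le> real (card B')" "\<forall>a\<in>A. real (card {b\<in>B'. c a b}) \<le> \<epsilon> * real (card B')" using ws(2) by blast
    have "separated A B' \<or> separated B' A"
    proof (cases "u < v")
      case True
      then show ?thesis using sep[OF o(1,2) True] o(4,5) unfolding separated_def by blast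
    next
      case False
      then have "v < u" using o(3) by simp
      then show ?thesis using sep[OF o(2,1)] o(4,5) unfolding separated_def by blast
    qed
    moreover have "A \<subseteq> V" "B' \<subseteq> V" using o(4,5) CY(2)[OF o(1)] CY(2)[OF o(2)] B(1)[OF posM] by blast+
    ultimately show ?thesis unfolding sparse_pair_def using o(6-8) by blast
  qed
qed

section \<open>Exploiting a sparse pair\<close>

lemma clique_on_insert:
  assumes "\<And>x y. c x y = c y x" "clique_on c X" "\<forall>x\<in>X. c v x" shows "clique_on c (insert v X)"
  using assms unfolding clique_on_def by auto

text \<open>Pascal's rule: the two colour neighbourhoods of a vertex cannot both be too small. The
  off-diagonal form matters, since the two clique sizes in use differ widely.\<close>

lemma erdos_szekeres_binomial:
  assumes sym: "\<And>x y. c x y = c y x"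
  shows "finite V \<Longrightarrow> (p + q choose p) \<le> card V \<Longrightarrow> has_clique c p V \<or> has_clique (\<lambda>x y. \<not> c x y) q V"
proof (induction "p + q" arbitrary: p q V)
  case 0
  then show ?case unfolding has_clique_def clique_on_def by (intro disjI1 exI[of _ "{}"]) simp
next
  case (Suc m)
  show ?case
  proof (cases "p = 0 \<or> q = 0")
    case True
    have e: "has_clique d 0 V" for d unfolding has_clique_def clique_on_def by (intro exI[of _ "{}"]) simp
    show ?thesis using True e by auto
  next
    case False
    then obtain p' q' where pq: "p = Suc p'" "q = Suc q'" by (metis not0_implies_Suc)
    have bin: "(p + q choose p) = (p' + q choose p') + (p + q' choose p)"
      unfolding pq by simp
    have "0 < (p + q choose p)" by simp
    then have "V \<noteq> {}" using Suc.prems by auto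
    then obtain v where v: "v \<in> V" by blast
    define A where "A = {x\<in>V - {v}. c v x}"
    define B where "B = {x\<in>V - {v}. \<not> c v x}"
    have AB: "A \<union> B = V - {v}" "A \<inter> B = {}" "finite A" "finite B" unfolding A_def B_def using Suc.prems(1) by auto
    then have "card A + card B = card V - 1" using v Suc.prems(1) by (metis card_Diff_singleton card_Un_disjoint)
    then have "(p' + q choose p') \<le> card A \<or> (p + q' choose p) \<le> card B"
      using bin Suc.prems(2) v Suc.prems(1) by linarith
    then show ?thesis
    proof
      assume a: "(p' + q choose p') \<le> card A"
      have "has_clique c p' A \<or> has_clique (\<lambda>x y. \<not> c x y) q A"
        using Suc.hyps(1)[of p' q A] Suc.hyps(2) pq AB(3) a by simp
      then show ?thesis
      proof
        assume "has_clique c p' A"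
        then obtain X where X: "X \<subseteq> A" "finite X" "card X = p'" "clique_on c X" unfolding has_clique_def by blast
        have "clique_on c (insert v X)" using X(1,4) by (intro clique_on_insert sym) (auto simp: A_def)
        moreover have "v \<notin> X" using X(1) unfolding A_def by auto
        then have "card (insert v X) = p" using X(2,3) pq by simp
        moreover have "insert v X \<subseteq> V" using X(1) v unfolding A_def by auto
        ultimately show ?thesis unfolding has_clique_def using X(2) by blast
      next
        assume "has_clique (\<lambda>x y. \<not> c x y) q A"
        then show ?thesis using has_clique_mono[of _ q A V] A_def by blast
      qed
    next
      assume a: "(p + q' choose p) \<le> card B"
      have "has_clique c p B \<or> has_clique (\<lambda>x y. \<not> c x y) q' B"
        using Suc.hyps(1)[of p q' B] Suc.hyps(2) pq AB(4) a by simp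
      then show ?thesis
      proof
        assume "has_clique (\<lambda>x y. \<not> c x y) q' B"
        then obtain X where X: "X \<subseteq> B" "finite X" "card X = q'" "clique_on (\<lambda>x y. \<not> c x y) X" unfolding has_clique_def by blast
        have "clique_on (\<lambda>x y. \<not> c x y) (insert v X)"
          using X(1,4) sym by (intro clique_on_insert) (auto simp: B_def)
        moreover have "v \<notin> X" using X(1) unfolding B_def by auto
        then have "card (insert v X) = q" using X(2,3) pq by simp
        moreover have "insert v X \<subseteq> V" using X(1) v unfolding B_def by auto
        ultimately show ?thesis unfolding has_clique_def using X(2) by blast
      next
        assume "has_clique c p B"
        then show ?thesis using has_clique_mono[of _ p B V] B_def by blast
      qed
    qed
  qed
qed

text \<open>Counts the patterns of bad neighbours in a clique. For small \<open>\<rho>\<close> this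
  is far below \<open>2 ^ card X\<close>, which keeps the growth rounds cheap even for large
  cliques.\<close>

lemma card_small_subsets:
  assumes "finite X" shows "card {R. R \<subseteq> X \<and> card R \<le> \<rho>} \<le> (card X + 1) ^ \<rho>"
proof -
  have "{R. R \<subseteq> X \<and> card R \<le> \<rho>} = (\<Union>i\<in>{..\<rho>}. {R. R \<subseteq> X \<and> card R = i})" by auto
  then have "card {R. R \<subseteq> X \<and> card R \<le> \<rho>} \<le> (\<Sum>i\<le>\<rho>. card {R. R \<subseteq> X \<and> card R = i})"
    using card_UN_le[of "{..\<rho>}" "\<lambda>i. {R. R \<subseteq> X \<and> card R = i}"] by simp
  also have "\<dots> = (\<Sum>i\<le>\<rho>. card X choose i)" using n_subsets[OF assms] by simp
  \<comment> \<open>The extra factor, at least 1 for \<open>i \<le> \<rho>\<close>, turns the sum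
    into a binomial expansion.\<close>
  also have "\<dots> \<le> (\<Sum>i\<le>\<rho>. (\<rho> choose i) * card X ^ i)"
  proof (rule sum_mono)
    fix i assume "i \<in> {..\<rho>}"
    then have "1 \<le> (\<rho> choose i)" by (simp add: Suc_le_eq)
    moreover have "card X choose i \<le> card X ^ i"
      using binomial_le_pow[of i "card X"] by (cases "i \<le> card X") (simp_all add: binomial_eq_0)
    ultimately have "1 * (card X choose i) \<le> (\<rho> choose i) * card X ^ i" by (rule mult_le_mono)
    then show "card X choose i \<le> (\<rho> choose i) * card X ^ i" by simp
  qed
  also have "\<dots> = (card X + 1) ^ \<rho>" using binomial[of "card X" 1 \<rho>] by simp
  finally show ?thesis .
qed

lemma real_card_filter:
  assumes "finite A" shows "real (card {x\<in>A. P x}) = (\<Sum>x\<in>A. if P x then 1 else 0)"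
  using assms by (simp flip: sum.inter_filter)

text \<open>Fix a clique \<open>K\<close> in \<open>A\<close> and classify the vertices of \<open>B\<close> by their set of bad neighbours in \<open>K\<close>.
  Half of them have at most \<open>\<rho>\<close>, so some pattern is shared by enough vertices to contain a
  second clique; delete the pattern from \<open>K\<close>.\<close>

lemma clique_doubling:
  fixes \<epsilon> t s P :: real
  assumes sp: "sparse_pair c \<epsilon> n t V" and V: "finite V" and pos: "0 < \<epsilon>" "0 < n" "0 < k" "0 < s" "1 \<le> P"
    and cl: "\<And>X. X \<subseteq> V \<Longrightarrow> s \<le> real (card X) \<Longrightarrow> has_clique (\<lambda>x y. \<not> c x y) k X"
    and sym: "\<And>x y. c x y = c y x"
    and t: "real n * s \<le> t" "2 * P * s \<le> t"
    and \<rho>: "2 * \<epsilon> * real k < real \<rho> + 1"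
    and P: "\<And>X :: nat set. finite X \<Longrightarrow> card X = k \<Longrightarrow> real (card {R. R \<subseteq> X \<and> card R \<le> \<rho>}) \<le> P"
  shows "has_clique (\<lambda>x y. \<not> c x y) (2 * k - \<rho>) V"
proof -
  obtain A B where AB: "A \<subseteq> V" "B \<subseteq> V" "separated A B \<or> separated B A" "t \<le> real n * real (card A)" "t \<le> real (card B)"
    "\<And>a. a \<in> A \<Longrightarrow> real (card {b\<in>B. c a b}) \<le> \<epsilon> * real (card B)" using sp unfolding sparse_pair_def by blast
  have fin: "finite A" "finite B" using AB(1,2) V finite_subset by blast+
  have "real n * s \<le> real n * real (card A)" using t(1) AB(4) by linarith
  then have sA: "s \<le> real (card A)" using pos(2) by simp
  obtain X1 where X1: "X1 \<subseteq> A" "finite X1" "card X1 = k" "clique_on (\<lambda>x y. \<not> c x y) X1"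
    using cl[OF AB(1) sA] unfolding has_clique_def by blast
  define R where "R b = {x\<in>X1. c x b}" for b
  have "(\<Sum>b\<in>B. real (card (R b))) = (\<Sum>b\<in>B. \<Sum>x\<in>X1. if c x b then 1 else 0)"
    unfolding R_def using real_card_filter[OF X1(2)] by (intro sum.cong) auto
  also have "\<dots> = (\<Sum>x\<in>X1. \<Sum>b\<in>B. if c x b then 1 else 0)" by (rule sum.swap)
  also have "\<dots> = (\<Sum>x\<in>X1. real (card {b\<in>B. c x b}))" using real_card_filter[OF fin(2)] by (intro sum.cong) auto
  also have "\<dots> \<le> (\<Sum>x\<in>X1. \<epsilon> * real (card B))" using AB(6) X1(1) by (intro sum_mono) auto
  also have "\<dots> = \<epsilon> * real k * real (card B)" using X1(3) by simp
  finally have sumR: "(\<Sum>b\<in>B. real (card (R b))) \<le> \<epsilon> * real k * real (card B)" .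
  define B0 where "B0 = {b\<in>B. card (R b) \<le> \<rho>}"
  have B0: "B0 \<subseteq> B" "finite B0" unfolding B0_def using fin by auto
  have ek: "0 < \<epsilon> * real k" using pos by simp
  \<comment> \<open>Markov's inequality: the mean of \<open>card (R b)\<close> is at most
    \<open>\<epsilon> * k\<close>, while outside \<open>B0\<close> the value is at least twice
    that.\<close>
  have half: "real (card B) \<le> 2 * real (card B0)"
  proof -
    have "real (card (B - B0)) * (2 * \<epsilon> * real k) = (\<Sum>b\<in>B - B0. 2 * \<epsilon> * real k)" by simp
    also have "\<dots> \<le> (\<Sum>b\<in>B - B0. real (card (R b)))"
    proof (rule sum_mono)
      fix b assume "b \<in> B - B0"
      then have "\<rho> + 1 \<le> card (R b)" unfolding B0_def by auto
      then have "real \<rho> + 1 \<le> real (card (R b))" by linarith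
      then show "2 * \<epsilon> * real k \<le> real (card (R b))" using \<rho> by linarith
    qed
    also have "\<dots> \<le> (\<Sum>b\<in>B. real (card (R b)))" using fin by (intro sum_mono2) auto
    finally have "(2 * real (card (B - B0))) * (\<epsilon> * real k) \<le> real (card B) * (\<epsilon> * real k)" using sumR by (simp add: mult_ac)
    then have "2 * real (card (B - B0)) \<le> real (card B)" using ek by (simp only: mult_le_cancel_right_pos)
    moreover have "real (card (B - B0)) = real (card B) - real (card B0)"
      using B0 fin by (simp add: card_Diff_subset card_mono of_nat_diff)
    ultimately show ?thesis by linarith
  qed
  define \<R> where "\<R> = {R. R \<subseteq> X1 \<and> card R \<le> \<rho>}"
  have f\<R>: "finite \<R>" "{} \<in> \<R>" unfolding \<R>_def using X1(2) by auto
  have cR: "real (card \<R>) \<le> P" unfolding \<R>_def by (rule P[OF X1(2,3)])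
  have "\<exists>Q\<in>\<R>. s \<le> real (card {b\<in>B0. R b = Q})"
  proof (rule ccontr)
    assume "\<not> ?thesis"
    then have l: "real (card {b\<in>B0. R b = Q}) < s" if "Q \<in> \<R>" for Q using that not_le by blast
    have "B0 \<subseteq> (\<Union>Q\<in>\<R>. {b\<in>B0. R b = Q})" unfolding B0_def \<R>_def R_def by auto
    then have "card B0 \<le> card (\<Union>Q\<in>\<R>. {b\<in>B0. R b = Q})" using f\<R> B0 by (intro card_mono) auto
    also have "\<dots> \<le> (\<Sum>Q\<in>\<R>. card {b\<in>B0. R b = Q})" by (rule card_UN_le[OF f\<R>(1)])
    finally have "real (card B0) \<le> real (\<Sum>Q\<in>\<R>. card {b\<in>B0. R b = Q})" by (simp only: of_nat_le_iff)
    also have "\<dots> = (\<Sum>Q\<in>\<R>. real (card {b\<in>B0. R b = Q}))" by simp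
    also have "\<dots> < (\<Sum>Q\<in>\<R>. s)" using l f\<R> by (intro sum_strict_mono) auto
    also have "\<dots> = real (card \<R>) * s" by simp
    also have "\<dots> \<le> P * s" using cR pos by (intro mult_right_mono) auto
    finally show False using half AB(5) t(2) by linarith
  qed
  then obtain Q where Q: "Q \<in> \<R>" "s \<le> real (card {b\<in>B0. R b = Q})" by blast
  have subV: "{b\<in>B0. R b = Q} \<subseteq> V" using B0 AB(2) by blast
  obtain X2 where X2: "X2 \<subseteq> {b\<in>B0. R b = Q}" "finite X2" "card X2 = k" "clique_on (\<lambda>x y. \<not> c x y) X2"
    using cl[OF subV Q(2)] unfolding has_clique_def by blast
  have disj: "A \<inter> B = {}" using AB(3) unfolding separated_def by blast
  have X2B: "X2 \<subseteq> B" using X2(1) B0 by blast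
  have "card ((X1 - Q) \<union> X2) = card (X1 - Q) + k"
  proof -
    have "(X1 - Q) \<inter> X2 = {}" using X1(1) X2B disj by blast
    then show ?thesis using X1(2) X2(2,3) by (simp add: card_Un_disjoint)
  qed
  moreover have "card (X1 - Q) \<ge> k - \<rho>"
  proof -
    have "Q \<subseteq> X1" "card Q \<le> \<rho>" using Q(1) unfolding \<R>_def by auto
    then show ?thesis using X1(2,3) card_Diff_subset[of Q X1] finite_subset[of Q X1] by simp
  qed
  ultimately have "2 * k - \<rho> \<le> card ((X1 - Q) \<union> X2)" by linarith
  moreover have "clique_on (\<lambda>x y. \<not> c x y) ((X1 - Q) \<union> X2)"
  proof -
    have cross: "\<not> c x y" if "x \<in> X1 - Q" "y \<in> X2" for x y using that X2(1) unfolding R_def by auto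
    show ?thesis unfolding clique_on_def
    proof (intro ballI impI)
      fix x y assume xy: "x \<in> X1 - Q \<union> X2" "y \<in> X1 - Q \<union> X2" "x \<noteq> y"
      consider "x \<in> X1 - Q" "y \<in> X1 - Q" | "x \<in> X1 - Q" "y \<in> X2" | "x \<in> X2" "y \<in> X1 - Q" | "x \<in> X2" "y \<in> X2"
        using xy by blast
      then show "\<not> c x y"
      proof cases
        case 1 then show ?thesis using X1(4) xy(3) unfolding clique_on_def by simp
      next
        case 2 then show ?thesis by (rule cross)
      next
        case 3 then show ?thesis using cross[of y x] sym[of x y] by simp
      next
        case 4 then show ?thesis using X2(4) xy(3) unfolding clique_on_def by simp
      qed
    qed
  qed
  moreover have "(X1 - Q) \<union> X2 \<subseteq> V" using X1(1) AB(1,2) X2B by blast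
  ultimately have "has_clique (\<lambda>x y. \<not> c x y) (card ((X1 - Q) \<union> X2)) V"
    unfolding has_clique_def using X1(2) X2(2) by blast
  then show ?thesis using \<open>2 * k - \<rho> \<le> card ((X1 - Q) \<union> X2)\<close> has_clique_le by blast
qed

section \<open>Embedding a graph by its two halves\<close>

text \<open>Cut at the first vertex \<open>x\<close> whose inclusion makes the initial segment span
  more than half of the edges. The part before \<open>x\<close> spans at most half, and the part
  from \<open>x\<close> on spans less than half, being edge-disjoint from the segment that includes
  \<open>x\<close>.\<close>

lemma split_edges:
  assumes g: "simple_graph W E"
  shows "\<exists>W1 W2. W = W1 \<union> W2 \<and> separated W1 W2 \<and> 2 * card (E \<inter> W1 \<times> W1) \<le> card E \<and> 2 * card (E \<inter> W2 \<times> W2) \<le> card E"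
proof -
  have fW: "finite W" using g unfolding simple_graph_def by blast
  have fE: "finite E" using g unfolding simple_graph_def by (elim conjE, intro finite_subset[of E "W \<times> W"]) auto
  define P where "P x = {u\<in>W. u < x}" for x
  define e where "e x = card (E \<inter> P x \<times> P x)" for x
  show ?thesis
  proof (cases "\<exists>x. card E < 2 * e (Suc x)")
    case False
    obtain m where m: "\<forall>u\<in>W. u < m" using fW finite_nat_set_iff_bounded by blast
    have "P (Suc m) = W" unfolding P_def using m by auto
    then have "E \<inter> P (Suc m) \<times> P (Suc m) = E" using g unfolding simple_graph_def by auto
    then have "2 * card E \<le> card E" using False e_def by (metis not_less)
    then have "E = {}" using fE by simp
    then show ?thesis by (intro exI[of _ W] exI[of _ "{}"]) (simp add: separated_def)
  next
    case True
    define x where "x = (LEAST x. card E < 2 * e (Suc x))"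
    have x1: "card E < 2 * e (Suc x)" unfolding x_def using True by (rule LeastI_ex)
    have x2: "2 * e x \<le> card E"
    proof (cases x)
      case 0
      then show ?thesis unfolding e_def P_def by simp
    next
      case (Suc y)
      then have "\<not> card E < 2 * e (Suc y)" using not_less_Least[of y "\<lambda>x. card E < 2 * e (Suc x)"] x_def by simp
      then show ?thesis using Suc by simp
    qed
    define W2 where "W2 = W - P x"
    \<comment> \<open>The two vertex sets share at most \<open>x\<close>, and an edge has two
      distinct ends.\<close>
    have "(E \<inter> W2 \<times> W2) \<inter> (E \<inter> P (Suc x) \<times> P (Suc x)) = {}"
      using g unfolding simple_graph_def W2_def P_def by fastforce
    then have "card (E \<inter> W2 \<times> W2) + e (Suc x) = card ((E \<inter> W2 \<times> W2) \<union> (E \<inter> P (Suc x) \<times> P (Suc x)))"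
      unfolding e_def using fE by (simp add: card_Un_disjoint)
    also have "\<dots> \<le> card E" using fE by (intro card_mono) auto
    finally have "2 * card (E \<inter> W2 \<times> W2) \<le> card E" using x1 by linarith
    then show ?thesis using x2 unfolding e_def W2_def
      by (intro exI[of _ "P x"] exI[of _ "W - P x"]) (auto simp: separated_def P_def)
  qed
qed

lemma copy_join:
  assumes g: "simple_graph W E" and W: "W = W1 \<union> W2" "separated W1 W2"
    and A: "separated (\<phi>1 ` W1) (\<phi>2 ` W2)" "strict_mono_on W1 \<phi>1" "strict_mono_on W2 \<phi>2"
      "\<phi>1 ` W1 \<subseteq> V" "\<phi>2 ` W2 \<subseteq> V"
    and e: "\<forall>(u,v)\<in>E \<inter> W1 \<times> W1. c (\<phi>1 u) (\<phi>1 v)" "\<forall>(u,v)\<in>E \<inter> W2 \<times> W2. c (\<phi>2 u) (\<phi>2 v)"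
    and x: "\<And>u v. u \<in> W1 \<Longrightarrow> v \<in> W2 \<Longrightarrow> c (\<phi>1 u) (\<phi>2 v)"
  shows "copy c W E V"
proof -
  define \<phi> where "\<phi> u = (if u \<in> W1 then \<phi>1 u else \<phi>2 u)" for u
  have d: "u \<notin> W1" if "u \<in> W2" for u using W(2) that unfolding separated_def by blast
  have p1: "\<phi> u = \<phi>1 u" if "u \<in> W1" for u using that unfolding \<phi>_def by simp
  have p2: "\<phi> u = \<phi>2 u" if "u \<in> W2" for u using d[OF that] unfolding \<phi>_def by simp
  have no: "\<not> (u \<in> W2 \<and> v \<in> W1)" if "u < v" for u v using W(2) that unfolding separated_def by force
  have "\<phi> u < \<phi> v" if m: "u \<in> W" "v \<in> W" "u < v" for u v
  proof -
    consider "u \<in> W1" "v \<in> W1" | "u \<in> W1" "v \<in> W2" | "u \<in> W2" "v \<in> W2" using m no[OF m(3)] W(1) by blast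
    then show ?thesis
    proof cases
      case 1 then show ?thesis using A(2) m(3) p1 unfolding strict_mono_on_def by simp
    next
      case 2 then show ?thesis using A(1) p1 p2 unfolding separated_def by simp
    next
      case 3 then show ?thesis using A(3) m(3) p2 unfolding strict_mono_on_def by simp
    qed
  qed
  then have "strict_mono_on W \<phi>" unfolding strict_mono_on_def by blast
  moreover have "\<phi> ` W \<subseteq> V" using A(4,5) W(1) p1 p2 by auto
  moreover have "\<forall>(u,v)\<in>E. c (\<phi> u) (\<phi> v)"
  proof clarify
    fix u v assume uv: "(u,v) \<in> E"
    then have m: "u \<in> W" "v \<in> W" "u < v" using g unfolding simple_graph_def by auto
    consider "u \<in> W1" "v \<in> W1" | "u \<in> W1" "v \<in> W2" | "u \<in> W2" "v \<in> W2" using m no[OF m(3)] W(1) by blast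
    then show "c (\<phi> u) (\<phi> v)"
    proof cases
      case 1 then show ?thesis using e(1) uv p1 by auto
    next
      case 2 then show ?thesis using x p1 p2 by simp
    next
      case 3 then show ?thesis using e(2) uv p2 by auto
    qed
  qed
  ultimately show ?thesis unfolding copy_def by blast
qed

text \<open>A union bound: if \<open>card U\<close> is at most \<open>1 / (2 * \<epsilon>)\<close>,
  the members of \<open>U\<close> spoil at most half of \<open>B\<close> together.\<close>

lemma sparse_pair_common:
  assumes "finite B" "\<And>a. a \<in> U \<Longrightarrow> real (card {b\<in>B. c a b}) \<le> \<epsilon> * real (card B)" "finite U"
    "\<epsilon> * real (card U) \<le> 1/2"
  shows "real (card B) \<le> 2 * real (card {b\<in>B. \<forall>a\<in>U. \<not> c a b})"
proof -
  let ?B' = "{b\<in>B. \<forall>a\<in>U. \<not> c a b}"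
  have "B - ?B' \<subseteq> (\<Union>a\<in>U. {b\<in>B. c a b})" by auto
  then have "card (B - ?B') \<le> card (\<Union>a\<in>U. {b\<in>B. c a b})" using assms by (intro card_mono) auto
  also have "\<dots> \<le> (\<Sum>a\<in>U. card {b\<in>B. c a b})" by (rule card_UN_le[OF assms(3)])
  finally have "real (card (B - ?B')) \<le> real (\<Sum>a\<in>U. card {b\<in>B. c a b})" by (simp only: of_nat_le_iff)
  also have "\<dots> = (\<Sum>a\<in>U. real (card {b\<in>B. c a b}))" by simp
  also have "\<dots> \<le> (\<Sum>a\<in>U. \<epsilon> * real (card B))" using assms(2) by (rule sum_mono)
  also have "\<dots> = (\<epsilon> * real (card U)) * real (card B)" by simp
  also have "\<dots> \<le> (1/2) * real (card B)" using assms(4) by (rule mult_right_mono) simp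
  finally have "real (card (B - ?B')) \<le> real (card B) / 2" by simp
  moreover have "real (card (B - ?B')) = real (card B) - real (card ?B')"
    using assms(1) by (simp add: card_Diff_subset card_mono of_nat_diff)
  ultimately show ?thesis by linarith
qed

text \<open>Sparsity is known for each vertex of \<open>A\<close>, so the first segment to be
  embedded always goes to \<open>A\<close>, and the other to those vertices of \<open>B\<close> that
  have no \<open>c\<close>-edge to its image. Which segment comes first depends on whether
  \<open>A\<close> precedes \<open>B\<close> or follows it.\<close>

lemma sparse_pair_halves:
  fixes \<epsilon> t s :: real
  assumes sym: "\<And>x y. c x y = c y x" and V: "finite V" and sp: "sparse_pair c \<epsilon> n t V" "0 < n"
    and g: "simple_graph W E" and W: "W = W1 \<union> W2" "separated W1 W2" and e: "0 < \<epsilon>" "\<epsilon> * real (card W) \<le> 1/2"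
    and t: "real n * s \<le> t" "2 * s \<le> t"
    and c1: "\<And>X. X \<subseteq> V \<Longrightarrow> s \<le> real (card X) \<Longrightarrow> copy (\<lambda>x y. \<not> c x y) W1 (E \<inter> W1 \<times> W1) X"
    and c2: "\<And>X. X \<subseteq> V \<Longrightarrow> s \<le> real (card X) \<Longrightarrow> copy (\<lambda>x y. \<not> c x y) W2 (E \<inter> W2 \<times> W2) X"
  shows "copy (\<lambda>x y. \<not> c x y) W E V"
proof -
  obtain A B where AB: "A \<subseteq> V" "B \<subseteq> V" "separated A B \<or> separated B A" "t \<le> real n * real (card A)" "t \<le> real (card B)"
    "\<And>a. a \<in> A \<Longrightarrow> real (card {b\<in>B. c a b}) \<le> \<epsilon> * real (card B)" using sp unfolding sparse_pair_def by blast
  have fin: "finite A" "finite B" using AB(1,2) V finite_subset by blast+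
  have fW: "finite W" "finite W1" "finite W2" using g W(1) unfolding simple_graph_def by auto
  have "real n * s \<le> real n * real (card A)" using t(1) AB(4) by linarith
  then have sA: "s \<le> real (card A)" using sp(2) by simp
  have com: "s \<le> real (card {b\<in>B. \<forall>a\<in>\<phi> ` U. \<not> c a b})" if "U \<subseteq> W" "\<phi> ` U \<subseteq> A" for U and \<phi> :: "nat \<Rightarrow> nat"
  proof -
    have fU: "finite U" using that fW finite_subset by blast
    have "card (\<phi> ` U) \<le> card W" using card_image_le[OF fU, of \<phi>] card_mono[OF fW(1) that(1)] by linarith
    then have "\<epsilon> * real (card (\<phi> ` U)) \<le> \<epsilon> * real (card W)" using e(1) by simp
    then have le: "\<epsilon> * real (card (\<phi> ` U)) \<le> 1/2" using e(2) by linarith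
    have "real (card B) \<le> 2 * real (card {b\<in>B. \<forall>a\<in>\<phi> ` U. \<not> c a b})"
    proof (rule sparse_pair_common[OF fin(2) _ _ le])
      show "finite (\<phi> ` U)" using fU by simp
      show "\<And>a. a \<in> \<phi> ` U \<Longrightarrow> real (card {b\<in>B. c a b}) \<le> \<epsilon> * real (card B)" using that(2) AB(6) by blast
    qed
    then show ?thesis using AB(5) t(2) by linarith
  qed
  show ?thesis
    using AB(3)
  proof
    assume sep: "separated A B"
    obtain \<phi>1 where p1: "strict_mono_on W1 \<phi>1" "\<phi>1 ` W1 \<subseteq> A" "\<forall>(u,v)\<in>E \<inter> W1 \<times> W1. \<not> c (\<phi>1 u) (\<phi>1 v)"
      using c1[OF AB(1) sA] unfolding copy_def by blast
    let ?B' = "{b\<in>B. \<forall>a\<in>\<phi>1 ` W1. \<not> c a b}"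
    have "?B' \<subseteq> V" using AB(2) by blast
    moreover have "s \<le> real (card ?B')" using com[of W1 \<phi>1] p1(2) W(1) by simp
    ultimately obtain \<phi>2 where p2: "strict_mono_on W2 \<phi>2" "\<phi>2 ` W2 \<subseteq> ?B'" "\<forall>(u,v)\<in>E \<inter> W2 \<times> W2. \<not> c (\<phi>2 u) (\<phi>2 v)"
      using c2[of ?B'] unfolding copy_def by blast
    have s12: "separated (\<phi>1 ` W1) (\<phi>2 ` W2)" using sep p1(2) p2(2) unfolding separated_def by blast
    have x: "\<And>u v. u \<in> W1 \<Longrightarrow> v \<in> W2 \<Longrightarrow> \<not> c (\<phi>1 u) (\<phi>2 v)" using p2(2) by blast
    have i: "\<phi>1 ` W1 \<subseteq> V" "\<phi>2 ` W2 \<subseteq> V" using p1(2) p2(2) AB(1,2) by blast+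
    show ?thesis by (rule copy_join[OF g W s12 p1(1) p2(1) i p1(3) p2(3) x])
  next
    assume sep: "separated B A"
    obtain \<phi>2 where p2: "strict_mono_on W2 \<phi>2" "\<phi>2 ` W2 \<subseteq> A" "\<forall>(u,v)\<in>E \<inter> W2 \<times> W2. \<not> c (\<phi>2 u) (\<phi>2 v)"
      using c2[OF AB(1) sA] unfolding copy_def by blast
    let ?B' = "{b\<in>B. \<forall>a\<in>\<phi>2 ` W2. \<not> c a b}"
    have "?B' \<subseteq> V" using AB(2) by blast
    moreover have "s \<le> real (card ?B')" using com[of W2 \<phi>2] p2(2) W(1) by simp
    ultimately obtain \<phi>1 where p1: "strict_mono_on W1 \<phi>1" "\<phi>1 ` W1 \<subseteq> ?B'" "\<forall>(u,v)\<in>E \<inter> W1 \<times> W1. \<not> c (\<phi>1 u) (\<phi>1 v)"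
      using c1[of ?B'] unfolding copy_def by blast
    have s12: "separated (\<phi>1 ` W1) (\<phi>2 ` W2)" using sep p1(2) p2(2) unfolding separated_def by blast
    have x: "\<And>u v. u \<in> W1 \<Longrightarrow> v \<in> W2 \<Longrightarrow> \<not> c (\<phi>1 u) (\<phi>2 v)" using p1(2) sym by blast
    have i: "\<phi>1 ` W1 \<subseteq> V" "\<phi>2 ` W2 \<subseteq> V" using p1(2) p2(2) AB(1,2) by blast+
    show ?thesis by (rule copy_join[OF g W s12 p1(1) p2(1) i p1(3) p2(3) x])
  qed
qed

text \<open>Between consecutive elements of \<open>V'\<close> there are \<open>n\<close> elements of \<open>V\<close>, which leaves room for
  isolated vertices.\<close>

lemma thin_out:
  fixes V :: "nat set"
  assumes V: "finite V" "(s + 1) * (n + 1) \<le> card V"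
  shows "\<exists>V'\<subseteq>V. card V' = s \<and> (\<forall>c W E. simple_graph W E \<longrightarrow> card W \<le> n \<longrightarrow>
    copy c {u\<in>W. nbrs E u \<noteq> {}} E V' \<longrightarrow> copy c W E V)"
proof -
  let ?ys = "sorted_list_of_set V"
  define y where "y i = ?ys ! i" for i
  have len: "length ?ys = card V" by simp
  have ymono: "y i < y j" if "i < j" "j < card V" for i j
    unfolding y_def using that sorted_wrt_nth_less[of "(<)" ?ys i j] len by simp
  have yV: "y i \<in> V" if "i < card V" for i
  proof -
    have "?ys ! i \<in> set ?ys" using that len by (intro nth_mem) simp
    then show ?thesis unfolding y_def using V(1) by simp
  qed
  have idx: "j * (n + 1) + i < card V" if "j \<le> s" "i \<le> n" for i j
  proof -
    have "j * (n + 1) + i < (j + 1) * (n + 1)" using that by simp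
    also have "\<dots> \<le> (s + 1) * (n + 1)" using that by (intro mult_right_mono) auto
    finally show ?thesis using V(2) by simp
  qed
  \<comment> \<open>Starting at index 1 rather than 0 leaves room for isolated vertices before the
    first chosen element; the extra block in \<open>s + 1\<close> leaves room after the
    last.\<close>
  define V' where "V' = (\<lambda>j. y (j * (n + 1))) ` {1..s}"
  have "V' \<subseteq> V" unfolding V'_def using idx[of _ 0] yV by auto
  moreover have "card V' = s"
  proof -
    have "inj_on (\<lambda>j. y (j * (n + 1))) {1..s}"
    proof (rule linorder_inj_onI')
      fix i j assume "i \<in> {1..s}" "j \<in> {1..s}" "i < j"
      then have "y (i * (n+1)) < y (j * (n+1))" using idx[of j 0] mult_less_mono1[of i j "n+1"] by (intro ymono) auto
      then show "y (i * (n+1)) \<noteq> y (j * (n+1))" by simp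
    qed
    then show ?thesis unfolding V'_def by (simp add: card_image)
  qed
  moreover have "copy c W E V" if g: "simple_graph W E" and n: "card W \<le> n" and cp: "copy c {u\<in>W. nbrs E u \<noteq> {}} E V'" for c W E
  proof -
    let ?W = "{u\<in>W. nbrs E u \<noteq> {}}"
    have fW: "finite W" using g unfolding simple_graph_def by blast
    obtain \<phi> where ph: "strict_mono_on ?W \<phi>" "\<phi> ` ?W \<subseteq> V'" "\<forall>(u,v)\<in>E. c (\<phi> u) (\<phi> v)" using cp unfolding copy_def by blast
    have "\<forall>u. \<exists>j. u \<in> ?W \<longrightarrow> j \<in> {1..s} \<and> \<phi> u = y (j * (n + 1))" using ph(2) unfolding V'_def by blast
    then obtain J where J0: "\<forall>u. u \<in> ?W \<longrightarrow> J u \<in> {1..s} \<and> \<phi> u = y (J u * (n + 1))" by (rule choice[THEN exE])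
    have J: "J u \<in> {1..s}" "\<phi> u = y (J u * (n + 1))" if "u \<in> ?W" for u using J0 that by blast+
    have Jmono: "J u < J v" if "u \<in> ?W" "v \<in> ?W" "u < v" for u v
    proof (rule ccontr)
      assume "\<not> J u < J v"
      then have "J v * (n+1) \<le> J u * (n+1)" by (intro mult_right_mono) auto
      moreover have "J u * (n+1) < card V" using idx[of "J u" 0] J(1)[OF that(1)] by simp
      ultimately have "y (J v * (n+1)) \<le> y (J u * (n+1))" using ymono[of "J v * (n+1)" "J u * (n+1)"] by (cases "J v * (n+1) = J u * (n+1)") auto
      moreover have "\<phi> u < \<phi> v" using ph(1) that unfolding strict_mono_on_def by blast
      ultimately show False using J(2)[OF that(1)] J(2)[OF that(2)] by simp
    qed
    define r where "r u = card {w\<in>W. w < u}" for u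
    have rn: "r u < n" if "u \<in> W" for u using rank_bound[OF fW that] n unfolding r_def by simp
    have rless: "r u < r v" if "u \<in> W" "u < v" for u v using rank_less[OF fW that] unfolding r_def .
    define P where "P w = {u\<in>?W. u \<le> w}" for w
    have fP: "finite (P w)" for w unfolding P_def using fW by simp
    \<comment> \<open>A vertex is placed in the gap after the image of the last non-isolated vertex
      not exceeding it, with 0 for the gap before all of them. The offset \<open>i\<close> is 0
      exactly at non-isolated vertices, so \<open>\<psi>\<close> extends \<open>\<phi>\<close>, and
      isolated ones are spread by rank.\<close>
    define j where "j w = (if P w = {} then 0 else J (Max (P w)))" for w
    define i where "i w = (if w \<in> ?W then 0 else r w + 1)" for w
    have jb: "j w \<le> s" for w
    proof (cases "P w = {}")
      case False
      then have "Max (P w) \<in> P w" using fP Max_in by blast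
      then show ?thesis unfolding j_def P_def using J(1) False by auto
    qed (simp add: j_def)
    have ib: "i w \<le> n" if "w \<in> W" for w unfolding i_def using rn[OF that] by auto
    have jW: "j w = J w" if "w \<in> ?W" for w
    proof -
      have "w \<in> P w" unfolding P_def using that by simp
      moreover have "Max (P w) = w" using \<open>w \<in> P w\<close> fP by (intro Max_eqI) (auto simp: P_def)
      ultimately show ?thesis unfolding j_def by auto
    qed
    have jmono: "j u \<le> j v" if "u \<le> v" for u v
    proof (cases "P u = {}")
      case False
      have sub: "P u \<subseteq> P v" using that unfolding P_def by auto
      then have vne: "P v \<noteq> {}" using False by blast
      have m: "Max (P u) \<le> Max (P v)" using sub False fP by (intro Max_mono)
      have mem: "Max (P u) \<in> ?W" "Max (P v) \<in> ?W" using Max_in[OF fP False] Max_in[OF fP vne] unfolding P_def by auto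
      have "J (Max (P u)) \<le> J (Max (P v))" using m Jmono[OF mem] by (cases "Max (P u) = Max (P v)") auto
      then show ?thesis unfolding j_def using False vne by simp
    qed (simp add: j_def)
    define \<psi> where "\<psi> w = y (j w * (n + 1) + i w)" for w
    have mono: "\<psi> u < \<psi> v" if uv: "u \<in> W" "v \<in> W" "u < v" for u v
    proof -
      have "j u * (n + 1) + i u < j v * (n + 1) + i v"
      proof (cases "v \<in> ?W")
        case True
        have "j u < j v"
        proof (cases "P u = {}")
          case True
          then show ?thesis using jW[OF \<open>v \<in> ?W\<close>] J(1)[OF \<open>v \<in> ?W\<close>] unfolding j_def by simp
        next
          case False
          then have "Max (P u) \<in> P u" using fP Max_in by blast
          then have "Max (P u) \<in> ?W" "Max (P u) < v" unfolding P_def using uv(3) by auto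
          then show ?thesis using Jmono[OF _ True] jW[OF True] False unfolding j_def by simp
        qed
        then have "(j u + 1) * (n + 1) \<le> j v * (n + 1)" by (intro mult_right_mono) auto
        then show ?thesis using ib[OF uv(1)] by simp
      next
        case False
        have "j u * (n + 1) \<le> j v * (n + 1)" using jmono[of u v] uv(3) by (intro mult_right_mono) auto
        moreover have "i u < i v" unfolding i_def using False rless[OF uv(1,3)] by auto
        ultimately show ?thesis by linarith
      qed
      then show ?thesis unfolding \<psi>_def using idx[OF jb ib[OF uv(2)], of v] by (rule ymono)
    qed
    have "strict_mono_on W \<psi>" unfolding strict_mono_on_def using mono by blast
    moreover have "\<psi> ` W \<subseteq> V" unfolding \<psi>_def using yV[OF idx[OF jb ib]] by blast
    moreover have "\<psi> u = \<phi> u" if "u \<in> ?W" for u unfolding \<psi>_def i_def using that jW[OF that] J(2)[OF that] by simp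
    moreover have "u \<in> ?W" "v \<in> ?W" if "(u,v) \<in> E" for u v using that g unfolding simple_graph_def nbrs_def by auto
    ultimately show ?thesis unfolding copy_def using ph(3) by (intro exI[of _ \<psi>]) fastforce
  qed
  ultimately show ?thesis by blast
qed

lemma card_verts_le:
  assumes g: "simple_graph W E" and i: "\<And>u. u \<in> W \<Longrightarrow> nbrs E u \<noteq> {}"
  shows "card W \<le> 2 * card E"
proof -
  have fW: "finite W" using g unfolding simple_graph_def by blast
  have "card W = (\<Sum>u\<in>W. 1)" by simp
  also have "\<dots> \<le> (\<Sum>u\<in>W. card (nbrs E u))"
  proof (rule sum_mono)
    fix u assume u: "u \<in> W"
    have "nbrs E u \<subseteq> W" using g unfolding simple_graph_def nbrs_def by auto
    then have "finite (nbrs E u)" using fW finite_subset by blast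
    then show "1 \<le> card (nbrs E u)" using i[OF u] by (simp add: Suc_le_eq card_gt_0_iff)
  qed
  also have "\<dots> \<le> 2 * card E" by (rule sum_degrees_le[OF g fW])
  finally show ?thesis .
qed

lemma card_high_degree:
  fixes D :: real
  assumes g: "simple_graph W E" and D: "0 < D"
  shows "real (card {u\<in>W. D < real (card (nbrs E u))}) \<le> 2 * real (card E) / D"
proof -
  have fW: "finite W" using g unfolding simple_graph_def by blast
  let ?S = "{u\<in>W. D < real (card (nbrs E u))}"
  have "real (card ?S) * D = (\<Sum>u\<in>?S. D)" by simp
  also have "\<dots> \<le> (\<Sum>u\<in>?S. real (card (nbrs E u)))" by (intro sum_mono) auto
  also have "\<dots> = real (\<Sum>u\<in>?S. card (nbrs E u))" by simp
  also have "\<dots> \<le> real (2 * card E)" using sum_degrees_le[OF g, of ?S] fW by (simp only: of_nat_le_iff) simp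
  finally show ?thesis using D by (simp add: field_simps)
qed

section \<open>Growing cliques\<close>

text \<open>Makes the trade-off in the degree threshold \<open>D\<close> visible. The set size
  \<open>M\<close> that forces the clique is about \<open>exp h\<close> and enters cubed, whence
  \<open>3 * h\<close> for the vertices of high degree; those of low degree cost
  \<open>D * ln (1 / \<epsilon>)\<close>. Rounding gives \<open>M \<le> 3 * exp h\<close> and
  doubles the chunk size, hence \<open>108 = 2 * 27 * 2\<close>.\<close>

lemma fat_copy_or_sparse_pair_exp:
  fixes \<epsilon> t h D :: real
  assumes sym: "\<And>x y. c x y = c y x" and g: "simple_graph W E" and n: "card W \<le> n" "0 < n"
    and D: "0 < D" and S: "S = {u\<in>W. D < real (card (nbrs E u))}" and q: "q = 4 * card S + 2"
    and e: "0 < \<epsilon>" "\<epsilon> \<le> 1" and t: "1 \<le> t" and h: "0 \<le> h"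
    and cl: "\<And>X. X \<subseteq> V \<Longrightarrow> exp h \<le> real (card X) \<Longrightarrow> has_clique c q X"
    and V: "finite V" "108 * real q * real n * exp (3 * h + D * ln (1 / \<epsilon>)) * t \<le> real (card V)"
  shows "copy c W E V \<or> sparse_pair c \<epsilon> n t V"
proof -
  define d where "d = nat \<lfloor>D\<rfloor>"
  define M where "M = nat \<lceil>exp h\<rceil> + 1"
  define x where "x = exp (D * ln (1 / \<epsilon>))"
  define s where "s = nat \<lceil>t * x\<rceil>"
  have eh: "1 \<le> exp h" using h by simp
  have lne: "0 \<le> ln (1 / \<epsilon>)" using e by simp
  have x1: "1 \<le> x" unfolding x_def using lne D by simp
  have M1: "real M \<le> exp h + 2" "exp h \<le> real M" unfolding M_def using eh by linarith+
  have M3: "real M \<le> 3 * exp h" using M1 eh by linarith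
  have M2: "1 < M" using eh unfolding M_def by simp
  have tx: "1 \<le> t * x" using t x1 mult_mono[of 1 t 1 x] by simp
  have s1: "t * x \<le> real s" "real s \<le> 2 * (t * x)" unfolding s_def using tx by linarith+
  have dD: "real d \<le> D" unfolding d_def using D by linarith
  have "\<epsilon> ^ d * x \<ge> 1"
  proof -
    have "x = (1 / \<epsilon>) powr D" unfolding x_def powr_def using e by simp
    moreover have "(1 / \<epsilon>) ^ d \<le> (1 / \<epsilon>) powr D"
      using e dD by (subst powr_realpow[symmetric]) (auto intro!: powr_mono)
    ultimately have "\<epsilon> ^ d * (1 / \<epsilon>) ^ d \<le> \<epsilon> ^ d * x" using e by (intro mult_left_mono) auto
    moreover have "\<epsilon> ^ d * (1 / \<epsilon>) ^ d = 1" using e by (simp add: power_one_over)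
    ultimately show ?thesis by linarith
  qed
  then have "t * 1 \<le> t * (\<epsilon> ^ d * x)" using t by (intro mult_left_mono) auto
  also have "\<dots> = (t * x) * \<epsilon> ^ d" by simp
  also have "\<dots> \<le> real s * \<epsilon> ^ d" using s1(1) e by (intro mult_right_mono) auto
  finally have ts: "t \<le> real s * \<epsilon> ^ d" by simp
  have "real (M * (2 * q * M\<^sup>2 * (n * s))) = 2 * real q * real n * (real M) ^ 3 * real s"
    by (simp add: power2_eq_square power3_eq_cube)
  also have "\<dots> \<le> 2 * real q * real n * (3 * exp h) ^ 3 * (2 * (t * x))"
    using M3 s1(2) tx by (intro mult_mono power_mono mult_nonneg_nonneg) auto
  also have "\<dots> = 108 * real q * real n * (exp h ^ 3 * x) * t" by (simp add: power_mult_distrib)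
  also have "exp h ^ 3 * x = exp (3 * h + D * ln (1 / \<epsilon>))" unfolding x_def by (simp add: exp_add exp_of_nat_mult[symmetric])
  also have "108 * real q * real n * exp (3 * h + D * ln (1 / \<epsilon>)) * t \<le> real (card V)" by (rule V(2))
  finally have cV: "M * (2 * q * M\<^sup>2 * (n * s)) \<le> card V" by (simp only: of_nat_le_iff)
  have clM: "\<forall>X. X \<subseteq> V \<and> card X = M \<longrightarrow> has_clique c q X" using cl M1(2) by blast
  have SW: "S \<subseteq> W" unfolding S by blast
  have deg: "card (nbrs E u) \<le> d" if "u \<in> W - S" for u
    using that unfolding S d_def by (simp add: not_less le_nat_floor)
  have t0: "0 < t" using t by simp
  show ?thesis by (rule fat_copy_or_sparse_pair[OF sym g n SW deg q e t0 M2 clM V(1) cV ts])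
qed

text \<open>The familiar bound \<open>(e n / k)^k\<close>: a single term of the expansion of
  \<open>(1 + x)^n\<close>, which is at most \<open>exp (n x)\<close>, at
  \<open>x = k / n\<close>.\<close>

lemma binomial_exp_bound:
  assumes "0 < k" "k \<le> n"
  shows "real (n choose k) \<le> exp (real k * (1 + ln (real n / real k)))"
proof -
  define x where "x = real k / real n"
  have n0: "0 < real n" "0 < real k" using assms by auto
  have x0: "0 < x" unfolding x_def using n0 by simp
  have "real (n choose k) * x ^ k \<le> (\<Sum>i\<le>n. real (n choose i) * x ^ i)"
    using assms x0 by (intro member_le_sum) auto
  also have "\<dots> = (x + 1) ^ n" using binomial_ring[of x 1 n] by simp
  also have "\<dots> \<le> exp x ^ n" using x0 exp_ge_add_one_self[of x] by (intro power_mono) (auto simp: add.commute)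
  also have "\<dots> = exp (real n * x)" by (simp add: exp_of_nat_mult[symmetric])
  also have "\<dots> = exp (real k)" unfolding x_def using n0 by simp
  finally have "real (n choose k) * x ^ k \<le> exp (real k)" .
  then have "real (n choose k) \<le> exp (real k) / x ^ k" using x0 by (simp add: field_simps)
  also have "\<dots> = exp (real k) * (real n / real k) ^ k" unfolding x_def using n0 by (simp add: field_simps)
  also have "(real n / real k) ^ k = exp (real k * ln (real n / real k))" using n0 by (simp add: exp_of_nat_mult)
  finally show ?thesis by (simp add: exp_add[symmetric] algebra_simps)
qed

text \<open>Induction on \<open>k\<close> through cliques of size about \<open>2k/3\<close>, nearly
  doubled by a \<open>c\<close>-sparse pair of constant density. Since a clique of size
  \<open>k\<close> in the negated colour is excluded, the clique in \<open>c\<close> that hosts the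
  high degrees comes from the binomial Ramsey bound. One step costs a multiple of
  \<open>k + sqrt k * A\<close>, and this quantity drops to at most \<open>11/12\<close> of itself,
  so the costs sum geometrically: the constant 360 leaves \<open>30 * \<Theta>\<close> for each
  step.\<close>

lemma clique_or_copy:
  assumes sym: "\<And>x y. c x y = c y x" and g: "simple_graph W E" and iso: "\<And>u. u \<in> W \<Longrightarrow> nbrs E u \<noteq> {}"
    and E0: "E \<noteq> {}" and A: "A = real (card E) powr (1/4)"
  shows "finite V \<Longrightarrow> exp (360 * (real k + sqrt (real k) * A)) \<le> real (card V) \<Longrightarrow>
    copy c W E V \<or> has_clique (\<lambda>x y. \<not> c x y) k V"
proof (induction k arbitrary: V rule: less_induct)
  case (less k)
  have fE: "finite E" using g unfolding simple_graph_def by (elim conjE, intro finite_subset[of E "W \<times> W"]) auto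
  have fW: "finite W" using g unfolding simple_graph_def by blast
  have cE: "1 \<le> card E" using E0 fE by (simp add: Suc_le_eq card_gt_0_iff)
  have A1: "1 \<le> A" unfolding A using cE by (intro ge_one_powr_ge_zero) auto
  have A4: "real (card E) = A ^ 4"
    unfolding A using cE by (subst powr_realpow[symmetric]) (auto simp: powr_powr)
  have nW: "card W \<le> 2 * card E" by (rule card_verts_le[OF g iso])
  have eA: "A \<le> exp A" using exp_ge_add_one_self[of A] by linarith
  show ?case
  proof (cases "k \<le> 3")
    case True
    show ?thesis
    proof (cases "k = 0")
      case True
      then show ?thesis unfolding has_clique_def clique_on_def by (intro disjI2 exI[of _ "{}"]) simp
    next
      case False
      have "real (card W + k choose card W) = real (card W + k choose k)" by (simp add: binomial_symmetric[of "card W" "card W + k"])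
      also have "\<dots> \<le> real ((card W + k) ^ k)" using binomial_le_pow[of k "card W + k"] by (simp only: of_nat_le_iff)
      also have "\<dots> \<le> real (card W + k) ^ 3" using True False by (simp, intro power_increasing) auto
      also have "\<dots> \<le> (5 * A ^ 4) ^ 3"
      proof (intro power_mono)
        have "real (card W + k) \<le> 2 * A ^ 4 + 3" using nW True A4 by linarith
        also have "\<dots> \<le> 5 * A ^ 4" using one_le_power[OF A1, of 4] by linarith
        finally show "real (card W + k) \<le> 5 * A ^ 4" .
      qed simp
      also have "\<dots> = 125 * A ^ 12" by (simp add: power_mult_distrib power_mult[symmetric])
      also have "\<dots> \<le> exp 1 ^ 7 * exp A ^ 12"
      proof (intro mult_mono power_mono eA)
        have "(125::real) \<le> 2 ^ 7" by simp
        also have "\<dots> \<le> exp 1 ^ 7" using exp_ge_add_one_self[of 1] by (intro power_mono) auto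
        finally show "(125::real) \<le> exp 1 ^ 7" .
      qed (use A1 in auto)
      also have "\<dots> = exp (7 + 12 * A)" by (simp add: exp_add exp_of_nat_mult[symmetric])
      also have "\<dots> \<le> exp (360 * (real k + sqrt (real k) * A))"
      proof -
        define y where "y = sqrt (real k) * A"
        have "1 * A \<le> y" unfolding y_def using False A1 by (intro mult_right_mono) auto
        moreover have "1 \<le> real k" using False by simp
        ultimately have "7 + 12 * A \<le> 360 * (real k + y)" using A1 by argo
        then show ?thesis unfolding y_def by simp
      qed
      finally have "card W + k choose card W \<le> card V" using less.prems(2) by linarith
      then have "has_clique c (card W) V \<or> has_clique (\<lambda>x y. \<not> c x y) k V"
        using erdos_szekeres_binomial[of c V "card W" k] sym less.prems(1) by blast
      then show ?thesis using clique_imp_copy[OF g] by blast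
    qed
  next
    case False
    then have k4: "4 \<le> k" by simp
    define K where "K = real k"
    have K4: "4 \<le> K" unfolding K_def using k4 by simp
    \<comment> \<open>This is \<open>2k/3\<close> rounded up; doubling it and deleting a quarter
      leaves at least \<open>7k/6\<close>. For \<open>k \<ge> 4\<close> it is at most
      \<open>5k/6\<close>, and \<open>5/6\<close> is just below \<open>(11/12)^2\<close>; smaller
      \<open>k\<close> are left to the base case.\<close>
    define k' where "k' = (2 * k + 2) div 3"
    have k'1: "3 * k' \<le> 2 * k + 2" "2 * k \<le> 3 * k'" unfolding k'_def by auto
    then have k'lt: "k' < k" "0 < k'" using k4 by auto
    define w where "w = sqrt K * A"
    define \<Theta> where "\<Theta> = K + w"
    define \<Theta>' where "\<Theta>' = real k' + sqrt (real k') * A"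
    have sqK: "2 \<le> sqrt K" using K4 real_sqrt_le_mono[of 4 K] by simp
    have sqA: "2 * A \<le> w" unfolding w_def using sqK A1 by (intro mult_right_mono) auto
    have gap: "\<Theta>' \<le> 11/12 * \<Theta>"
    proof -
      have "real k' \<le> 5/6 * K" using k'1(1) k4 unfolding K_def by linarith
      then have "sqrt (real k') \<le> sqrt (121/144 * K)" using K4 by (intro real_sqrt_le_mono) auto
      also have "\<dots> = 11/12 * sqrt K" by (simp add: real_sqrt_mult real_sqrt_divide)
      finally have "sqrt (real k') * A \<le> 11/12 * sqrt K * A" using A1 by (intro mult_right_mono) auto
      moreover have "real k' \<le> 11/12 * K" using \<open>real k' \<le> 5/6 * K\<close> K4 by linarith
      ultimately show ?thesis unfolding \<Theta>_def \<Theta>'_def w_def by (simp add: algebra_simps)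
    qed
    show ?thesis
    proof (rule ccontr)
      assume "\<not> ?thesis"
      then have nc: "\<not> copy c W E V" and nk: "\<not> has_clique (\<lambda>x y. \<not> c x y) k V" by auto
      have sub1: "has_clique (\<lambda>x y. \<not> c x y) k' X" if X: "X \<subseteq> V" "exp (360 * \<Theta>') \<le> real (card X)" for X
        using less.IH[OF k'lt(1), of X] X finite_subset[OF X(1) less.prems(1)] nc copy_mono[of c W E X V]
        unfolding \<Theta>'_def by blast
      \<comment> \<open>The low degrees then cost \<open>w * ln 8\<close>, and only about
        \<open>A ^ 3 / sqrt K\<close> vertices exceed the threshold.\<close>
      define D where "D = w"
      have D0: "0 < D" unfolding D_def using sqA A1 by linarith
      define S where "S = {u\<in>W. D < real (card (nbrs E u))}"
      define q where "q = 4 * card S + 2"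
      have S1: "real (card S) \<le> 2 * A ^ 3 / sqrt K"
      proof -
        have "real (card S) \<le> 2 * real (card E) / D" unfolding S_def by (rule card_high_degree[OF g D0])
        also have "\<dots> = 2 * A ^ 3 / sqrt K" unfolding A4 D_def w_def using A1 sqK by (simp add: field_simps eval_nat_numeral)
        finally show ?thesis .
      qed
      \<comment> \<open>The ratio \<open>q / K\<close> is of order \<open>z ^ 3\<close>, but only
        its logarithm enters the Ramsey bound: \<open>K * ln (1 + z)\<close> is at most
        \<open>K * z = sqrt K * A\<close>, the same order as the cost of the low degrees.\<close>
      define z where "z = A / sqrt K"
      have "0 < z" unfolding z_def using A1 sqK by (intro divide_pos_pos) linarith+
      then have z0: "0 \<le> z" "0 < z" by simp_all
      have Kz: "K * z = w" 
      proof -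
        have "K * z = (K / sqrt K) * A" unfolding z_def by simp
        then show ?thesis unfolding w_def using real_div_sqrt[of K] K4 by simp
      qed
      have qK: "real (q + k) / K \<le> 8 * (1 + z) ^ 3"
      proof -
        have "real (q + k) \<le> 8 * A ^ 3 / sqrt K + 2 + K" unfolding q_def K_def using S1 K_def by simp
        then have "real (q + k) / K \<le> (8 * A ^ 3 / sqrt K + 2 + K) / K" using K4 by (intro divide_right_mono) auto
        also have "\<dots> = 8 * (A ^ 3 / (sqrt K * K)) + 2 / K + 1" using K4 by (simp add: field_simps)
        also have "A ^ 3 / (sqrt K * K) = z ^ 3"
        proof -
          have "sqrt K * K = sqrt K ^ 3" using K4 by (simp add: power3_eq_cube)
          then show ?thesis unfolding z_def by (simp add: power_divide)
        qed
        also have "8 * z ^ 3 + 2 / K + 1 \<le> 8 * (1 + z) ^ 3"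
        proof -
          have "2 / K \<le> 1" using K4 by simp
          moreover have "(1 + z) ^ 3 = 1 + 3 * z + 3 * z ^ 2 + z ^ 3" by (simp add: power3_eq_cube power2_eq_square algebra_simps)
          moreover have "0 \<le> z ^ 2" by simp
          ultimately show ?thesis using z0 by linarith
        qed
        finally show ?thesis .
      qed
      have ES: "real (q + k choose q) \<le> exp (5 * \<Theta>)"
      proof -
        have "real (q + k choose q) = real (q + k choose k)" by (simp add: binomial_symmetric[of q "q + k"])
        also have "\<dots> \<le> exp (K * (1 + ln (real (q + k) / K)))"
          using binomial_exp_bound[of k "q + k"] k4 unfolding K_def by simp
        also have "\<dots> \<le> exp (5 * \<Theta>)"
        proof -
          have "ln (real (q + k) / K) \<le> ln (8 * (1 + z) ^ 3)" using qK K4 k4 z0 by (subst ln_le_cancel_iff) auto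
          also have "\<dots> = ln 8 + 3 * ln (1 + z)" using z0 by (simp add: ln_mult ln_realpow)
          also have "\<dots> \<le> 3 + 3 * z"
          proof -
            have "ln (2 ^ 3 :: real) = 3 * ln 2" by (subst ln_realpow) auto
            then have "ln (8::real) \<le> 3" using ln_2_less_1 by simp
            moreover have "ln (1 + z) \<le> z" using z0 ln_add_one_self_le_self by simp
            ultimately show ?thesis by linarith
          qed
          finally have "1 + ln (real (q + k) / K) \<le> 4 + 3 * z" by linarith
          then have "K * (1 + ln (real (q + k) / K)) \<le> K * (4 + 3 * z)" using K4 by (intro mult_left_mono) auto
          also have "\<dots> \<le> 5 * \<Theta>" unfolding \<Theta>_def using Kz K4 sqA A1 by (simp add: algebra_simps)
          finally show ?thesis by simp
        qed
        finally show ?thesis .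
      qed
      have clq: "has_clique c q X" if X: "X \<subseteq> V" "exp (5 * \<Theta>) \<le> real (card X)" for X
      proof -
        have "q + k choose q \<le> card X" using ES X(2) by linarith
        then have "has_clique c q X \<or> has_clique (\<lambda>x y. \<not> c x y) k X"
          using erdos_szekeres_binomial[of c X q k] sym finite_subset[OF X(1) less.prems(1)] by blast
        then show ?thesis using nk has_clique_mono[OF _ X(1)] by blast
      qed
      define n where "n = 2 * card E"
      have n0: "card W \<le> n" "0 < n" using nW cE n_def by auto
      \<comment> \<open>The term \<open>K\<close> pays for counting every subset of a
        \<open>k'\<close>-clique as a possible pattern, which is affordable because the density is
        constant.\<close>
      define t where "t = 2 * real n * exp (K + 360 * \<Theta>')"
      have Th0: "0 \<le> \<Theta>" "0 \<le> \<Theta>'" "6 \<le> \<Theta>" "A \<le> \<Theta> / 2" unfolding \<Theta>_def \<Theta>'_def using K4 A1 sqA by auto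
      have t1: "1 \<le> t"
      proof -
        have "1 * 1 \<le> (2 * real n) * exp (K + 360 * \<Theta>')" using n0(2) Th0 K4 by (intro mult_mono) auto
        then show ?thesis unfolding t_def by simp
      qed
      have big: "108 * real q * real n * exp (3 * (5 * \<Theta>) + D * ln (1 / (1/8))) * t \<le> real (card V)"
      proof -
        have q10: "real q \<le> 10 * A ^ 3"
        proof -
          have "A ^ 3 / sqrt K \<le> A ^ 3 / 1" using A1 K4 by (intro divide_left_mono) auto
          then have "real q \<le> 8 * A ^ 3 + 2" unfolding q_def using S1 by simp
          then show ?thesis using one_le_power[OF A1, of 3] by linarith
        qed
        have nA: "real n = 2 * A ^ 4" unfolding n_def using A4 by simp
        have "108 * real q * real n * exp (3 * (5 * \<Theta>) + D * ln (1 / (1/8))) * t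
          \<le> 108 * (10 * A ^ 3) * real n * exp (3 * (5 * \<Theta>) + D * ln (1 / (1/8))) * t"
          using q10 t1 by (intro mult_right_mono mult_left_mono) auto
        also have "\<dots> = 8640 * A ^ 11 * exp (15 * \<Theta> + D * ln 8 + (K + 360 * \<Theta>'))"
          unfolding t_def nA by (simp add: exp_add power_add[symmetric] mult_ac eval_nat_numeral)
        also have "\<dots> \<le> exp 1 ^ 14 * exp A ^ 11 * exp (15 * \<Theta> + D * 3 + (K + 360 * \<Theta>'))"
        proof (intro mult_mono power_mono eA)
          have "(8640::real) \<le> 2 ^ 14" by simp
          also have "\<dots> \<le> exp 1 ^ 14" using exp_ge_add_one_self[of 1] by (intro power_mono) auto
          finally show "(8640::real) \<le> exp 1 ^ 14" .
          have "ln (2 ^ 3 :: real) = 3 * ln 2" by (subst ln_realpow) auto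
          then have "ln (8::real) \<le> 3" using ln_2_less_1 by simp
          then have "D * ln 8 \<le> D * 3" using D0 by (intro mult_left_mono) auto
          then show "exp (15 * \<Theta> + D * ln 8 + (K + 360 * \<Theta>')) \<le> exp (15 * \<Theta> + D * 3 + (K + 360 * \<Theta>'))" by simp
        qed (use A1 in auto)
        also have "\<dots> = exp (14 + 11 * A + (15 * \<Theta> + D * 3 + (K + 360 * \<Theta>')))"
          by (simp add: exp_add exp_of_nat_mult[symmetric])
        also have "\<dots> \<le> exp (360 * \<Theta>)"
        proof -
          have "14 + 11 * A + (15 * \<Theta> + D * 3 + (K + 360 * \<Theta>')) \<le> 360 * \<Theta>"
            using gap Th0 K4 D0 unfolding D_def \<Theta>_def by argo
          then show ?thesis by simp
        qed
        also have "\<dots> \<le> real (card V)" using less.prems(2) unfolding \<Theta>_def w_def K_def by simp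
        finally show ?thesis .
      qed
      have h0: "0 \<le> 5 * \<Theta>" using Th0 by simp
      have "copy c W E V \<or> sparse_pair c (1/8) n t V"
        by (rule fat_copy_or_sparse_pair_exp[OF sym g n0 D0 S_def q_def _ _ t1 h0 clq less.prems(1) big]) auto
      then have sp: "sparse_pair c (1/8) n t V" using nc by blast
      have "has_clique (\<lambda>x y. \<not> c x y) (2 * k' - k' div 4) V"
      proof (rule clique_doubling[where \<epsilon> = "1/8" and s = "exp (360 * \<Theta>')" and P = "exp K" and \<rho> = "k' div 4" and k = k',
            OF sp less.prems(1)])
        show "0 < exp (360 * \<Theta>')" "(0::real) < 1/8" "1 \<le> exp K" "0 < n" "0 < k'" using K4 n0(2) k'lt(2) by auto
        show "\<And>x y. c x y = c y x" by (rule sym)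
        show "\<And>X. X \<subseteq> V \<Longrightarrow> exp (360 * \<Theta>') \<le> real (card X) \<Longrightarrow> has_clique (\<lambda>x y. \<not> c x y) k' X" by (rule sub1)
        have "real n * exp (360 * \<Theta>') \<le> real n * (2 * exp (K + 360 * \<Theta>'))"
        proof (rule mult_left_mono)
          have "exp (360 * \<Theta>') \<le> exp (K + 360 * \<Theta>')" using K4 by simp
          then show "exp (360 * \<Theta>') \<le> 2 * exp (K + 360 * \<Theta>')" by (smt (verit) exp_gt_zero)
        qed simp
        then show "real n * exp (360 * \<Theta>') \<le> t" unfolding t_def by simp
        have "1 * (2 * exp (K + 360 * \<Theta>')) \<le> real n * (2 * exp (K + 360 * \<Theta>'))" using n0(2) by (intro mult_right_mono) auto
        then show "2 * exp K * exp (360 * \<Theta>') \<le> t" unfolding t_def by (simp add: exp_add mult_ac)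
        show "2 * (1/8) * real k' < real (k' div 4) + 1" by linarith
        show "real (card {R. R \<subseteq> X \<and> card R \<le> k' div 4}) \<le> exp K" if X: "finite X" "card X = k'" for X :: "nat set"
        proof -
          have "card {R. R \<subseteq> X \<and> card R \<le> k' div 4} \<le> card (Pow X)" using X(1) by (intro card_mono) auto
          also have "\<dots> = 2 ^ k'" using X card_Pow by auto
          finally have "real (card {R. R \<subseteq> X \<and> card R \<le> k' div 4}) \<le> 2 ^ k'"
            by (metis of_nat_le_iff of_nat_numeral of_nat_power)
          also have "\<dots> \<le> exp 1 ^ k'" using exp_ge_add_one_self[of 1] by (intro power_mono) auto
          also have "\<dots> = exp (real k')" by (simp add: exp_of_nat_mult[symmetric])
          also have "\<dots> \<le> exp K" using k'lt unfolding K_def by simp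
          finally show ?thesis .
        qed
      qed
      moreover have "k \<le> 2 * k' - k' div 4" using k'1 by linarith
      ultimately show False using nk has_clique_le by blast
    qed
  qed
qed

text \<open>A segment can have isolated vertices, whereas the induction speaks only of graphs
  without them; thinning the host set repairs this at the price of a factor
  \<open>3 * (n + 1)\<close>. At density \<open>1 / (4 * n)\<close> up to \<open>n\<close> vertices
  spoil at most a quarter of the other set.\<close>

lemma halve_step:
  fixes \<epsilon> t f :: real
  assumes sym: "\<And>x y. c x y = c y x" and V: "finite V" and sp: "sparse_pair c (1 / (4 * real n)) n t V"
    and g: "simple_graph W E" and n: "card W \<le> n" "0 < n" and f: "0 \<le> f"
    and t: "6 * real n * (real n + 1) * exp f \<le> t"
    and IH: "\<And>W' E' X. simple_graph W' E' \<Longrightarrow> (\<And>u. u \<in> W' \<Longrightarrow> nbrs E' u \<noteq> {}) \<Longrightarrow> 2 * card E' \<le> card E \<Longrightarrow>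
      X \<subseteq> V \<Longrightarrow> exp f \<le> real (card X) \<Longrightarrow> copy (\<lambda>x y. \<not> c x y) W' E' X"
  shows "copy (\<lambda>x y. \<not> c x y) W E V"
proof -
  obtain W1 W2 where W: "W = W1 \<union> W2" "separated W1 W2" "2 * card (E \<inter> W1 \<times> W1) \<le> card E" "2 * card (E \<inter> W2 \<times> W2) \<le> card E"
    using split_edges[OF g] by blast
  have fW: "finite W" using g unfolding simple_graph_def by blast
  define s where "s = 3 * (real n + 1) * exp f"
  have ef: "1 \<le> exp f" using f by simp
  have half: "copy (\<lambda>x y. \<not> c x y) U (E \<inter> U \<times> U) X"
    if U: "U \<subseteq> W" "2 * card (E \<inter> U \<times> U) \<le> card E" and X: "X \<subseteq> V" "s \<le> real (card X)" for U X
  proof -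
    define s0 where "s0 = nat \<lceil>exp f\<rceil>"
    have s0: "exp f \<le> real s0" "real s0 \<le> exp f + 1" unfolding s0_def using ef by linarith+
    have "real ((s0 + 1) * (n + 1)) = (real s0 + 1) * (real n + 1)" by (simp add: algebra_simps)
    also have "\<dots> \<le> (3 * exp f) * (real n + 1)"
    proof (rule mult_right_mono)
      show "real s0 + 1 \<le> 3 * exp f" using s0(2) ef by linarith
    qed simp
    also have "\<dots> = s" unfolding s_def by simp
    finally have cX: "(s0 + 1) * (n + 1) \<le> card X" using X(2) by linarith
    have gU: "simple_graph U (E \<inter> U \<times> U)" using g U(1) fW unfolding simple_graph_def by (auto intro: finite_subset)
    have cU: "card U \<le> n" using card_mono[OF fW U(1)] n(1) by linarith
    obtain V' where V': "V' \<subseteq> X" "card V' = s0" and lift: "\<And>c W E. simple_graph W E \<Longrightarrow> card W \<le> n \<Longrightarrow>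
        copy c {u\<in>W. nbrs E u \<noteq> {}} E V' \<Longrightarrow> copy c W E X"
      using thin_out[OF finite_subset[OF X(1) V] cX] by blast
    let ?U = "{u\<in>U. nbrs (E \<inter> U \<times> U) u \<noteq> {}}"
    have g': "simple_graph ?U (E \<inter> U \<times> U)" using gU unfolding simple_graph_def nbrs_def by auto
    have V'V: "V' \<subseteq> V" using V'(1) X(1) by blast
    have "copy (\<lambda>x y. \<not> c x y) ?U (E \<inter> U \<times> U) V'"
    proof (rule IH[OF g' _ U(2) V'V])
      show "nbrs (E \<inter> U \<times> U) u \<noteq> {}" if "u \<in> ?U" for u using that by blast
      show "exp f \<le> real (card V')" using s0(1) V'(2) by simp
    qed
    then show ?thesis by (rule lift[OF gU cU])
  qed
  have n1: "1 \<le> real n" using n(2) by simp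
  have s0: "0 \<le> s" unfolding s_def by simp
  have ts: "real n * s \<le> t" "2 * s \<le> t"
  proof -
    have "2 * (real n * s) \<le> t" unfolding s_def using t by (simp add: mult_ac)
    moreover have "0 \<le> real n * s" using s0 by simp
    moreover have "1 * s \<le> real n * s" using n1 s0 by (intro mult_right_mono)
    ultimately show "real n * s \<le> t" "2 * s \<le> t" by linarith+
  qed
  show ?thesis
  proof (rule sparse_pair_halves[OF sym V sp n(2) g W(1,2) _ _ ts])
    show "0 < 1 / (4 * real n)" using n(2) by simp
    have "1 / (4 * real n) * real (card W) \<le> 1 / (4 * real n) * real n" using n by (intro mult_left_mono) auto
    also have "\<dots> = 1/4" using n(2) by simp
    finally show "1 / (4 * real n) * real (card W) \<le> 1/2" by simp
    show "\<And>X. X \<subseteq> V \<Longrightarrow> s \<le> real (card X) \<Longrightarrow> copy (\<lambda>x y. \<not> c x y) W1 (E \<inter> W1 \<times> W1) X" using half W by blast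
    show "\<And>X. X \<subseteq> V \<Longrightarrow> s \<le> real (card X) \<Longrightarrow> copy (\<lambda>x y. \<not> c x y) W2 (E \<inter> W2 \<times> W2) X" using half W by blast
  qed
qed

text \<open>One round, using both exclusions. No copy of the first graph in the negated colour gives
  \<open>d\<close>-cliques of size \<open>q\<close>; these host the high degrees of the second graph
  in \<open>d\<close>, whose absence gives a \<open>d\<close>-sparse pair; and that pair nearly
  doubles cliques of the negated colour. As \<open>\<epsilon> \<le> 1/4\<close>, at most half of one
  clique is deleted, so the factor is \<open>3/2\<close>, with \<open>+ 1\<close> for rounding up. A
  round multiplies the required set size by \<open>exp Y\<close>.\<close>

lemma clique_growth:
  fixes D \<epsilon> s A h Y :: real
  assumes sym: "\<And>x y. d x y = d y x" and V: "finite V"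
    and g1: "simple_graph W1 E1" "\<And>u. u \<in> W1 \<Longrightarrow> nbrs E1 u \<noteq> {}" "E1 \<noteq> {}" and A: "A = real (card E1) powr (1/4)"
    and g2: "simple_graph W2 E2" and n: "card W2 \<le> n" "0 < n"
    and no1: "\<not> copy (\<lambda>x y. \<not> d x y) W1 E1 V" and no2: "\<not> copy d W2 E2 V"
    and D: "0 < D" and S: "S = {u\<in>W2. D < real (card (nbrs E2 u))}" and q: "q = 4 * card S + 2"
    and h: "h = 360 * (real q + sqrt (real q) * A)"
    and e: "0 < \<epsilon>" "\<epsilon> \<le> 1/4" and k: "0 < k" and s: "1 \<le> s"
    and cl: "\<And>X. X \<subseteq> V \<Longrightarrow> s \<le> real (card X) \<Longrightarrow> has_clique (\<lambda>x y. \<not> d x y) k X"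
    and Y: "ln (216 * real q * real n ^ 2) + 3 * h + D * ln (1 / \<epsilon>) + 2 * \<epsilon> * real k * ln (real k + 1) \<le> Y"
    and X: "X \<subseteq> V" "s * exp Y \<le> real (card X)"
    and j: "2 * real j \<le> 3 * real k + 1"
  shows "has_clique (\<lambda>x y. \<not> d x y) j X"
proof -
  have fX: "finite X" using X(1) V finite_subset by blast
  have A0: "0 \<le> A" unfolding A by simp
  have h0: "0 \<le> h" unfolding h using A0 by simp
  have q0: "0 < real q" unfolding q by simp
  have n0: "0 < real n" using n(2) by simp
  \<comment> \<open>The fewest deletions that \<open>clique_doubling\<close> permits, so that the
    number of patterns costs only \<open>2 * \<epsilon> * k * ln (k + 1)\<close>.\<close>
  define \<rho> where "\<rho> = nat \<lfloor>2 * \<epsilon> * real k\<rfloor>"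
  have ek: "0 \<le> 2 * \<epsilon> * real k" using e by simp
  have r: "real \<rho> \<le> 2 * \<epsilon> * real k" "2 * \<epsilon> * real k < real \<rho> + 1" unfolding \<rho>_def using ek by linarith+
  define P where "P = exp (2 * \<epsilon> * real k * ln (real k + 1))"
  have lk: "0 \<le> ln (real k + 1)" by simp
  have P1: "1 \<le> P" unfolding P_def using ek lk by simp
  define t where "t = 2 * real n * P * s"
  have nP: "1 \<le> real n" using n(2) by simp
  have Ps: "1 \<le> P * s" using P1 s mult_mono[of 1 P 1 s] by simp
  have nPs: "1 \<le> real n * (P * s)" using nP Ps mult_mono[of 1 "real n" 1 "P * s"] by simp
  have t1: "1 \<le> t" unfolding t_def using nPs by (simp add: mult.assoc)
  have no1': "\<not> copy (\<lambda>x y. \<not> d x y) W1 E1 Z" and no2': "\<not> copy d W2 E2 Z" if "Z \<subseteq> V" for Z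
    using no1 no2 copy_mono that by blast+
  have symn: "(\<not> d x y) = (\<not> d y x)" for x y using sym[of x y] by simp
  have clq: "has_clique d q Z" if Z: "Z \<subseteq> X" "exp h \<le> real (card Z)" for Z
  proof -
    have ZV: "Z \<subseteq> V" using Z(1) X(1) by blast
    have "copy (\<lambda>x y. \<not> d x y) W1 E1 Z \<or> has_clique (\<lambda>x y. \<not> \<not> d x y) q Z"
      by (rule clique_or_copy[OF symn g1 A finite_subset[OF ZV V] Z(2)[unfolded h]])
    then show ?thesis using no1'[OF ZV] by simp
  qed
  have "108 * real q * real n * exp (3 * h + D * ln (1 / \<epsilon>)) * t = (216 * real q * real n ^ 2) * exp (3 * h + D * ln (1 / \<epsilon>)) * P * s"
    unfolding t_def by (simp add: power2_eq_square)
  also have "\<dots> = s * exp (ln (216 * real q * real n ^ 2) + 3 * h + D * ln (1 / \<epsilon>) + 2 * \<epsilon> * real k * ln (real k + 1))"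
  proof -
    have "216 * real q * real n ^ 2 = exp (ln (216 * real q * real n ^ 2))" using q0 n0 by simp
    then show ?thesis unfolding P_def by (simp add: exp_add mult_ac)
  qed
  also have "\<dots> \<le> s * exp Y" using Y s by (intro mult_left_mono) auto
  also have "\<dots> \<le> real (card X)" by (rule X(2))
  finally have big: "108 * real q * real n * exp (3 * h + D * ln (1 / \<epsilon>)) * t \<le> real (card X)" .
  have e1: "\<epsilon> \<le> 1" using e by simp
  have "copy d W2 E2 X \<or> sparse_pair d \<epsilon> n t X"
    by (rule fat_copy_or_sparse_pair_exp[OF sym g2 n D S q e(1) e1 t1 h0 clq fX big])
  then have sp: "sparse_pair d \<epsilon> n t X" using no2'[OF X(1)] by blast
  have "has_clique (\<lambda>x y. \<not> d x y) (2 * k - \<rho>) X"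
  proof (rule clique_doubling[where \<epsilon> = \<epsilon> and s = s and P = P and \<rho> = \<rho> and k = k, OF sp fX e(1) n(2) k])
    show "0 < s" "1 \<le> P" using s P1 by auto
    show "\<And>x y. d x y = d y x" by (rule sym)
    show "\<And>Z. Z \<subseteq> X \<Longrightarrow> s \<le> real (card Z) \<Longrightarrow> has_clique (\<lambda>x y. \<not> d x y) k Z" using cl X(1) by blast
    have "real n * (1 * s) \<le> real n * (2 * P * s)" using P1 s by (intro mult_left_mono mult_right_mono) auto
    then show "real n * s \<le> t" unfolding t_def by (simp add: mult_ac)
    have "1 * (2 * P * s) \<le> real n * (2 * P * s)" using nP P1 s by (intro mult_right_mono) auto
    then show "2 * P * s \<le> t" unfolding t_def by (simp add: mult_ac)
    show "2 * \<epsilon> * real k < real \<rho> + 1" by (rule r(2))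
    show "real (card {R. R \<subseteq> Z \<and> card R \<le> \<rho>}) \<le> P" if Z: "finite Z" "card Z = k" for Z :: "nat set"
    proof -
      have "real (card {R. R \<subseteq> Z \<and> card R \<le> \<rho>}) \<le> real ((k + 1) ^ \<rho>)" using card_small_subsets[OF Z(1), of \<rho>] Z(2) by (simp only: of_nat_le_iff)
      also have "\<dots> = exp (real \<rho> * ln (real k + 1))" by (simp add: exp_of_nat_mult add.commute)
      also have "\<dots> \<le> P" unfolding P_def using mult_right_mono[OF r(1) lk] by simp
      finally show ?thesis .
    qed
  qed
  moreover have "j \<le> 2 * k - \<rho>"
  proof -
    have "2 * \<epsilon> * real k \<le> 1/2 * real k" using e by (intro mult_right_mono) auto
    then have "2 * real \<rho> \<le> real k" using r(1) by linarith
    then have "2 * real j \<le> 4 * real k - 2 * real \<rho> + 1" using j by linarith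
    then have "2 * j + 2 * \<rho> \<le> 4 * k + 1" by linarith
    then show ?thesis by linarith
  qed
  ultimately show ?thesis using has_clique_le by blast
qed

text \<open>Capping the size at \<open>T\<close> is what allows a single \<open>Y\<close> to bound
  every round, as the pattern cost grows with \<open>k\<close>.\<close>

lemma clique_growth_iterate:
  fixes D \<epsilon> s A h Y \<kappa> :: real
  assumes sym: "\<And>x y. d x y = d y x" and V: "finite V"
    and g1: "simple_graph W1 E1" "\<And>u. u \<in> W1 \<Longrightarrow> nbrs E1 u \<noteq> {}" "E1 \<noteq> {}" and A: "A = real (card E1) powr (1/4)"
    and g2: "simple_graph W2 E2" and n: "card W2 \<le> n" "0 < n"
    and no1: "\<not> copy (\<lambda>x y. \<not> d x y) W1 E1 V" and no2: "\<not> copy d W2 E2 V"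
    and D: "0 < D" and S: "S = {u\<in>W2. D < real (card (nbrs E2 u))}" and q: "q = 4 * card S + 2"
    and h: "h = 360 * (real q + sqrt (real q) * A)"
    and e: "0 < \<epsilon>" "\<epsilon> \<le> 1/4" and s: "1 \<le> s" and \<kappa>: "0 < \<kappa>" and T: "0 < T"
    and cl: "\<And>X. X \<subseteq> V \<Longrightarrow> s \<le> real (card X) \<Longrightarrow> has_clique (\<lambda>x y. \<not> d x y) (nat \<lceil>\<kappa>\<rceil>) X"
    and Y: "\<And>k. k \<le> T \<Longrightarrow> ln (216 * real q * real n ^ 2) + 3 * h + D * ln (1 / \<epsilon>) + 2 * \<epsilon> * real k * ln (real k + 1) \<le> Y" "0 \<le> Y"
  shows "X \<subseteq> V \<Longrightarrow> s * exp (real j * Y) \<le> real (card X) \<Longrightarrow>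
    has_clique (\<lambda>x y. \<not> d x y) (min T (nat \<lceil>\<kappa> * (3/2) ^ j\<rceil>)) X"
proof (induction j arbitrary: X)
  case 0
  then show ?case using cl[of X] has_clique_le[of _ "nat \<lceil>\<kappa>\<rceil>" X] by simp
next
  case (Suc j)
  define k where "k = min T (nat \<lceil>\<kappa> * (3/2) ^ j\<rceil>)"
  have pj: "0 < \<kappa> * (3/2) ^ j" using \<kappa> by simp
  have kT: "k \<le> T" unfolding k_def by simp
  have k0: "0 < k" unfolding k_def using T pj by simp
  have sY: "1 \<le> s * exp (real j * Y)" using s Y(2) mult_mono[of 1 s 1 "exp (real j * Y)"] by simp
  have IH: "has_clique (\<lambda>x y. \<not> d x y) k Z" if "Z \<subseteq> V" "s * exp (real j * Y) \<le> real (card Z)" for Z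
    unfolding k_def using Suc.IH[OF that] .
  have XY: "(s * exp (real j * Y)) * exp Y \<le> real (card X)"
    using Suc.prems(2) by (simp add: exp_add[symmetric] algebra_simps)
  show ?case
  proof (cases "k = T")
    case True
    have "s * exp (real j * Y) \<le> (s * exp (real j * Y)) * exp Y" using sY Y(2) mult_left_mono[of 1 "exp Y" "s * exp (real j * Y)"] by simp
    then have "s * exp (real j * Y) \<le> real (card X)" using XY by linarith
    then have "has_clique (\<lambda>x y. \<not> d x y) T X" using IH[OF Suc.prems(1)] True by simp
    then show ?thesis by (rule has_clique_le) simp
  next
    case False
    then have k2: "k = nat \<lceil>\<kappa> * (3/2) ^ j\<rceil>" unfolding k_def by (simp add: min_def split: if_splits)
    then have kk: "\<kappa> * (3/2) ^ j \<le> real k" by linarith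
    define i where "i = nat \<lceil>\<kappa> * (3/2) ^ Suc j\<rceil>"
    have "\<kappa> * (3/2) ^ Suc j \<le> 3/2 * real k" using kk by simp
    then have "2 * (\<kappa> * (3/2) ^ Suc j) \<le> real_of_int (3 * int k)" by simp
    moreover have "real i < \<kappa> * (3/2) ^ Suc j + 1" unfolding i_def using \<kappa> by (simp add: nat_less_real_le) linarith
    ultimately have "2 * real i < real_of_int (3 * int k) + 2" by linarith
    \<comment> \<open>In integers the strict bound becomes \<open>2 * i \<le> 3 * k + 1\<close>,
      precisely the rounding that \<open>clique_growth\<close> admits.\<close>
    then have "2 * int i < 3 * int k + 2" by linarith
    then have ij: "2 * real i \<le> 3 * real k + 1" by linarith
    have "has_clique (\<lambda>x y. \<not> d x y) i X"
      by (rule clique_growth[OF sym V g1 A g2 n no1 no2 D S q h e k0 sY IH Y(1)[OF kT] Suc.prems(1) XY ij])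
    then show ?thesis unfolding i_def[symmetric] by (rule has_clique_le) simp
  qed
qed

section \<open>Halving one of the two graphs\<close>

text \<open>From \<open>(1 - 1/100)^100 \<le> 1/e\<close>. The numerical estimates below rest on
  this bound.\<close>

lemma exp_1_le_274: "exp 1 \<le> (274/100::real)"
proof -
  have "(1 + (-1) / real 100) ^ 100 \<le> exp (-1 :: real)" by (rule exp_ge_one_plus_x_over_n_power_n) auto
  then have "exp 1 * (99/100) ^ 100 \<le> (1::real)" by (simp add: exp_minus field_simps)
  moreover have "(1::real) \<le> 274/100 * (99/100) ^ 100" by (simp add: power_divide)
  ultimately have "exp 1 * (99/100) ^ 100 \<le> 274/100 * (99/100::real) ^ 100" by linarith
  then show ?thesis by simp
qed

text \<open>A failed greedy embedding of the second graph in \<open>c\<close> gives a pair sparse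
  enough to halve the first. With \<open>d \<le> 3 * sqrt b\<close> and
  \<open>ln (4 * n) \<le> 2 * L\<close> it costs \<open>6 * sqrt b * L\<close>; another
  \<open>5 * L\<close> absorbs the polynomial factors. The maximum with 16 keeps
  \<open>exp L\<close> large enough to swallow constants.\<close>

lemma step_unbalanced:
  fixes f F L :: real
  assumes sym: "\<And>x y. c x y = c y x" and V: "finite V"
    and g1: "simple_graph W1 E1" "\<And>u. u \<in> W1 \<Longrightarrow> nbrs E1 u \<noteq> {}"
    and g2: "simple_graph W2 E2" "\<And>u. u \<in> W2 \<Longrightarrow> nbrs E2 u \<noteq> {}" "E2 \<noteq> {}"
    and L: "L = ln (max 16 (real (card E1 + card E2)))" and f: "0 \<le> f"
    and F: "f + 11 * sqrt (real (card E2)) * L \<le> F" "exp F \<le> real (card V)"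
    and IH: "\<And>W' E' X. simple_graph W' E' \<Longrightarrow> (\<And>u. u \<in> W' \<Longrightarrow> nbrs E' u \<noteq> {}) \<Longrightarrow> 2 * card E' \<le> card E1 \<Longrightarrow>
      X \<subseteq> V \<Longrightarrow> exp f \<le> real (card X) \<Longrightarrow> copy (\<lambda>x y. \<not> c x y) W' E' X \<or> copy c W2 E2 X"
  shows "copy (\<lambda>x y. \<not> c x y) W1 E1 V \<or> copy c W2 E2 V"
proof (cases "copy c W2 E2 V")
  case False
  define m where "m = card E1 + card E2"
  define n where "n = 2 * m"
  have fE2: "finite E2" using g2(1) unfolding simple_graph_def by (elim conjE, intro finite_subset[of E2 "W2 \<times> W2"]) auto
  define b where "b = real (card E2)"
  have b1: "1 \<le> b" unfolding b_def using g2(3) fE2 by (simp add: Suc_le_eq card_gt_0_iff)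
  have m1: "1 \<le> real m" unfolding m_def using b1 b_def by simp
  have n1: "0 < n" unfolding n_def using m1 by simp
  have W1n: "card W1 \<le> n" "card W2 \<le> n" using card_verts_le[OF g1] card_verts_le[OF g2(1,2)] unfolding n_def m_def by auto
  have eL: "real m \<le> exp L" "16 \<le> exp L" unfolding L m_def by auto
  have L0: "0 \<le> L" unfolding L by simp
  define d where "d = nat \<lceil>sqrt (2 * b)\<rceil>"
  have sb: "1 \<le> sqrt b" using b1 by simp
  have d3: "real d \<le> 3 * sqrt b"
  proof -
    have "sqrt (2 * b) \<le> sqrt (4 * b)" using b1 by simp
    also have "\<dots> = 2 * sqrt b" by (simp add: real_sqrt_mult)
    finally show ?thesis unfolding d_def using sb b1 by linarith
  qed
  have dd: "2 * card E2 \<le> d * d"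
  proof -
    have "sqrt (2 * b) \<le> real d" unfolding d_def by linarith
    then have "sqrt (2 * b) * sqrt (2 * b) \<le> real d * real d" using b1 by (intro mult_mono) auto
    then have "real (2 * card E2) \<le> real (d * d)" using b1 unfolding b_def by simp
    then show ?thesis by (simp only: of_nat_le_iff)
  qed
  define \<epsilon> where "\<epsilon> = 1 / (4 * real n)"
  have e: "0 < \<epsilon>" "\<epsilon> \<le> 1" unfolding \<epsilon>_def using n1 by auto
  define t where "t = 6 * real n * (real n + 1) * exp f"
  have t0: "1 \<le> t"
  proof -
    have a: "1 \<le> 6 * real n" "1 \<le> real n + 1" "1 \<le> exp f" using n1 f by auto
    have "1 * 1 \<le> (6 * real n) * (real n + 1)" using mult_mono[OF a(1,2)] by simp
    then have "1 * 1 \<le> ((6 * real n) * (real n + 1)) * exp f" using mult_mono[OF _ a(3)] by simp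
    then show ?thesis unfolding t_def by simp
  qed
  define s where "s = nat \<lceil>t * (4 * real n) ^ d\<rceil>"
  have t1: "1 \<le> t * (4 * real n) ^ d"
    using t0 n1 mult_mono[of 1 t 1 "(4 * real n) ^ d"] one_le_power[of "4 * real n" d] by simp
  have s1: "t * (4 * real n) ^ d \<le> real s" "real s \<le> 2 * (t * (4 * real n) ^ d)" unfolding s_def using t1 by linarith+
  have ts: "t \<le> real s * \<epsilon> ^ d"
  proof -
    have "t = (t * (4 * real n) ^ d) * \<epsilon> ^ d" unfolding \<epsilon>_def using n1 by (simp add: power_one_over)
    also have "\<dots> \<le> real s * \<epsilon> ^ d" using s1(1) e by (intro mult_right_mono) auto
    finally show ?thesis .
  qed
  have cV: "n * s \<le> card V"
  proof -
    have "real (n * s) \<le> real n * (2 * (t * (4 * real n) ^ d))" using s1(2) by (simp add: mult_left_mono)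
    also have "\<dots> = 12 * ((real n * real n) * (real n + 1)) * ((4 * real n) ^ d * exp f)" unfolding t_def by simp
    also have "\<dots> \<le> 12 * ((2 * exp L * (2 * exp L)) * (3 * exp L)) * (exp (6 * sqrt b * L) * exp f)"
    proof -
      have n2: "real n \<le> 2 * exp L" unfolding n_def using eL by simp
      have n3: "real n + 1 \<le> 3 * exp L" using n2 eL by linarith
      have 1: "(real n * real n) * (real n + 1) \<le> (2 * exp L * (2 * exp L)) * (3 * exp L)"
        by (rule mult_mono[OF mult_mono[OF n2 n2] n3]) auto
      have "4 * real n \<le> exp L * exp L"
      proof -
        have "4 * real n \<le> 8 * exp L" unfolding n_def using eL by simp
        also have "\<dots> \<le> exp L * exp L" using eL by (intro mult_right_mono) auto
        finally show ?thesis .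
      qed
      then have "(4 * real n) ^ d \<le> (exp L * exp L) ^ d" by (intro power_mono) auto
      also have "\<dots> = exp (real d * (2 * L))" unfolding exp_of_nat_mult mult_2 exp_add ..
      also have "\<dots> \<le> exp (6 * sqrt b * L)"
      proof -
        have "real d * (2 * L) \<le> (3 * sqrt b) * (2 * L)" using d3 L0 by (intro mult_right_mono) auto
        then show ?thesis by simp
      qed
      finally have "(4 * real n) ^ d \<le> exp (6 * sqrt b * L)" .
      then have 2: "(4 * real n) ^ d * exp f \<le> exp (6 * sqrt b * L) * exp f" by (rule mult_right_mono) simp
      show ?thesis using mult_mono[OF mult_left_mono[OF 1, of 12] 2] by simp
    qed
    also have "\<dots> = 144 * (exp L ^ 3 * exp (6 * sqrt b * L) * exp f)" by (simp add: power3_eq_cube)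
    also have "exp L ^ 3 = exp (3 * L)" by (simp add: exp_of_nat_mult[symmetric])
    also have "144 * (exp (3 * L) * exp (6 * sqrt b * L) * exp f) = 144 * exp (3 * L + 6 * sqrt b * L + f)" unfolding exp_add ..
    also have "\<dots> \<le> exp (2 * L) * exp (3 * L + 6 * sqrt b * L + f)"
    proof (rule mult_right_mono)
      have "(144::real) \<le> 16 * 16" by simp
      also have "\<dots> \<le> exp L * exp L" using eL by (intro mult_mono) auto
      finally show "144 \<le> exp (2 * L)" unfolding mult_2 exp_add .
    qed simp
    also have "\<dots> = exp (2 * L + (3 * L + 6 * sqrt b * L + f))" unfolding exp_add ..
    also have "\<dots> = exp (5 * L + 6 * (sqrt b * L) + f)" by (simp add: algebra_simps)
    also have "\<dots> \<le> exp F"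
    proof -
      have "1 * L \<le> sqrt b * L" using sb L0 by (rule mult_right_mono)
      then have "5 * L + 6 * (sqrt b * L) + f \<le> F" using F(1) unfolding b_def by (simp add: mult.assoc)
      then show ?thesis by simp
    qed
    also have "\<dots> \<le> real (card V)" by (rule F(2))
    finally show ?thesis by (simp only: of_nat_le_iff)
  qed
  have t00: "0 < t" using t0 by simp
  have "sparse_pair c \<epsilon> n t V"
    using copy_or_sparse_pair[of c, OF sym g2(1) W1n(2) dd e t00 V cV ts] False by blast
  then have sp: "sparse_pair c (1 / (4 * real n)) n t V" unfolding \<epsilon>_def .
  have "copy (\<lambda>x y. \<not> c x y) W1 E1 V"
  proof (rule halve_step[OF sym V sp g1(1) W1n(1) n1 f])
    show "6 * real n * (real n + 1) * exp f \<le> t" unfolding t_def by simp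
    show "copy (\<lambda>x y. \<not> c x y) W' E' X" if "simple_graph W' E'" "\<And>u. u \<in> W' \<Longrightarrow> nbrs E' u \<noteq> {}" "2 * card E' \<le> card E1"
      "X \<subseteq> V" "exp f \<le> real (card X)" for W' E' X
      using IH[OF that] False copy_mono[OF _ that(4)] by blast
  qed
  then show ?thesis by blast
qed simp

text \<open>Two fat embeddings with different thresholds. The second graph, at density
  \<open>L ^ (-5)\<close>, is used repeatedly to grow cliques of the negated colour; the first
  graph, at density \<open>1 / (4 * n)\<close>, is used once, to produce the pair that halves the
  second. The bound \<open>10000 \<le> L\<close> exceeds \<open>exp 9\<close> and thus gives
  \<open>r \<ge> 3\<close>.\<close>

lemma step_balanced:
  fixes f F L A B G r :: real
  assumes sym: "\<And>x y. d x y = d y x" and V: "finite V"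
    and g1: "simple_graph W1 E1" "\<And>u. u \<in> W1 \<Longrightarrow> nbrs E1 u \<noteq> {}" "E1 \<noteq> {}"
    and g2: "simple_graph W2 E2" "\<And>u. u \<in> W2 \<Longrightarrow> nbrs E2 u \<noteq> {}" "E2 \<noteq> {}"
    and A: "A = real (card E1) powr (1/4)" and B: "B = real (card E2) powr (1/4)" and G: "G = A * B"
    and ord: "B \<le> A" "A \<le> B * L"
    and L: "L = ln (real (card E1 + card E2))" "10000 \<le> L" and r: "r = sqrt (ln L)" and f: "0 \<le> f"
    and F: "f + 113000 * G * r ^ 3 \<le> F" "exp F \<le> real (card V)"
    and IH: "\<And>W' E' X. simple_graph W' E' \<Longrightarrow> (\<And>u. u \<in> W' \<Longrightarrow> nbrs E' u \<noteq> {}) \<Longrightarrow> 2 * card E' \<le> card E2 \<Longrightarrow>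
      X \<subseteq> V \<Longrightarrow> exp f \<le> real (card X) \<Longrightarrow> copy (\<lambda>x y. \<not> d x y) W1 E1 X \<or> copy d W' E' X"
  shows "copy (\<lambda>x y. \<not> d x y) W1 E1 V \<or> copy d W2 E2 V"
proof (rule ccontr)
  assume "\<not> ?thesis"
  then have no1: "\<not> copy (\<lambda>x y. \<not> d x y) W1 E1 V" and no2: "\<not> copy d W2 E2 V" by auto
  have fE: "finite E1" "finite E2" using g1(1) g2(1) unfolding simple_graph_def
    by (elim conjE, intro finite_subset[of E1 "W1 \<times> W1"], auto, intro finite_subset[of E2 "W2 \<times> W2"], auto)
  have c1: "1 \<le> card E1" "1 \<le> card E2" using g1(3) g2(3) fE by (auto simp: Suc_le_eq card_gt_0_iff)
  have B1: "1 \<le> B" unfolding B using c1 by (intro ge_one_powr_ge_zero) auto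
  have A1: "1 \<le> A" using B1 ord(1) by simp
  have A4: "real (card E1) = A ^ 4" unfolding A using c1 by (subst powr_realpow[symmetric]) (auto simp: powr_powr)
  have B4: "real (card E2) = B ^ 4" unfolding B using c1 by (subst powr_realpow[symmetric]) (auto simp: powr_powr)
  define l where "l = ln L"
  have L0: "0 < L" using L(2) by simp
  have el: "exp l = L" unfolding l_def using L0 by simp
  have l9: "9 \<le> l"
  proof -
    have "exp (9::real) = exp 1 ^ 9" by (simp add: exp_of_nat_mult[symmetric])
    also have "\<dots> \<le> (274/100) ^ 9" using exp_1_le_274 by (intro power_mono) auto
    also have "\<dots> \<le> L" using L(2) by (simp add: eval_nat_numeral)
    finally have "exp 9 \<le> exp l" unfolding el .
    then show ?thesis by simp
  qed
  have rl: "r * r = l" "r ^ 2 = l" unfolding r l_def[symmetric] using l9 by auto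
  have r3: "3 \<le> r"
  proof -
    have "sqrt 9 \<le> sqrt l" using l9 by (rule real_sqrt_le_mono)
    then show ?thesis unfolding r l_def by simp
  qed
  have expL: "L ^ 6 \<le> 46656 * exp L"
  proof -
    have "(1 + L / real 6) ^ 6 \<le> exp L" using L0 by (intro exp_ge_one_plus_x_over_n_power_n) auto
    moreover have "(L / 6) ^ 6 \<le> (1 + L / real 6) ^ 6" using L0 by (intro power_mono) auto
    ultimately have "(L / 6) ^ 6 \<le> exp L" by linarith
    then show ?thesis by (simp add: power_divide)
  qed
  have L2: "1000000 \<le> L ^ 2"
  proof -
    have "1000 * 1000 \<le> L * L" using L(2) by (intro mult_mono) auto
    then show ?thesis by (simp add: power2_eq_square)
  qed
  define m where "m = card E1 + card E2"
  have mL: "real m = exp L" unfolding L(1) m_def using c1 by simp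
  have GB: "B ^ 2 \<le> G" "B \<le> G" "1 \<le> G" "A \<le> G"
  proof -
    show "B ^ 2 \<le> G" unfolding G power2_eq_square using ord B1 by (intro mult_right_mono) auto
    have "B * 1 \<le> B * A" using A1 B1 by (intro mult_left_mono) auto
    then show "B \<le> G" unfolding G by (simp add: mult.commute)
    then show "1 \<le> G" using B1 by simp
    have "A * 1 \<le> A * B" using A1 B1 by (intro mult_left_mono) auto
    then show "A \<le> G" unfolding G by simp
  qed
  have A2m: "A ^ 2 \<le> exp (L / 2)" "exp (L / 2) \<le> 2 * A ^ 2"
  proof -
    have sq: "exp (L / 2) ^ 2 = exp L" by (simp add: exp_of_nat_mult[symmetric])
    have "(A ^ 2) ^ 2 \<le> exp (L / 2) ^ 2" unfolding sq mL[symmetric] m_def using A4 by (simp add: power_mult[symmetric])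
    then show "A ^ 2 \<le> exp (L / 2)" using power2_le_imp_le[of "A^2" "exp (L/2)"] by simp
    have "B ^ 4 \<le> A ^ 4" using ord(1) B1 by (intro power_mono) auto
    then have "exp L \<le> 2 * A ^ 4" unfolding mL[symmetric] m_def using A4 B4 by simp
    also have "\<dots> \<le> (2 * A ^ 2) ^ 2" by (simp add: power_mult_distrib power_mult[symmetric])
    finally have "exp (L / 2) ^ 2 \<le> (2 * A ^ 2) ^ 2" unfolding sq .
    then show "exp (L / 2) \<le> 2 * A ^ 2" by (rule power2_le_imp_le) simp
  qed
  have L4: "(2 * L ^ 2) ^ 2 \<le> exp L"
  proof -
    have "1000000 * L ^ 4 \<le> L ^ 2 * L ^ 4" using L2 by (rule mult_right_mono) simp
    then have "1000000 * L ^ 4 \<le> 46656 * exp L" using expL by (simp add: power_add[symmetric])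
    then have "4 * L ^ 4 \<le> exp L" using zero_le_power[of L 4] L0 by linarith
    then show ?thesis by (simp add: power_mult_distrib power_mult[symmetric])
  qed
  \<comment> \<open>Polynomial factors in the number of edges cost multiples of \<open>L\<close>, so
    they disappear in \<open>G\<close>. Indeed \<open>A ^ 2\<close> is at least
    \<open>exp (L / 2) / 2\<close>, and near balance it is at most \<open>G * L\<close>.\<close>
  have GL: "L \<le> G"
  proof -
    have "(2 * L ^ 2) ^ 2 \<le> exp (L / 2) ^ 2" using L4 by (simp add: exp_of_nat_mult[symmetric])
    then have "2 * L ^ 2 \<le> exp (L / 2)" by (rule power2_le_imp_le) simp
    then have "L ^ 2 \<le> A ^ 2" using A2m(2) by simp
    moreover have "A * A \<le> A * (B * L)" using ord(2) A1 by (intro mult_left_mono) auto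
    ultimately have "L * L \<le> G * L" unfolding G by (simp add: power2_eq_square)
    then show ?thesis using L0 by simp
  qed
  have sqG: "G \<le> exp (L / 2)"
  proof -
    have "G \<le> A ^ 2" unfolding G power2_eq_square using ord A1 by (intro mult_left_mono) auto
    then show ?thesis using A2m by simp
  qed
  have Gr: "G \<le> G * r" using GB r3 by simp
  have r0: "0 < r" using r3 by simp
  have GBr: "B ^ 2 * r \<le> G * r" using GB(1) r0 by simp

  \<comment> \<open>The balancing choice: about \<open>B ^ 2 * r\<close> vertices exceed it, and
    with \<open>ln (1 / \<epsilon>) = 5 * r ^ 2\<close> the low degrees also cost a multiple of
    \<open>B ^ 2 * r\<close>.\<close>
  define D2 where "D2 = 8 * B ^ 2 / r"
  have D20: "0 < D2" unfolding D2_def using B1 r0 by simp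
  define S2 where "S2 = {u\<in>W2. D2 < real (card (nbrs E2 u))}"
  define q2 where "q2 = 4 * card S2 + 2"
  have q2b: "real q2 \<le> 2 * (B ^ 2 * r)"
  proof -
    have "real (card S2) \<le> 2 * real (card E2) / D2" unfolding S2_def by (rule card_high_degree[OF g2(1) D20])
    also have "\<dots> = B ^ 2 * r / 4" unfolding B4 D2_def using B1 r0 by (simp add: field_simps eval_nat_numeral)
    finally have "real q2 \<le> B ^ 2 * r + 2" unfolding q2_def by simp
    moreover have "1 * 3 \<le> B ^ 2 * r" using B1 r3 by (intro mult_mono) auto
    ultimately show ?thesis by linarith
  qed
  define h2 where "h2 = 360 * (real q2 + sqrt (real q2) * A)"
  have h2b: "h2 \<le> 1080 * (G * r)"
  proof -
    have "sqrt (real q2) \<le> sqrt ((B * r) ^ 2)"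
    proof (rule real_sqrt_le_mono)
      have "2 * (B ^ 2 * r) \<le> r * (B ^ 2 * r)" using r3 B1 by (intro mult_right_mono) auto
      also have "\<dots> = (B * r) ^ 2" by (simp add: power2_eq_square)
      finally show "real q2 \<le> (B * r) ^ 2" using q2b by linarith
    qed
    then have "sqrt (real q2) \<le> B * r" using B1 r0 by simp
    then have "sqrt (real q2) * A \<le> (B * r) * A" using A1 by (intro mult_right_mono) auto
    also have "\<dots> = G * r" unfolding G by simp
    finally have "sqrt (real q2) * A \<le> G * r" .
    then have "real q2 + sqrt (real q2) * A \<le> 3 * (G * r)" using q2b GBr by linarith
    then show ?thesis unfolding h2_def by simp
  qed
  define n2 where "n2 = 2 * card E2"
  have n2W: "card W2 \<le> n2" "0 < n2" unfolding n2_def using card_verts_le[OF g2(1,2)] c1 by auto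
  \<comment> \<open>Cliques reach size about \<open>G * L ^ 3\<close>, with logarithm of order
    \<open>L\<close>, so the patterns cost \<open>O(\<epsilon> * G * L ^ 4)\<close>; the fifth power
    brings this below \<open>G\<close>.\<close>
  define \<epsilon> where "\<epsilon> = 1 / L ^ 5"
  have L51: "4 \<le> L ^ 5"
  proof -
    have "L ^ 1 \<le> L ^ 5" using L(2) by (intro power_increasing) auto
    then show ?thesis using L(2) by simp
  qed
  have e: "0 < \<epsilon>" "\<epsilon> \<le> 1/4" unfolding \<epsilon>_def using L0 L51 by (auto simp: field_simps)
  have Dl: "D2 * ln (1 / \<epsilon>) \<le> 40 * (G * r)"
  proof -
    have "ln (1 / \<epsilon>) = 5 * (r * r)" unfolding \<epsilon>_def rl l_def using L0 by (simp add: ln_realpow)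
    then have "D2 * ln (1 / \<epsilon>) = 40 * (B ^ 2 * r)" unfolding D2_def using r0 by (simp add: field_simps)
    then show ?thesis using GBr by linarith
  qed
  have lnq: "ln (216 * real q2 * real n2 ^ 2) \<le> 20 * (G * r)"
  proof -
    have q20: "0 < real q2" "0 < real n2" unfolding q2_def using n2W by auto
    have "216 * real q2 * real n2 ^ 2 \<le> 216 * (2 * (B ^ 2 * r)) * real n2 ^ 2"
      using q2b by (intro mult_right_mono mult_left_mono) auto
    also have "\<dots> = 1728 * B ^ 10 * r" unfolding n2_def using B4 by (simp add: eval_nat_numeral)
    also have "\<dots> \<le> exp 8 * exp B ^ 10 * exp r"
    proof (intro mult_mono power_mono)
      have "(1728::real) \<le> (1 + 8 / real 64) ^ 64" by (simp add: power_divide)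
      also have "\<dots> \<le> exp 8" by (rule exp_ge_one_plus_x_over_n_power_n) auto
      finally show "1728 \<le> exp (8::real)" .
      show "B \<le> exp B" "r \<le> exp r" using exp_ge_add_one_self[of B] exp_ge_add_one_self[of r] by linarith+
    qed (use B1 r0 in auto)
    also have "\<dots> = exp (8 + 10 * B + r)" by (simp add: exp_add exp_of_nat_mult[symmetric])
    finally have "ln (216 * real q2 * real n2 ^ 2) \<le> ln (exp (8 + 10 * B + r))" using q20 by (intro ln_mono) auto
    then have "ln (216 * real q2 * real n2 ^ 2) \<le> 8 + 10 * B + r" by simp
    moreover have "1 * r \<le> G * r" using GB r0 by (intro mult_right_mono) auto
    moreover have "8 \<le> 3 * (G * r)" using \<open>1 * r \<le> G * r\<close> r3 by linarith
    ultimately show ?thesis using GB(2) Gr by linarith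
  qed

  \<comment> \<open>At density \<open>1 / (4 * n)\<close> each degree costs up to
    \<open>2 * L\<close>, so the low degrees cost at most \<open>2 * G\<close>. The price is a
    clique of size \<open>O(G * L ^ 3)\<close>, where \<open>A \<le> B * L\<close> enters.\<close>
  define D1 where "D1 = G / L"
  have D10: "0 < D1" unfolding D1_def using GB(3) L0 by simp
  define S1 where "S1 = {u\<in>W1. D1 < real (card (nbrs E1 u))}"
  define q1 where "q1 = 4 * card S1 + 2"
  have q1b: "real q1 \<le> 9 * (G * L ^ 3)"
  proof -
    have "real (card S1) \<le> 2 * real (card E1) / D1" unfolding S1_def by (rule card_high_degree[OF g1(1) D10])
    also have "\<dots> = 2 * (A ^ 2 * A / B) * L" unfolding A4 D1_def G using A1 B1 L0 by (simp add: field_simps eval_nat_numeral)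
    also have "\<dots> \<le> 2 * (G * L ^ 2) * L"
    proof -
      have "A ^ 2 * A \<le> (B * L) ^ 2 * A" using ord(2) A1 by (intro mult_right_mono power_mono) auto
      also have "\<dots> = (G * L ^ 2) * B" unfolding G by (simp add: power2_eq_square)
      finally have "A ^ 2 * A / B \<le> G * L ^ 2" using B1 by (simp add: divide_le_eq)
      then show ?thesis using L0 by (intro mult_right_mono mult_left_mono) auto
    qed
    finally have "real q1 \<le> 8 * (G * L ^ 3) + 2" unfolding q1_def by (simp add: eval_nat_numeral)
    moreover have "1 * 2 \<le> G * L ^ 3"
    proof (rule mult_mono)
      have "L ^ 1 \<le> L ^ 3" using L(2) by (intro power_increasing) auto
      then show "2 \<le> L ^ 3" using L(2) by simp
    qed (use GB in auto)
    ultimately show ?thesis by linarith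
  qed
  \<comment> \<open>The cost of a round adds up to \<open>3 * 1080 + 40 + 20 + 1\<close> times
    \<open>G * r\<close>.\<close>
  define Y where "Y = 3400 * (G * r)"
  have Y0: "0 \<le> Y" unfolding Y_def using GB r0 by simp
  have pat: "2 * \<epsilon> * real k * ln (real k + 1) \<le> G * r" if k: "k \<le> q1" for k
  proof -
    have kb: "real k \<le> 9 * (G * L ^ 3)" using k q1b by linarith
    have GL3: "1 * 1 \<le> G * L ^ 3" using GB(3) L(2) by (intro mult_mono one_le_power) auto
    have "real k + 1 \<le> 10 * (G * L ^ 3)" using kb GL3 by linarith
    also have "\<dots> \<le> exp (L / 2) * exp L"
    proof -
      have "10 * L ^ 3 \<le> exp L"
      proof -
        have "1000000 * L ^ 4 \<le> L ^ 2 * L ^ 4" using L2 by (rule mult_right_mono) simp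
        then have "1000000 * L ^ 4 \<le> 46656 * exp L" using expL by (simp add: power_add[symmetric])
        moreover have "L ^ 3 \<le> L ^ 4" using L(2) by (intro power_increasing) auto
        moreover have "0 \<le> L ^ 3" using L0 by simp
        ultimately show ?thesis by linarith
      qed
      then have "G * (10 * L ^ 3) \<le> exp (L / 2) * exp L" using sqG L0 by (intro mult_mono) auto
      then show ?thesis by (simp add: mult_ac)
    qed
    also have "\<dots> = exp (3 * L / 2)" by (simp add: exp_add[symmetric])
    finally have "ln (real k + 1) \<le> ln (exp (3 * L / 2))" by (intro ln_mono) auto
    then have lk: "ln (real k + 1) \<le> 2 * L" using L0 by simp
    have "2 * \<epsilon> * real k * ln (real k + 1) \<le> 2 * \<epsilon> * (9 * (G * L ^ 3)) * (2 * L)"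
      using kb lk e by (intro mult_mono) auto
    also have "\<dots> = 36 * G / L" unfolding \<epsilon>_def using L0 by (simp add: field_simps eval_nat_numeral)
    also have "\<dots> \<le> G" using L GB by (simp add: field_simps)
    finally show ?thesis using Gr by linarith
  qed
  have Yb: "ln (216 * real q2 * real n2 ^ 2) + 3 * h2 + D2 * ln (1 / \<epsilon>) + 2 * \<epsilon> * real k * ln (real k + 1) \<le> Y" if "k \<le> q1" for k
    using lnq h2b Dl pat[OF that] GB r0 unfolding Y_def by (smt (verit) mult_nonneg_nonneg)
  define s where "s = exp (1440 * G)"
  have s1: "1 \<le> s" unfolding s_def using GB by simp
  \<comment> \<open>Here \<open>clique_or_copy\<close> is applied to the second graph. Size
    \<open>G\<close> is affordable because \<open>B ^ 2 \<le> G\<close> gives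
    \<open>sqrt G * B \<le> G\<close>.\<close>
  have start: "has_clique (\<lambda>x y. \<not> d x y) (nat \<lceil>G\<rceil>) X" if X: "X \<subseteq> V" "s \<le> real (card X)" for X
  proof -
    define k where "k = nat \<lceil>G\<rceil>"
    have kb: "real k \<le> 2 * G" unfolding k_def using GB(3) by linarith
    have "sqrt (real k) \<le> sqrt (2 * G)" using kb by (rule real_sqrt_le_mono)
    then have "sqrt (real k) * B \<le> sqrt (2 * G) * B" using B1 by (intro mult_right_mono) auto
    also have "\<dots> = sqrt (2 * G * B ^ 2)" using B1 by (simp add: real_sqrt_mult)
    also have "\<dots> \<le> sqrt ((2 * G) ^ 2)"
    proof (rule real_sqrt_le_mono)
      have "2 * G * B ^ 2 \<le> 2 * G * G" using GB by (intro mult_left_mono) auto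
      also have "\<dots> \<le> 2 * G * (2 * G)" using GB by (intro mult_left_mono) auto
      finally show "2 * G * B ^ 2 \<le> (2 * G) ^ 2" by (simp add: power2_eq_square)
    qed
    also have "\<dots> = 2 * G" using GB by (intro real_sqrt_unique) auto
    finally have "real k + sqrt (real k) * B \<le> 4 * G" using kb by linarith
    then have "exp (360 * (real k + sqrt (real k) * B)) \<le> s" unfolding s_def by simp
    then have sz: "exp (360 * (real k + sqrt (real k) * B)) \<le> real (card X)" using X(2) by linarith
    have "copy d W2 E2 X \<or> has_clique (\<lambda>x y. \<not> d x y) k X"
      by (rule clique_or_copy[OF sym g2 B finite_subset[OF X(1) V] sz])
    then show ?thesis using no2 copy_mono[OF _ X(1)] unfolding k_def by blast
  qed
  \<comment> \<open>Since \<open>3/2 \<ge> exp (1/3)\<close>, this many rounds gain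
    \<open>exp (10 * l / 3)\<close>, and \<open>l \<ge> 9\<close> makes that at least
    \<open>exp (3 + 3 * l) \<ge> 9 * L ^ 3\<close>.\<close>
  define J where "J = nat \<lceil>10 * l\<rceil>"
  have Jb: "real J \<le> 11 * l" "10 * l \<le> real J" unfolding J_def using l9 by linarith+
  have T0: "0 < q1" unfolding q1_def by simp
  have G0: "0 < G" using GB(3) by simp
  have reach: "q1 \<le> nat \<lceil>G * (3/2) ^ J\<rceil>"
  proof -
    have "exp (- 1 / 3) \<ge> (2/3 :: real)" using exp_ge_add_one_self[of "-1/3"] by simp
    then have e13: "exp (1/3) \<le> (3/2::real)" by (simp add: exp_minus field_simps)
    have "9 * L ^ 3 = 9 * exp (3 * l)" using exp_of_nat_mult[of 3 l] el by simp
    also have "\<dots> \<le> exp 3 * exp (3 * l)"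
    proof (rule mult_right_mono)
      have "(9::real) \<le> (1 + 3 / real 6) ^ 6" by (simp add: power_divide)
      also have "\<dots> \<le> exp 3" by (rule exp_ge_one_plus_x_over_n_power_n) auto
      finally show "9 \<le> exp (3::real)" .
    qed simp
    also have "\<dots> = exp (3 + 3 * l)" by (simp add: exp_add)
    also have "\<dots> \<le> exp (real J * (1/3))" using Jb(2) l9 by simp
    also have "\<dots> = exp (1/3) ^ J" by (rule exp_of_nat_mult)
    also have "\<dots> \<le> (3/2) ^ J" using e13 by (intro power_mono) auto
    finally have "G * (9 * L ^ 3) \<le> G * (3/2) ^ J" using G0 by (intro mult_left_mono) auto
    then have "real q1 \<le> G * (3/2) ^ J" using q1b by (simp add: mult_ac)
    then show ?thesis by linarith
  qed
  define g where "g = 1440 * G + real J * Y"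
  have g0: "0 \<le> g" unfolding g_def using G0 Y0 by simp
  have r27: "27 \<le> r ^ 3"
  proof -
    have "3 ^ 3 \<le> r ^ 3" using r3 by (intro power_mono) auto
    then show ?thesis by simp
  qed
  have Gr3: "27 * G \<le> G * r ^ 3" using r27 G0 by simp
  \<comment> \<open>At most \<open>11 * l\<close> rounds at \<open>3400 * G * r\<close> give 37400;
    the initial \<open>1440 * G\<close> adds less than 60 because
    \<open>r ^ 3 \<ge> 27\<close>.\<close>
  have gb: "g \<le> 37460 * (G * r ^ 3)"
  proof -
    have "real J * Y \<le> (11 * (r * r)) * Y" using Jb(1) Y0 unfolding rl by (intro mult_right_mono) auto
    also have "\<dots> = 37400 * (G * r ^ 3)" unfolding Y_def by (simp add: power3_eq_cube)
    finally show ?thesis unfolding g_def using Gr3 G0 by linarith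
  qed
  have clq: "has_clique (\<lambda>x y. \<not> d x y) q1 X" if X: "X \<subseteq> V" "exp g \<le> real (card X)" for X
  proof -
    have "s * exp (real J * Y) \<le> real (card X)" using X(2) unfolding s_def g_def by (simp add: exp_add)
    then have "has_clique (\<lambda>x y. \<not> d x y) (min q1 (nat \<lceil>G * (3/2) ^ J\<rceil>)) X"
      using clique_growth_iterate[OF sym V g1 A g2(1) n2W no1 no2 D20 S2_def q2_def h2_def e s1 G0 T0 start Yb Y0 X(1)] by blast
    then show ?thesis using reach by (simp add: min_def)
  qed

  define n where "n = 2 * m"
  have m16: "16 \<le> real m" unfolding mL using exp_ge_add_one_self[of L] L(2) by linarith
  have n0: "0 < n" unfolding n_def using m16 by simp
  have Wn: "card W1 \<le> n" "card W2 \<le> n" using card_verts_le[OF g1(1,2)] card_verts_le[OF g2(1,2)] unfolding n_def m_def by auto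
  define t where "t = 6 * real n * (real n + 1) * exp f"
  have t1: "1 \<le> t"
  proof -
    have a: "1 \<le> 6 * real n" "1 \<le> real n + 1" "1 \<le> exp f" using n0 f by auto
    have "1 * 1 \<le> (6 * real n) * (real n + 1)" using mult_mono[OF a(1,2)] by simp
    then have "1 * 1 \<le> ((6 * real n) * (real n + 1)) * exp f" using mult_mono[OF _ a(3)] by simp
    then show ?thesis unfolding t_def by simp
  qed
  have e1: "0 < 1 / (4 * real n)" "1 / (4 * real n) \<le> 1" using n0 by auto
  have big: "108 * real q1 * real n * exp (3 * g + D1 * ln (1 / (1 / (4 * real n)))) * t \<le> real (card V)"
  proof -
    have "card S1 \<le> card W1" unfolding S1_def using g1(1) by (intro card_mono) (auto simp: simple_graph_def)
    also have "\<dots> \<le> 2 * m" using card_verts_le[OF g1(1,2)] unfolding m_def by simp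
    finally have q10: "real q1 \<le> 9 * real m" unfolding q1_def using m16 by simp
    have Dl1: "D1 * ln (1 / (1 / (4 * real n))) \<le> 2 * G"
    proof -
      have "4 * real n \<le> real m * real m" unfolding n_def using m16 mult_right_mono[of 8 "real m" "real m"] by simp
      also have "\<dots> = exp (2 * L)" unfolding mL mult_2 exp_add ..
      finally have "ln (4 * real n) \<le> ln (exp (2 * L))" using n0 by (intro ln_mono) auto
      then have "ln (4 * real n) \<le> 2 * L" by simp
      then have "D1 * ln (4 * real n) \<le> D1 * (2 * L)" using D10 by (intro mult_left_mono) auto
      also have "\<dots> = 2 * G" unfolding D1_def using L0 by simp
      finally show ?thesis by simp
    qed
    define M where "M = exp L"
    have Mm: "real m = M" using mL M_def by simp
    have M0: "16 \<le> M" using m16 Mm by simp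
    have "108 * real q1 * real n * exp (3 * g + D1 * ln (1 / (1 / (4 * real n)))) * t
        = 648 * (real q1 * real n * (real n * (real n + 1))) * exp (3 * g + D1 * ln (1 / (1 / (4 * real n))) + f)"
      unfolding t_def exp_add[of _ f] by simp
    also have "\<dots> \<le> 648 * ((9 * M) * (2 * M) * ((2 * M) * (3 * M))) * exp (3 * g + 2 * G + f)"
    proof (rule mult_mono)
      have "real n = 2 * M" unfolding n_def using Mm by simp
      then have nn: "real n \<le> 2 * M" "real n + 1 \<le> 3 * M" using M0 by linarith+
      have qq: "real q1 \<le> 9 * M" using q10 Mm by simp
      have "real q1 * real n * (real n * (real n + 1)) \<le> (9 * M) * (2 * M) * ((2 * M) * (3 * M))"
        by (rule mult_mono[OF mult_mono[OF qq nn(1)] mult_mono[OF nn]]) (use M0 in auto)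
      then show "648 * (real q1 * real n * (real n * (real n + 1))) \<le> 648 * ((9 * M) * (2 * M) * ((2 * M) * (3 * M)))" by (rule mult_left_mono) simp
      show "exp (3 * g + D1 * ln (1 / (1 / (4 * real n))) + f) \<le> exp (3 * g + 2 * G + f)" using Dl1 by simp
    qed (use M0 in auto)
    also have "\<dots> = 69984 * M ^ 4 * exp (3 * g + 2 * G + f)" by (simp add: eval_nat_numeral)
    also have "\<dots> \<le> M ^ 5 * M ^ 4 * exp (3 * g + 2 * G + f)"
    proof (intro mult_right_mono)
      have "(69984::real) \<le> 16 ^ 5" by simp
      also have "\<dots> \<le> M ^ 5" using M0 by (intro power_mono) auto
      finally show "69984 \<le> M ^ 5" .
    qed auto
    also have "M ^ 5 * M ^ 4 = M ^ 9" by (simp add: power_add[symmetric])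
    also have "M ^ 9 = exp (9 * L)" by (simp add: M_def exp_of_nat_mult[symmetric])
    also have "exp (9 * L) * exp (3 * g + 2 * G + f) = exp (9 * L + (3 * g + 2 * G + f))" by (rule exp_add[symmetric])
    also have "\<dots> \<le> exp F"
    proof -
      \<comment> \<open>This is the source of 113000, which exceeds
        \<open>3 * 37460 + 11/27\<close>.\<close>
      have "9 * L + (3 * g + 2 * G + f) \<le> 11 * G + 3 * (37460 * (G * r ^ 3)) + f" using GL gb by linarith
      also have "\<dots> \<le> f + 113000 * (G * r ^ 3)" using Gr3 G0 by linarith
      also have "\<dots> \<le> F" using F(1) by (simp add: mult.assoc)
      finally show ?thesis by simp
    qed
    also have "\<dots> \<le> real (card V)" by (rule F(2))
    finally show ?thesis .
  qed
  have symn: "(\<not> d x y) = (\<not> d y x)" for x y using sym[of x y] by simp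
  have "copy (\<lambda>x y. \<not> d x y) W1 E1 V \<or> sparse_pair (\<lambda>x y. \<not> d x y) (1 / (4 * real n)) n t V"
    by (rule fat_copy_or_sparse_pair_exp[OF symn g1(1) Wn(1) n0 D10 S1_def q1_def e1 t1 g0 clq V big])
  then have sp: "sparse_pair (\<lambda>x y. \<not> d x y) (1 / (4 * real n)) n t V" using no1 by blast
  have "copy (\<lambda>x y. \<not> \<not> d x y) W2 E2 V"
  proof (rule halve_step[OF symn V sp g2(1) Wn(2) n0 f])
    show "6 * real n * (real n + 1) * exp f \<le> t" unfolding t_def by simp
    show "copy (\<lambda>x y. \<not> \<not> d x y) W' E' X" if "simple_graph W' E'" "\<And>u. u \<in> W' \<Longrightarrow> nbrs E' u \<noteq> {}" "2 * card E' \<le> card E2"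
      "X \<subseteq> V" "exp f \<le> real (card X)" for W' E' X
      using IH[OF that] no1 copy_mono[OF _ that(4)] by simp blast
  qed
  then show False using no2 by simp
qed

section \<open>The exponent and the induction on the number of edges\<close>

definition loglog :: "real \<Rightarrow> real" where
  "loglog x = ln (ln (max 16 x))"

text \<open>Halving one argument lowers the exponent by at least \<open>3/20\<close>, here 195000
  units; this covers both kinds of halving, which cost 113000 and \<open>11 * 10000\<close>
  units.\<close>

definition ramsey_exponent :: "real \<Rightarrow> real \<Rightarrow> real" where
  "ramsey_exponent a b = 1300000 * ((a * b) powr (1/4) * loglog (a + b) powr (3/2))"

text \<open>As \<open>274/100\<close> exceeds \<open>e\<close>, its logarithm is at least 1, and
  comparing integer powers yields rational lower bounds for logarithms.\<close>

lemma ln_ge_ratio: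
  assumes "0 < q" "(274/100) ^ p \<le> z ^ q"
  shows "real p / real q \<le> ln (z::real)"
proof -
  have "1 \<le> ln (274/100 :: real)" using exp_1_le_274 by (subst ln_ge_iff) simp_all
  then have "real p * 1 \<le> real p * ln (274/100)" by (intro mult_left_mono) simp_all
  also have "\<dots> = ln ((274/100) ^ p)" by (simp only: ln_realpow)
  also have "\<dots> \<le> ln (z ^ q)" using assms(2) by (intro ln_mono) simp_all
  also have "\<dots> = real q * ln z" by (rule ln_realpow)
  finally show ?thesis using assms(1) by (simp add: divide_le_eq mult.commute)
qed

text \<open>The reason for cutting off at 16: the iterated logarithm is at least 1 from there on.
  The fraction \<open>137/50\<close> is the bound 2.74 for \<open>e\<close>.\<close>

lemma ln_16_ge: "exp 1 \<le> ln (16::real)"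
proof -
  have "(274/100) ^ 137 \<le> (16::real) ^ 50" by (simp add: power_divide)
  then have "real 137 / real 50 \<le> ln (16::real)" by (rule ln_ge_ratio[rotated]) simp
  then show ?thesis using exp_1_le_274 by simp
qed

lemma loglog_mono: "x \<le> y \<Longrightarrow> loglog x \<le> loglog y"
proof -
  assume xy: "x \<le> y"
  have "0 < ln (max 16 x)" by (intro ln_gt_zero) auto
  moreover have "ln (max 16 x) \<le> ln (max 16 y)" using xy by (intro ln_mono) auto
  ultimately show ?thesis unfolding loglog_def by (intro ln_mono) auto
qed

lemma loglog_ge_1: "1 \<le> loglog x"
proof -
  have "ln 16 \<le> ln (max 16 x)" by (intro ln_mono) auto
  then have "exp 1 \<le> ln (max 16 x)" using ln_16_ge by linarith
  then show ?thesis unfolding loglog_def by (subst ln_ge_iff) (auto intro: less_le_trans[OF exp_gt_zero])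
qed

lemma ramsey_exponent_commute: "ramsey_exponent a b = ramsey_exponent b a"
  unfolding ramsey_exponent_def by (simp add: mult.commute add.commute)

lemma ramsey_exponent_nonneg: "0 \<le> ramsey_exponent a b"
  unfolding ramsey_exponent_def by simp

lemma ramsey_exponent_mono:
  assumes "0 \<le> a'" "a' \<le> a" "0 \<le> b" shows "ramsey_exponent a' b \<le> ramsey_exponent a b"
proof -
  have "(a' * b) powr (1/4) \<le> (a * b) powr (1/4)" using assms by (intro powr_mono2 mult_right_mono) auto
  moreover have "loglog (a' + b) powr (3/2) \<le> loglog (a + b) powr (3/2)"
    using assms loglog_mono[of "a' + b" "a + b"] loglog_ge_1[of "a' + b"] by (intro powr_mono2) auto
  ultimately show ?thesis unfolding ramsey_exponent_def by (intro mult_left_mono mult_mono) auto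
qed

text \<open>The product under the fourth root is halved, and \<open>(17/20)^4\<close> exceeds
  \<open>1/2\<close>; the iterated logarithm can only decrease.\<close>

lemma ramsey_exponent_halve:
  assumes "0 \<le> a" "0 \<le> b"
  shows "ramsey_exponent (a/2) b + 195000 * ((a * b) powr (1/4) * loglog (a + b) powr (3/2)) \<le> ramsey_exponent a b"
proof -
  define G where "G = (a * b) powr (1/4)"
  define l where "l = loglog (a + b) powr (3/2)"
  have "(1/2) powr (1/4) \<le> ((17/20) ^ 4) powr (1/4 :: real)" by (intro powr_mono2) (auto simp: power_divide)
  also have "((17/20) ^ 4 :: real) = (17/20) powr 4" by (simp add: powr_numeral)
  also have "((17/20) powr 4) powr (1/4) = (17/20 :: real)" by (simp only: powr_powr) simp
  finally have h: "(1/2) powr (1/4) \<le> (17/20 :: real)" .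
  have "(a/2 * b) powr (1/4) = (1/2) powr (1/4) * G" unfolding G_def using assms by (subst powr_mult[symmetric]) auto
  also have "\<dots> \<le> 17/20 * G" using h unfolding G_def by (intro mult_right_mono) auto
  finally have 1: "(a/2 * b) powr (1/4) \<le> 17/20 * G" .
  have 2: "loglog (a/2 + b) powr (3/2) \<le> l" unfolding l_def
    using assms loglog_mono[of "a/2 + b" "a + b"] loglog_ge_1[of "a/2 + b"] by (intro powr_mono2) auto
  have "(a/2 * b) powr (1/4) * loglog (a/2 + b) powr (3/2) \<le> (17/20 * G) * l"
    using 1 2 by (intro mult_mono) (auto simp: G_def)
  then show ?thesis unfolding ramsey_exponent_def G_def[symmetric] l_def[symmetric] by simp
qed

lemma copy_empty: "copy c {} {} V"
  unfolding copy_def strict_mono_on_def by simp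

text \<open>If \<open>sqrt b * L\<close> is at most
  \<open>10000 * G * loglog (a + b) powr (3/2)\<close>, the plain greedy embedding is cheap enough
  and the larger graph is halved. Otherwise, as \<open>sqrt b = B * B\<close> and
  \<open>G = A * B\<close>, it follows that \<open>10000 * A < B * L\<close>; with
  \<open>B \<le> A\<close> this forces \<open>10000 \<le> L\<close>, so all hypotheses of the
  balanced step hold.\<close>

lemma ordered_ramsey_step:
  fixes E1 E2 :: "(nat \<times> nat) set"
  assumes sym: "\<And>x y. c x y = c y x" and V: "finite V"
    and g1: "simple_graph W1 E1" "\<And>u. u \<in> W1 \<Longrightarrow> nbrs E1 u \<noteq> {}"
    and g2: "simple_graph W2 E2" "\<And>u. u \<in> W2 \<Longrightarrow> nbrs E2 u \<noteq> {}"
    and ba: "card E2 \<le> card E1"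
    and sz: "exp (ramsey_exponent (real (card E1)) (real (card E2))) \<le> real (card V)"
    and IH1: "\<And>W' E' X. simple_graph W' E' \<Longrightarrow> (\<And>u. u \<in> W' \<Longrightarrow> nbrs E' u \<noteq> {}) \<Longrightarrow> card E' < card E1 \<Longrightarrow>
      X \<subseteq> V \<Longrightarrow> exp (ramsey_exponent (real (card E')) (real (card E2))) \<le> real (card X) \<Longrightarrow>
      copy (\<lambda>x y. \<not> c x y) W' E' X \<or> copy c W2 E2 X"
    and IH2: "\<And>W' E' X. simple_graph W' E' \<Longrightarrow> (\<And>u. u \<in> W' \<Longrightarrow> nbrs E' u \<noteq> {}) \<Longrightarrow> card E' < card E2 \<Longrightarrow>
      X \<subseteq> V \<Longrightarrow> exp (ramsey_exponent (real (card E1)) (real (card E'))) \<le> real (card X) \<Longrightarrow>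
      copy (\<lambda>x y. \<not> c x y) W1 E1 X \<or> copy c W' E' X"
  shows "copy (\<lambda>x y. \<not> c x y) W1 E1 V \<or> copy c W2 E2 V"
proof (cases "E2 = {}")
  case True
  then have "W2 = {}" using g2(2) unfolding nbrs_def by auto
  then show ?thesis using True copy_empty by blast
next
  case ne2: False
  have fE: "finite E1" "finite E2" using g1(1) g2(1) unfolding simple_graph_def
    by (elim conjE, intro finite_subset[of E1 "W1 \<times> W1"], auto, intro finite_subset[of E2 "W2 \<times> W2"], auto)
  have c2: "1 \<le> card E2" using ne2 fE by (auto simp: Suc_le_eq card_gt_0_iff)
  then have c1: "1 \<le> card E1" using ba by simp
  then have ne1: "E1 \<noteq> {}" by auto
  define a where "a = real (card E1)"
  define b where "b = real (card E2)"
  have ab: "1 \<le> b" "b \<le> a" "1 \<le> a" unfolding a_def b_def using c1 c2 ba by auto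
  define A where "A = a powr (1/4)"
  define B where "B = b powr (1/4)"
  define G where "G = (a * b) powr (1/4)"
  define lam where "lam = loglog (a + b)"
  define L where "L = ln (max 16 (real (card E1 + card E2)))"
  have GAB: "G = A * B" unfolding G_def A_def B_def using ab by (simp add: powr_mult)
  have A1: "1 \<le> A" "1 \<le> B" unfolding A_def B_def using ab by (auto intro: ge_one_powr_ge_zero)
  have BA: "B \<le> A" unfolding A_def B_def using ab by (intro powr_mono2) auto
  have lL: "lam = ln L" unfolding lam_def loglog_def L_def a_def b_def by simp
  have lam1: "1 \<le> lam" unfolding lam_def by (rule loglog_ge_1)
  have lp1: "1 \<le> lam powr (3/2)" using lam1 by (intro ge_one_powr_ge_zero) auto
  show ?thesis
  proof (cases "sqrt b * L \<le> 10000 * (G * lam powr (3/2))")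
    case True
    define f where "f = ramsey_exponent (a/2) b"
    have f0: "0 \<le> f" unfolding f_def by (rule ramsey_exponent_nonneg)
    have hv: "f + 195000 * (G * lam powr (3/2)) \<le> ramsey_exponent a b"
      unfolding f_def G_def lam_def using ramsey_exponent_halve[of a b] ab by simp
    have G0: "0 \<le> G * lam powr (3/2)" using A1 GAB by simp
    have Fb: "f + 11 * sqrt (real (card E2)) * L \<le> ramsey_exponent a b"
      using hv True G0 unfolding b_def[symmetric] by (simp add: mult.assoc)
    show ?thesis
    proof (rule step_unbalanced[OF sym V g1 g2 ne2 L_def f0 Fb])
      show "exp (ramsey_exponent a b) \<le> real (card V)" using sz unfolding a_def b_def .
      show "copy (\<lambda>x y. \<not> c x y) W' E' X \<or> copy c W2 E2 X"
        if w: "simple_graph W' E'" "\<And>u. u \<in> W' \<Longrightarrow> nbrs E' u \<noteq> {}" "2 * card E' \<le> card E1" "X \<subseteq> V" "exp f \<le> real (card X)" for W' E' X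
      proof (rule IH1[OF w(1,2) _ w(4)])
        show "card E' < card E1" using w(3) c1 by linarith
        have "real (card E') \<le> a/2" unfolding a_def using w(3) by linarith
        then have "ramsey_exponent (real (card E')) b \<le> f" unfolding f_def using ab by (intro ramsey_exponent_mono) auto
        then have "exp (ramsey_exponent (real (card E')) b) \<le> exp f" by simp
        then show "exp (ramsey_exponent (real (card E')) (real (card E2))) \<le> real (card X)" using w(5) unfolding b_def by linarith
      qed
    qed
  next
    case False
    have sqb: "sqrt b = B * B"
    proof -
      have "B * B = b powr (1/2)" unfolding B_def by (simp add: powr_add[symmetric])
      then show ?thesis using ab by (simp add: powr_half_sqrt)
    qed
    have "10000 * (A * B) * 1 \<le> 10000 * (A * B) * lam powr (3/2)" using lp1 A1 by (intro mult_left_mono) auto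
    then have "10000 * A * B < (B * L) * B" using False unfolding sqb GAB by (simp add: mult_ac)
    then have AL: "10000 * A < B * L" using A1 by (simp add: mult.commute)
    have L0: "0 \<le> L" unfolding L_def by simp
    have "B * L \<le> A * L" using BA L0 by (rule mult_right_mono)
    then have "10000 * A < L * A" using AL by (simp add: mult.commute)
    then have L4: "10000 \<le> L" using A1 by simp
    have L': "L = ln (real (card E1 + card E2))"
    proof (cases "16 \<le> real (card E1 + card E2)")
      case False
      then have "L = ln 16" unfolding L_def by simp
      moreover have "ln (16::real) \<le> 16 - 1" by (rule ln_le_minus_one) simp
      ultimately show ?thesis using L4 by linarith
    qed (simp add: L_def)
    have AL': "A \<le> B * L" using AL A1 by linarith
    define r where "r = sqrt (ln L)"
    have r3: "lam powr (3/2) = r ^ 3"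
    proof -
      have "r ^ 3 = (lam powr (1/2)) ^ 3" unfolding r_def lL[symmetric] using lam1 by (simp add: powr_half_sqrt)
      also have "\<dots> = (lam powr (1/2)) powr 3" using lam1 by (subst powr_realpow[symmetric]) auto
      also have "\<dots> = lam powr (3/2)" by (simp add: powr_powr)
      finally show ?thesis by simp
    qed
    define f where "f = ramsey_exponent a (b/2)"
    have f0: "0 \<le> f" unfolding f_def by (rule ramsey_exponent_nonneg)
    have "ramsey_exponent (b/2) a + 195000 * ((b * a) powr (1/4) * loglog (b + a) powr (3/2)) \<le> ramsey_exponent b a"
      using ramsey_exponent_halve[of b a] ab by simp
    then have hv: "f + 195000 * (G * r ^ 3) \<le> ramsey_exponent a b"
      unfolding f_def G_def r3[symmetric] lam_def by (simp add: ramsey_exponent_commute[of a] mult.commute[of a] add.commute[of a])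
    have "0 \<le> G * r ^ 3" using A1 GAB lp1 unfolding r3[symmetric] by simp
    then have Fb: "f + 113000 * G * r ^ 3 \<le> ramsey_exponent a b" using hv by (simp add: mult.assoc)
    show ?thesis
    proof (rule step_balanced[OF sym V g1 ne1 g2 ne2 _ _ GAB BA AL' L' L4 r_def f0 Fb])
      show "A = real (card E1) powr (1/4)" "B = real (card E2) powr (1/4)" unfolding A_def B_def a_def b_def by auto
      show "exp (ramsey_exponent a b) \<le> real (card V)" using sz unfolding a_def b_def .
      show "copy (\<lambda>x y. \<not> c x y) W1 E1 X \<or> copy c W' E' X"
        if w: "simple_graph W' E'" "\<And>u. u \<in> W' \<Longrightarrow> nbrs E' u \<noteq> {}" "2 * card E' \<le> card E2" "X \<subseteq> V" "exp f \<le> real (card X)" for W' E' X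
      proof (rule IH2[OF w(1,2) _ w(4)])
        show "card E' < card E2" using w(3) c2 by linarith
        have "real (card E') \<le> b/2" unfolding b_def using w(3) by linarith
        then have "ramsey_exponent (real (card E')) a \<le> ramsey_exponent (b/2) a" using ab by (intro ramsey_exponent_mono) auto
        then have "exp (ramsey_exponent a (real (card E'))) \<le> exp f" unfolding f_def by (simp add: ramsey_exponent_commute[of a])
        then show "exp (ramsey_exponent (real (card E1)) (real (card E'))) \<le> real (card X)" using w(5) unfolding a_def by linarith
      qed
    qed
  qed
qed

text \<open>The step wants the graph with more edges first. If it comes second, negating
  \<open>c\<close> exchanges the colours, and the exponent is symmetric; the induction is therefore
  over all colourings.\<close>

lemma ordered_ramsey_copies:
  assumes "\<And>x y. c x y = c y x" "finite V"
    "simple_graph W1 E1" "\<And>u. u \<in> W1 \<Longrightarrow> nbrs E1 u \<noteq> {}" "simple_graph W2 E2" "\<And>u. u \<in> W2 \<Longrightarrow> nbrs E2 u \<noteq> {}"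
    "exp (ramsey_exponent (real (card E1)) (real (card E2))) \<le> real (card V)"
  shows "copy (\<lambda>x y. \<not> c x y) W1 E1 V \<or> copy c W2 E2 V"
  using assms
proof (induction "card E1 + card E2" arbitrary: c V W1 E1 W2 E2 rule: less_induct)
  case less
  have symn: "(\<not> c x y) = (\<not> c y x)" for x y using less.prems(1)[of x y] by simp
  have IH1: "copy (\<lambda>x y. \<not> c x y) W' E' X \<or> copy c W2 E2 X"
    if w: "simple_graph W' E'" "\<And>u. u \<in> W' \<Longrightarrow> nbrs E' u \<noteq> {}" "card E' < card E1" "X \<subseteq> V"
      "exp (ramsey_exponent (real (card E')) (real (card E2))) \<le> real (card X)" for W' E' X
    by (rule less.hyps[OF _ less.prems(1) finite_subset[OF w(4) less.prems(2)] w(1,2) less.prems(5,6) w(5)]) (use w(3) in auto)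
  have IH2: "copy (\<lambda>x y. \<not> c x y) W1 E1 X \<or> copy c W' E' X"
    if w: "simple_graph W' E'" "\<And>u. u \<in> W' \<Longrightarrow> nbrs E' u \<noteq> {}" "card E' < card E2" "X \<subseteq> V"
      "exp (ramsey_exponent (real (card E1)) (real (card E'))) \<le> real (card X)" for W' E' X
    by (rule less.hyps[OF _ less.prems(1) finite_subset[OF w(4) less.prems(2)] less.prems(3,4) w(1,2) w(5)]) (use w(3) in auto)
  show ?case
  proof (cases "card E2 \<le> card E1")
    case True
    show ?thesis
      by (rule ordered_ramsey_step[OF less.prems(1-6) True less.prems(7) IH1 IH2])
  next
    case False
    then have le: "card E1 \<le> card E2" by simp
    have "copy (\<lambda>x y. \<not> \<not> c x y) W2 E2 V \<or> copy (\<lambda>x y. \<not> c x y) W1 E1 V"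
    proof (rule ordered_ramsey_step[OF symn less.prems(2) less.prems(5,6) less.prems(3,4) le])
      show "exp (ramsey_exponent (real (card E2)) (real (card E1))) \<le> real (card V)"
        using less.prems(7) by (simp add: ramsey_exponent_commute)
      show "copy (\<lambda>x y. \<not> \<not> c x y) W' E' X \<or> copy (\<lambda>x y. \<not> c x y) W1 E1 X"
        if w: "simple_graph W' E'" "\<And>u. u \<in> W' \<Longrightarrow> nbrs E' u \<noteq> {}" "card E' < card E2" "X \<subseteq> V"
          "exp (ramsey_exponent (real (card E')) (real (card E1))) \<le> real (card X)" for W' E' X
        using IH2[OF w(1-4)] w(5) by (auto simp: ramsey_exponent_commute[of "real (card E1)"])
      show "copy (\<lambda>x y. \<not> \<not> c x y) W2 E2 X \<or> copy (\<lambda>x y. \<not> c x y) W' E' X"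
        if w: "simple_graph W' E'" "\<And>u. u \<in> W' \<Longrightarrow> nbrs E' u \<noteq> {}" "card E' < card E1" "X \<subseteq> V"
          "exp (ramsey_exponent (real (card E2)) (real (card E'))) \<le> real (card X)" for W' E' X
        using IH1[OF w(1-4)] w(5) by (auto simp: ramsey_exponent_commute[of "real (card E2)"])
    qed
    then show ?thesis by auto
  qed
qed

section \<open>The bound on the ordered Ramsey number\<close>

definition oedges :: "ograph \<Rightarrow> (nat \<times> nat) set" where
  "oedges H = {(u, v). u < v \<and> {u, v} \<in> edges H}"

lemma nsets_2_E:
  assumes "e \<in> nsets W 2" obtains u v where "e = {u, v}" "u < v" "u \<in> W" "v \<in> (W :: nat set)"
proof -
  have e: "e \<subseteq> W" "card e = 2" using assms unfolding nsets_def by auto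
  then obtain x y where xy: "e = {x, y}" "x \<noteq> y" by (meson card_2_iff)
  show thesis
  proof (cases "x < y")
    case True
    then show thesis using that[of x y] xy e(1) by auto
  next
    case False
    then have "y < x" using xy(2) by simp
    then show thesis using that[of y x] xy e(1) by auto
  qed
qed

lemma simple_graph_oedges:
  assumes "ordered_graph H" shows "simple_graph (verts H) (oedges H)"
proof -
  have "u \<in> verts H \<and> v \<in> verts H" if "{u, v} \<in> edges H" for u v
    using assms that unfolding ordered_graph_def nsets_def by blast
  then show ?thesis unfolding simple_graph_def oedges_def by auto
qed

lemma nbrs_oedges:
  assumes "ordered_graph H" "no_isolated_vertices H" "u \<in> verts H" shows "nbrs (oedges H) u \<noteq> {}"
proof -
  obtain e where e: "e \<in> edges H" "u \<in> e" using assms(2,3) unfolding no_isolated_vertices_def by blast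
  then have "e \<in> nsets (verts H) 2" using assms(1) unfolding ordered_graph_def by blast
  then obtain x y where "e = {x, y}" "x < y" by (rule nsets_2_E)
  then have "(x, y) \<in> oedges H" "u = x \<or> u = y" using e unfolding oedges_def by auto
  then show ?thesis unfolding nbrs_def by auto
qed

lemma card_oedges:
  assumes "ordered_graph H" shows "card (oedges H) = card (edges H)"
proof (rule bij_betw_same_card[of "\<lambda>(u, v). {u, v}"])
  show "bij_betw (\<lambda>(u, v). {u, v}) (oedges H) (edges H)"
    unfolding bij_betw_def
  proof
    show "inj_on (\<lambda>(u, v). {u, v}) (oedges H)"
      unfolding oedges_def by (auto simp: inj_on_def doubleton_eq_iff)
    have "e \<in> (\<lambda>(u, v). {u, v}) ` oedges H" if "e \<in> edges H" for e
    proof -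
      have "e \<in> nsets (verts H) 2" using assms that unfolding ordered_graph_def by blast
      then obtain x y where "e = {x, y}" "x < y" by (rule nsets_2_E)
      then show ?thesis using that unfolding oedges_def by force
    qed
    then show "(\<lambda>(u, v). {u, v}) ` oedges H = edges H" unfolding oedges_def by auto
  qed
qed

lemma contains_ordered_if_copy:
  assumes H: "ordered_graph H" and cp: "copy (\<lambda>x y. \<chi> {x, y} = k) (verts H) (oedges H) {1..N}"
  shows "contains_ordered (colour_class N \<chi> k) H"
proof -
  obtain \<phi> where p: "strict_mono_on (verts H) \<phi>" "\<phi> ` verts H \<subseteq> {1..N}" "\<forall>(u, v)\<in>oedges H. \<chi> {\<phi> u, \<phi> v} = k"
    using cp unfolding copy_def by blast
  have main: "{\<phi> i, \<phi> j} \<in> edges (colour_class N \<chi> k)" if ij: "i \<in> verts H" "j \<in> verts H" "{i, j} \<in> edges H" "i < j" for i j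
  proof -
    have "\<phi> i < \<phi> j" using p(1) ij unfolding strict_mono_on_def by blast
    moreover have "\<phi> i \<in> {1..N}" "\<phi> j \<in> {1..N}" using p(2) ij by blast+
    ultimately have "{\<phi> i, \<phi> j} \<in> nsets {1..N} 2" unfolding nsets_def by auto
    moreover have "\<chi> {\<phi> i, \<phi> j} = k" using p(3) ij unfolding oedges_def by blast
    ultimately show ?thesis unfolding colour_class_def by simp
  qed
  have "{\<phi> i, \<phi> j} \<in> edges (colour_class N \<chi> k)" if ij: "i \<in> verts H" "j \<in> verts H" "{i, j} \<in> edges H" for i j
  proof -
    have "{i, j} \<in> nsets (verts H) 2" using H ij(3) unfolding ordered_graph_def by blast
    then have "i \<noteq> j" unfolding nsets_def by auto
    then consider "i < j" | "j < i" by linarith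
    then show ?thesis
    proof cases
      case 1
      then show ?thesis using main ij by blast
    next
      case 2
      have "{j, i} \<in> edges H" using ij(3) by (simp add: insert_commute)
      then show ?thesis using main[OF ij(2,1) _ 2] by (simp add: insert_commute)
    qed
  qed
  moreover have "\<phi> ` verts H \<subseteq> verts (colour_class N \<chi> k)" using p(2) unfolding colour_class_def by simp
  ultimately show ?thesis unfolding contains_ordered_def using p(1) by blast
qed

section \<open>Numerical bounds for at most sixteen edges, and the final theorem\<close>

lemma ln_2_le: "ln 2 \<le> (7/10::real)"
proof -
  have "(2::real) \<le> (1 + (7/10) / real 50) ^ 50" by (simp add: power_divide)
  also have "\<dots> \<le> exp (7/10)" by (rule exp_ge_one_plus_x_over_n_power_n) auto
  finally have "ln 2 \<le> ln (exp (7/10::real))" by (intro ln_mono) simp_all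
  then show ?thesis by simp
qed

text \<open>The value \<open>87/80\<close> is chosen for \<open>1 - 80/87\<close> to exceed
  \<open>(28/100)^2\<close>, the least absolute value of the iterated logarithm that the small cases
  can afford.\<close>

lemma ln_3_ge: "87/80 \<le> ln (3::real)"
proof -
  have "(274/100) ^ 87 \<le> (3::real) ^ 80" by (simp add: power_divide)
  then have "real 87 / real 80 \<le> ln (3::real)" by (rule ln_ge_ratio[rotated]) simp
  then show ?thesis by simp
qed

lemma loglog_small: "x \<le> 16 \<Longrightarrow> loglog x powr (3/2) \<le> 121/100"
proof -
  assume "x \<le> 16"
  then have ll: "loglog x = ln (ln 16)" unfolding loglog_def by simp
  have "ln (16::real) = 4 * ln 2" using ln_realpow[of 2 4] by simp
  then have "ln (16::real) \<le> 28/10" using ln_2_le by linarith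
  also have "\<dots> \<le> (1 + (11/10) / real 10) ^ 10" by (simp add: power_divide)
  also have "\<dots> \<le> exp (11/10)" by (rule exp_ge_one_plus_x_over_n_power_n) auto
  finally have "ln (ln 16) \<le> ln (exp (11/10::real))" by (intro ln_mono) simp_all
  then have "ln (ln 16) \<le> (11/10::real)" by simp
  then have "loglog x powr (3/2) \<le> loglog x powr 2" "loglog x \<le> 11/10"
    using loglog_ge_1[of x] unfolding ll by (auto intro: powr_mono)
  moreover have "loglog x powr 2 = loglog x * loglog x" using loglog_ge_1[of x] by (simp add: powr_numeral power2_eq_square)
  moreover have "loglog x * loglog x \<le> (11/10) * (11/10)" using \<open>loglog x \<le> 11/10\<close> loglog_ge_1[of x] by (intro mult_mono) auto
  ultimately show ?thesis by simp
qed

text \<open>For two edges in total, \<open>ln (ln 2)\<close> is negative; the library extends \<open>ln\<close> as an even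
  function, so that the power there is that of the absolute value.\<close>

lemma loglog_le_powr_ln_ln:
  assumes m: "2 \<le> m"
  shows "1300001 * loglog (real m) powr (3/2) \<le> 10 ^ 8 * ln (ln (real m)) powr (3/2)"
proof (cases "16 \<le> m")
  case True
  then have "loglog (real m) = ln (ln (real m))" unfolding loglog_def by simp
  then show ?thesis by (simp add: mult_right_mono)
next
  case False
  \<comment> \<open>Below 16 edges \<open>loglog\<close> contributes at most \<open>121/100\<close>,
    so a power of at least \<open>2/100\<close> on the right is enough:
    \<open>10 ^ 8 * 2/100\<close> exceeds \<open>1300001 * 121/100\<close>. The base
    \<open>(28/100)^2\<close> turns the exponent \<open>3/2\<close> into a cube.\<close>
  have lo: "(2/100::real) \<le> z powr (3/2)" if "(28/100)^2 \<le> z" for z :: real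
  proof -
    have "((28/100) powr 2) powr (3/2) = (28/100::real) powr 3" by (simp only: powr_powr) simp
    moreover have "(28/100::real) powr 2 = (28/100)^2" "(28/100::real) powr 3 = (28/100)^3" by (simp_all add: powr_numeral)
    ultimately have "((28/100)^2) powr (3/2) = (28/100::real)^3" by simp
    moreover have "((28/100)^2) powr (3/2) \<le> z powr (3/2)" using that by (intro powr_mono2) auto
    moreover have "(2/100::real) \<le> (28/100)^3" by (simp add: power_divide)
    ultimately show ?thesis by linarith
  qed
  have "(2/100::real) \<le> ln (ln (real m)) powr (3/2)"
  proof (cases "m = 2")
    case True
    have "ln (ln 2) \<le> ln 2 - (1::real)" by (rule ln_le_minus_one) simp
    then have "(28/100)^2 \<le> - ln (ln (2::real))" using ln_2_le by (simp add: power_divide)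
    then have "(2/100::real) \<le> (- ln (ln 2)) powr (3/2)" by (rule lo)
    moreover have "(- ln (ln 2)) powr (3/2) = ln (ln (2::real)) powr (3/2)" by (simp add: powr_def ln_minus)
    ultimately show ?thesis using True by simp
  next
    case f: False
    then have "3 \<le> real m" using m by simp
    then have "ln 3 \<le> ln (real m)" by (intro ln_mono) auto
    then have l: "87/80 \<le> ln (real m)" using ln_3_ge by linarith
    have "ln (80/87) \<le> 80/87 - (1::real)" by (rule ln_le_minus_one) simp
    moreover have "ln (87/80) = - ln (80/87 :: real)" by (simp add: ln_div)
    moreover have "ln (87/80) \<le> ln (ln (real m))" using l by (intro ln_mono) auto
    ultimately have "(28/100)^2 \<le> ln (ln (real m))" by (simp add: power_divide)
    then show ?thesis by (rule lo)
  qed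
  moreover have "loglog (real m) powr (3/2) \<le> 121/100" using False by (intro loglog_small) simp
  ultimately show ?thesis by simp
qed

theorem theorem2p1:
  fixes H1 H2 :: ograph and m1 m2 :: nat
  assumes "ordered_graph H1" and "ordered_graph H2"
    and "no_isolated_vertices H1" and "no_isolated_vertices H2"
    and "card (edges H1) = m1" and "card (edges H2) = m2"
  shows "real (ordered_ramsey H1 H2) \<le>
    exp (10 ^ 8 * (real m1 * real m2) powr (1/4) * (ln (ln (real (m1 + m2)))) powr (3/2))"
proof -
  define Z where "Z = 10 ^ 8 * (real m1 * real m2) powr (1/4) * (ln (ln (real (m1 + m2)))) powr (3/2)"
  define N where "N = nat \<lfloor>exp Z\<rfloor>"
  have NZ: "real N \<le> exp Z" unfolding N_def by (simp add: of_nat_floor)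
  have big: "exp (ramsey_exponent (real m1) (real m2)) \<le> real N"
  \<comment> \<open>Here \<open>0 powr (1/4) = 0\<close>, so both exponents vanish and
    \<open>N = 1\<close>.\<close>
  proof (cases "m1 = 0 \<or> m2 = 0")
    case True
    then have "ramsey_exponent (real m1) (real m2) = 0" "Z = 0" unfolding ramsey_exponent_def Z_def by auto
    then show ?thesis unfolding N_def by simp
  next
    case False
    define G where "G = (real m1 * real m2) powr (1/4)"
    define y where "y = (ln (ln (real (m1 + m2)))) powr (3/2)"
    define l where "l = loglog (real (m1 + m2)) powr (3/2)"
    have "1 * 1 \<le> real m1 * real m2" using False by (intro mult_mono) auto
    then have G1: "1 \<le> G" unfolding G_def by (intro ge_one_powr_ge_zero) auto
    have l1: "1 \<le> l" unfolding l_def using loglog_ge_1 by (intro ge_one_powr_ge_zero) auto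
    have "2 \<le> m1 + m2" using False by simp
    then have ly: "1300001 * l \<le> 10 ^ 8 * y" unfolding l_def y_def by (rule loglog_le_powr_ln_ln)
    have re: "ramsey_exponent (real m1) (real m2) = 1300000 * (G * l)" unfolding ramsey_exponent_def G_def l_def by simp
    \<comment> \<open>The surplus unit of 1300001 over 1300000 at least doubles the exponential,
      which leaves room for rounding \<open>exp Z\<close> down to \<open>N\<close>.\<close>
    have "1 * 1 \<le> G * l" using G1 l1 by (intro mult_mono) auto
    then have "1300000 * (G * l) + 1 \<le> G * (1300001 * l)" by simp
    also have "\<dots> \<le> G * (10 ^ 8 * y)" using ly G1 by (intro mult_left_mono) auto
    also have "\<dots> = Z" unfolding Z_def G_def y_def by simp
    finally have "exp (1300000 * (G * l) + 1) \<le> exp Z" by simp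
    moreover have "exp (1300000 * (G * l) + 1) = exp 1 * exp (1300000 * (G * l))" by (simp add: exp_add)
    moreover have "2 * exp (1300000 * (G * l)) \<le> exp 1 * exp (1300000 * (G * l))"
      using exp_ge_add_one_self[of 1] by (intro mult_right_mono) auto
    moreover have "1 \<le> exp (1300000 * (G * l))" using \<open>1 * 1 \<le> G * l\<close> by simp
    ultimately have "exp (1300000 * (G * l)) + 1 \<le> exp Z" by linarith
    then show ?thesis unfolding re N_def by linarith
  qed
  have "contains_ordered (colour_class N \<chi> Red) H1 \<or> contains_ordered (colour_class N \<chi> Blue) H2" for \<chi>
  proof -
    define c where "c x y \<longleftrightarrow> \<chi> {x, y} = Blue" for x y :: nat
    have sym: "c x y = c y x" for x y unfolding c_def by (simp add: insert_commute)
    have sz: "exp (ramsey_exponent (real (card (oedges H1))) (real (card (oedges H2)))) \<le> real (card {1..N})"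
      using big card_oedges assms by simp
    have "copy (\<lambda>x y. \<not> c x y) (verts H1) (oedges H1) {1..N} \<or> copy c (verts H2) (oedges H2) {1..N}"
      by (rule ordered_ramsey_copies[OF sym _ simple_graph_oedges[OF assms(1)] nbrs_oedges[OF assms(1,3)]
            simple_graph_oedges[OF assms(2)] nbrs_oedges[OF assms(2,4)] sz]) auto
    moreover have "(\<lambda>x y. \<not> c x y) = (\<lambda>x y. \<chi> {x, y} = Red)" unfolding c_def by (metis colour.exhaust colour.distinct(1))
    moreover have "c = (\<lambda>x y. \<chi> {x, y} = Blue)" unfolding c_def by (intro ext) simp
    ultimately show ?thesis using contains_ordered_if_copy assms(1,2) by metis
  qed
  then have "ordered_ramsey H1 H2 \<le> N" unfolding ordered_ramsey_def by (intro Least_le) blast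
  then have "real (ordered_ramsey H1 H2) \<le> real N" by simp
  then show ?thesis using NZ unfolding Z_def by linarith
qed

end
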